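(* Fix $C_{\rm comp}\ge1$, $m_0\in\mathbb N$ and $\varepsilon>0$. Let $0<\delta\le a\le b\le r\le1$, put $h=c_0a$, and let $\mathcal T=\bigsqcup_{B\in\mathcal B}\mathcal T_B$ be a finite labelled family with measurable shading $Y$ and $M(Y)>0$. Assume: (F1) every $B\in\mathcal B$ is a labelled rectangular box, with an ordered orthonormal side frame, of dimensions comparable to $a\times b\times r$, and every $T\in\mathcal T_B$ is a labelled $\delta\times\delta\times r$ child contained in $B$, with measurable shading $Y(T)\subset T$; (F2) for some $D>0$ and $\kappa_D\ge1$, $D\le D_B:=\sum_{T\in\mathcal T_B}|T|\le\kappa_DD$ for every $B\in\mathcal B$; (F3) with $\mathcal Q_h(Y)=\{Q\in\mathcal Q_h:\sum_{B}\sum_{T\in\mathcal T_B}|Y(T)\cap Q|>0\}$, one has $|\mathcal T|+|\mathcal B|+|\mathcal Q_h(Y)|\le\delta^{-C_{\rm comp}}$; (F4) one of the following alternatives is designated for the whole family: - (ordinary) with one common constant $C_F$, for every $B$ and every convex $K\subset B$, $\frac{\#\{T\in\mathcal T_B:T\subset K\}}{|\mathcal T_B|}\le C_F\frac{|K|}{|B|}$; - (biased) for one fixed $0<\sigma\le1$ and one common constant $C_0$, for every $B$ and every convex $K\subset B$, $\frac{\#\{T\in\mathcal T_B:T\subset K\}}{|\mathcal T_B|}\le C_0\bigl(\frac{|K|}{|B|}\bigr)^{1+\sigma}$; - (coarse) there is one scale $\delta\le\rho\le a$ and, for every $B$, a nonempty labelled family $\mathbb S_B$ of $\rho\times\rho\times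 r$ capped tubes contained in $B$ with $\frac{\#\{S\in\mathbb S_B:S\subset K\}}{|\mathbb S_B|}\le C_F\frac{|K|}{|B|}$ for every convex $K\subset B$, with common $C_F$; fine and coarse carriers use the same length window $[c_{\rm len}r,C_{\rm len}r]$ and the same endcap convention; each $T\in\mathcal T_B$ is assigned to one $S(T)\in\mathbb S_B$ with $T\subset S(T)$; and for some $m_B\ge1$ the number $n_S$ of $T\in\mathcal T_B$ assigned to $S$ satisfies $m_B\le n_S\le R_{\rm br}m_B$ for all $S\in\mathbb S_B$, with one common factor $R_{\rm br}\ge1$. Let $E^+$ be the positive parent–cell graph obtained after the common inner-level selection (see context), $N_{\max}=\max_B|\mathcal T_B|$, $e_+=|E^+|$, and $$\mathfrak L_0=4\bigl(1+\lceil\log_2N_{\max}\rceil\bigr)\bigl(1+\lceil\log_2(2e_+)\rceil\bigr)\bigl(1+\lceil\log_2e_+\rceil\bigr).$$ Then there exist a retained edge set $E_2\subset E^+$ with $$\mathcal B'=\{B:\exists Q,\ (B,Q)\in E_2\},\quad \mathcal T'=\bigsqcup_{B\in\mathcal B'}\mathcal T_B,\quad Z(B)=\bigcup_{Q:(B,Q)\in E_2}Q\subset\widetilde B,\quad Y_1(T)=Y_0(T)\cap Z(B)\ (T\in\mathcal T_B),$$ and numbers $\mu_{\rm in},d_0\ge1$ such that $M(Y_1)\ge\mathfrak L_0^{-1}M(Y)$; $Y_1(T)\subset Z(B)$ for $T\in\mathcal T_B$; $\mu_{\rm in}\le\sum_{T\in\mathcal T_B}\mathbf 1_{Y_1(T)}<2\mu_{\rm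 in}$ on $U(\mathcal T_B,Y_1)$; $d_0\le\sum_B\mathbf 1_{Z(B)}<2d_0$ on $\bigcup_BZ(B)$; and $\sum_{T\in\mathcal T}\mathbf 1_{Y_1(T)}<4\mu_{\rm in}d_0$ everywhere. Writing $\widetilde{\mathcal B}'=\{\widetilde B:B\in\mathcal B'\}$ (labelled), with implicit constants depending only on $\varepsilon$, $\sigma$ (where applicable), the fixed comparison constants and $C_{\rm comp}$: in the biased alternative $$\lambda(\widetilde{\mathcal B}',Z)\gtrsim C_0^{-(2-\sigma)}(a/b)^{\varepsilon}\kappa_D^{-(2-\sigma)}\mathfrak L_0^{-(2-\sigma)}\lambda(\mathcal T,Y)^{2-\sigma};$$ in the ordinary alternative $$\lambda(\widetilde{\mathcal B}',Z)\gtrsim C_F^{-1}[\log(2b/a)]^{-1}\kappa_D^{-2}\mathfrak L_0^{-2}\lambda(\mathcal T,Y)^2;$$ in the coarse alternative $$\lambda(\widetilde{\mathcal B}',Z)\gtrsim C_F^{-1}R_{\rm br}^{-3}[\log(2b/a)]^{-1}\kappa_D^{-2}\mathfrak L_0^{-2}\lambda(\mathcal T,Y)^2 .$$ Furthermore, let $E^{(m)}\subset\cdots\subset E^{(1)}\subset E^{(0)}=E_2$, $m\le m_0$, and put $Z^{(j)}(B)=\bigcup_{Q:(B,Q)\in E^{(j)}}Q$ and $Y^{(j)}(T)=Y_1(T)\cap Z^{(j)}(B)$ for $T\in\mathcal T_B$. If $\sum_B|Z^{(j)}(B)|\ge c_j\sum_B|Z^{(j-1)}(B)|$ with $0<c_j\le1$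 for $1\le j\le m$, then $$M(Y^{(m)})\ge\mathfrak L_0^{-1}2^{-m}\prod_{j=1}^mc_j\,M(Y)=\mathfrak L^{-1}M(Y),\qquad \mathfrak L:=\mathfrak L_0\prod_{j=1}^m\frac{2}{c_j},$$ and if all $c_j\ge c_{\min}>0$ then $\mathfrak L\le\mathfrak L_0(2/c_{\min})^{m_0}$. At every stage $j$: $Z^{(j)}(B)=\mathcal C_h(U(\mathcal T_B,Y^{(j)}))$; $\mu_{\rm in}\le\sum_{T\in\mathcal T_B}\mathbf 1_{Y^{(j)}(T)}<2\mu_{\rm in}$ on $U(\mathcal T_B,Y^{(j)})$; and $\sum_{T\in\mathcal T}\mathbf 1_{Y^{(j)}(T)}<4\mu_{\rm in}d_0$ everywhere. (A dyadic right-degree re-regularization, which must keep all edges at every selected cell, counts as one of the $m$ stages.)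
   Context: All families are finite and labelled: coincident geometric carriers with different labels are kept distinct, and all sums and counts are over labels. $|\cdot|$ of a set is Lebesgue measure in $\mathbb R^3$; of a family, labelled cardinality. For a labelled family $\mathcal F$ with measurable shading $Y(F)\subset F$: $U(\mathcal F,Y)=\bigcup_FY(F)$, $M(Y)=\sum_F|Y(F)|$, $\lambda(\mathcal F,Y)=M(Y)/\sum_F|F|$. Tubes: a (capped) $w\times w\times r$ tube is the closed neighbourhood, of radius comparable to $w$ with fixed structural constants, of a segment (its carrier) of length in $[c_{\rm len}r,C_{\rm len}r]$; endpoint caps are included. The structural constants are fixed once and for all. Grid: $0<c_0\le10^{-3}$ is fixed, $h=c_0a$, $\mathcal Q_h=\{h(k+[0,1)^3):k\in\mathbb Z^3\}$, and $\mathcal C_h(E)$ is the union of all cells of $\mathcal Q_h$ meeting $E$. For a box $B$, $\widetilde B$ is the concentric box with the same axes whose half-side lengths are those of $B$ increased by $\sqrt3h$; it keeps the label of $B$, and shadings $Z(B)$ of parents are subsets of $\widetilde B$. Common inner level and positive graph: put $f_B(x)=\sum_{T\in\mathcal T_B}\mathbf 1_{Y(T)}(x)$; choose $k_0\in\{0,\dots,\lceil\log_2N_{\max}\rceil\}$ such that $Y_0(T):=Y(T)\cap\{x:2^{k_0}\le f_B(x)<2^{k_0+1}\}$ $(T\in\mathcal T_B)$ satisfies $M(Y_0)\ge(1+\lceil\log_2N_{\max}\rceil)^{-1}M(Y)$, and put $\mu_{\rm in}=2^{k_0}$. Set $\omega_{BQ}=\sum_{T\in\mathcal T_B}|Y_0(T)\cap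 Q|$ and $E^+=\{(B,Q)\in\mathcal B\times\mathcal Q_h:\omega_{BQ}>0\}$. Shadings $Y_1,Y^{(j)}$ are total functions, equal to $\varnothing$ for children of non-retained parents. *)

theory Defs
  imports "HOL-Analysis.Analysis"
begin

type_synonym pt = "real ^ 3"

text \<open>A finite labelled family is a finite set of labels together with a map from labels to
  sets; labels are natural numbers, which loses nothing for finite families and keeps the implied
  constants independent of any label type.\<close>

type_synonym label = nat

abbreviation vol :: "pt set \<Rightarrow> real"
  where "vol E \<equiv> measure lebesgue E"

definition shadow :: "label set \<Rightarrow> (label \<Rightarrow> pt set) \<Rightarrow> pt set"
  where "shadow F Y = (\<Union>t\<in>F. Y t)"

definition mass :: "label set \<Rightarrow> (label \<Rightarrow> pt set) \<Rightarrow> real"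
  where "mass F Y = (\<Sum>t\<in>F. vol (Y t))"

definition shading_density :: "label set \<Rightarrow> (label \<Rightarrow> pt set) \<Rightarrow> (label \<Rightarrow> pt set) \<Rightarrow> real"
  where "shading_density F carrier Y = mass F Y / (\<Sum>t\<in>F. vol (carrier t))"

definition multiplicity_at :: "label set \<Rightarrow> (label \<Rightarrow> pt set) \<Rightarrow> pt \<Rightarrow> real"
  where "multiplicity_at F Y x = (\<Sum>t\<in>F. indicat_real (Y t) x)"


text \<open>The constants fixed once and for all: tube length window, comparability windows for tube
  radii and for box side lengths, and the ratio of the grid spacing to \<open>a\<close>.\<close>

record structure_constants =
  len_lo :: real
  len_hi :: real
  rad_lo :: real
  rad_hi :: real
  side_lo :: real
  side_hi :: real
  grid_ratio :: real

definition admissible_constants :: "structure_constants \<Rightarrow> bool"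
  where "admissible_constants K \<longleftrightarrow>
    0 < len_lo K \<and> len_lo K \<le> len_hi K \<and>
    0 < rad_lo K \<and> rad_lo K \<le> rad_hi K \<and>
    0 < side_lo K \<and> side_lo K \<le> side_hi K \<and>
    0 < grid_ratio K \<and> grid_ratio K \<le> 1 / 10 ^ 3"

definition is_tube :: "structure_constants \<Rightarrow> real \<Rightarrow> real \<Rightarrow> pt set \<Rightarrow> bool"
  where "is_tube K w r X \<longleftrightarrow>
    (\<exists>p q s. len_lo K * r \<le> dist p q \<and> dist p q \<le> len_hi K * r \<and>
             rad_lo K * w \<le> s \<and> s \<le> rad_hi K * w \<and>
             X = {x. infdist x (closed_segment p q) \<le> s})"

record obox =
  center :: pt
  frame :: "3 \<Rightarrow> pt"
  halfside :: "3 \<Rightarrow> real"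

definition box_set :: "obox \<Rightarrow> pt set"
  where "box_set B = {x. \<forall>i. \<bar>(x - center B) \<bullet> frame B i\<bar> \<le> halfside B i}"

definition is_box :: "structure_constants \<Rightarrow> real \<Rightarrow> real \<Rightarrow> real \<Rightarrow> obox \<Rightarrow> bool"
  where "is_box K a b r B \<longleftrightarrow>
    (\<forall>i j. frame B i \<bullet> frame B j = (if i = j then 1 else 0)) \<and>
    2 * halfside B 1 \<in> {side_lo K * a .. side_hi K * a} \<and>
    2 * halfside B 2 \<in> {side_lo K * b .. side_hi K * b} \<and>
    2 * halfside B 3 \<in> {side_lo K * r .. side_hi K * r}"

definition enlarge :: "real \<Rightarrow> obox \<Rightarrow> obox"
  where "enlarge h B = B\<lparr>halfside := (\<lambda>i. halfside B i + sqrt 3 * h)\<rparr>"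


definition cell :: "real \<Rightarrow> int ^ 3 \<Rightarrow> pt set"
  where "cell h k = {x. \<forall>i. h * of_int (k $ i) \<le> x $ i \<and> x $ i < h * (of_int (k $ i) + 1)}"

definition cells :: "real \<Rightarrow> pt set set"
  where "cells h = range (cell h)"

definition cell_hull :: "real \<Rightarrow> pt set \<Rightarrow> pt set"
  where "cell_hull h E = \<Union>{Q \<in> cells h. Q \<inter> E \<noteq> {}}"


text \<open>The disjoint union of the families of children is encoded by the map \<open>parent_of\<close>.\<close>

record configuration =
  parents :: "label set"
  children :: "label set"
  parent_of :: "label \<Rightarrow> label"
  pbox :: "label \<Rightarrow> obox"
  tube :: "label \<Rightarrow> pt set"
  shade :: "label \<Rightarrow> pt set"

definition children_of :: "configuration \<Rightarrow> label \<Rightarrow> label set"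
  where "children_of X B = {t \<in> children X. parent_of X t = B}"

definition total_mass :: "configuration \<Rightarrow> real"
  where "total_mass X = mass (children X) (shade X)"

definition shaded_family :: "configuration \<Rightarrow> bool"
  where "shaded_family X \<longleftrightarrow>
    finite (parents X) \<and> finite (children X) \<and> parent_of X ` children X \<subseteq> parents X \<and>
    (\<forall>t\<in>children X. shade X t \<in> sets lebesgue \<and> shade X t \<subseteq> tube X t)"

definition F1 :: "structure_constants \<Rightarrow> real \<Rightarrow> real \<Rightarrow> real \<Rightarrow> real \<Rightarrow> configuration \<Rightarrow> bool"
  where "F1 K \<delta> a b r X \<longleftrightarrow>
    (\<forall>B\<in>parents X. is_box K a b r (pbox X B)) \<and>
    (\<forall>B\<in>parents X. \<forall>t\<in>children_of X B. is_tube K \<delta> r (tube X t) \<and> tube X t \<subseteq> box_set (pbox X B))"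

definition F2 :: "real \<Rightarrow> real \<Rightarrow> configuration \<Rightarrow> bool"
  where "F2 D \<kappa> X \<longleftrightarrow> 0 < D \<and> 1 \<le> \<kappa> \<and>
    (\<forall>B\<in>parents X. D \<le> (\<Sum>t\<in>children_of X B. vol (tube X t)) \<and>
                    (\<Sum>t\<in>children_of X B. vol (tube X t)) \<le> \<kappa> * D)"

definition active_cells :: "real \<Rightarrow> configuration \<Rightarrow> pt set set"
  where "active_cells h X =
    {Q \<in> cells h. 0 < (\<Sum>B\<in>parents X. \<Sum>t\<in>children_of X B. vol (shade X t \<inter> Q))}"

definition F3 :: "real \<Rightarrow> real \<Rightarrow> real \<Rightarrow> configuration \<Rightarrow> bool"
  where "F3 Ccomp h \<delta> X \<longleftrightarrow> finite (active_cells h X) \<and>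
    real (card (children X)) + real (card (parents X)) + real (card (active_cells h X))
      \<le> \<delta> powr (- Ccomp)"

text \<open>Coarse tubes carry labels local to their parent box.\<close>

record coarse_data =
  coarse_labels :: "label \<Rightarrow> label set"
  coarse_tube :: "label \<Rightarrow> label \<Rightarrow> pt set"
  coarse_of :: "label \<Rightarrow> label"

text \<open>The designated alternative with its parameters: \<open>Ordinary C\<^sub>F\<close>, \<open>Biased \<sigma> C\<^sub>0\<close>,
  \<open>Coarse \<rho> C\<^sub>F R\<^sub>b\<^sub>r S\<close>.\<close>

datatype alternative =
    Ordinary real
  | Biased real real
  | Coarse real real real coarse_data

definition coarse_load :: "configuration \<Rightarrow> coarse_data \<Rightarrow> label \<Rightarrow> label \<Rightarrow> nat"
  where "coarse_load X S B s = card {t \<in> children_of X B. coarse_of S t = s}"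

fun F4 :: "structure_constants \<Rightarrow> real \<Rightarrow> real \<Rightarrow> real \<Rightarrow> configuration \<Rightarrow> alternative \<Rightarrow> bool"
  where
    "F4 K \<delta> a r X (Ordinary C\<^sub>F) \<longleftrightarrow>
      (\<forall>B\<in>parents X. \<forall>V. convex V \<and> V \<subseteq> box_set (pbox X B) \<longrightarrow>
        real (card {t \<in> children_of X B. tube X t \<subseteq> V}) / real (card (children_of X B))
          \<le> C\<^sub>F * (vol V / vol (box_set (pbox X B))))"
  | "F4 K \<delta> a r X (Biased \<sigma> C\<^sub>0) \<longleftrightarrow> 0 < \<sigma> \<and> \<sigma> \<le> 1 \<and>
      (\<forall>B\<in>parents X. \<forall>V. convex V \<and> V \<subseteq> box_set (pbox X B) \<longrightarrow>
        real (card {t \<in> children_of X B. tube X t \<subseteq> V}) / real (card (children_of X B))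
          \<le> C\<^sub>0 * (vol V / vol (box_set (pbox X B))) powr (1 + \<sigma>))"
  | "F4 K \<delta> a r X (Coarse \<rho> C\<^sub>F R S) \<longleftrightarrow> \<delta> \<le> \<rho> \<and> \<rho> \<le> a \<and> 1 \<le> R \<and>
      (\<forall>B\<in>parents X.
        finite (coarse_labels S B) \<and> coarse_labels S B \<noteq> {} \<and>
        (\<forall>s\<in>coarse_labels S B.
          is_tube K \<rho> r (coarse_tube S B s) \<and> coarse_tube S B s \<subseteq> box_set (pbox X B)) \<and>
        (\<forall>V. convex V \<and> V \<subseteq> box_set (pbox X B) \<longrightarrow>
          real (card {s \<in> coarse_labels S B. coarse_tube S B s \<subseteq> V})
              / real (card (coarse_labels S B))
            \<le> C\<^sub>F * (vol V / vol (box_set (pbox X B)))) \<and>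
        (\<forall>t\<in>children_of X B.
          coarse_of S t \<in> coarse_labels S B \<and> tube X t \<subseteq> coarse_tube S B (coarse_of S t)) \<and>
        (\<exists>m::real. 1 \<le> m \<and>
          (\<forall>s\<in>coarse_labels S B.
            m \<le> real (coarse_load X S B s) \<and> real (coarse_load X S B s) \<le> R * m)))"


definition N_max :: "configuration \<Rightarrow> nat"
  where "N_max X = Max ((\<lambda>B. card (children_of X B)) ` parents X)"

text \<open>\<open>f\<^sub>B\<close> is \<open>multiplicity_at (children_of X B) (shade X)\<close>, and \<open>\<mu>\<^sub>i\<^sub>n = 2 ^ k\<close>.\<close>

definition shade0 :: "configuration \<Rightarrow> nat \<Rightarrow> label \<Rightarrow> pt set"
  where "shade0 X k t = shade X t \<inter>
    {x. 2 ^ k \<le> multiplicity_at (children_of X (parent_of X t)) (shade X) x \<and>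
        multiplicity_at (children_of X (parent_of X t)) (shade X) x < 2 ^ (k + 1)}"

definition common_inner_level :: "configuration \<Rightarrow> nat \<Rightarrow> bool"
  where "common_inner_level X k \<longleftrightarrow> int k \<le> \<lceil>log 2 (real (N_max X))\<rceil> \<and>
    mass (children X) (shade0 X k)
      \<ge> inverse (1 + of_int \<lceil>log 2 (real (N_max X))\<rceil>) * total_mass X"

definition edge_weight :: "configuration \<Rightarrow> nat \<Rightarrow> label \<Rightarrow> pt set \<Rightarrow> real"
  where "edge_weight X k B Q = (\<Sum>t\<in>children_of X B. vol (shade0 X k t \<inter> Q))"

definition positive_graph :: "configuration \<Rightarrow> real \<Rightarrow> nat \<Rightarrow> (label \<times> pt set) set"
  where "positive_graph X h k = {(B, Q) \<in> parents X \<times> cells h. 0 < edge_weight X k B Q}"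

definition L0 :: "configuration \<Rightarrow> real \<Rightarrow> nat \<Rightarrow> real"
  where "L0 X h k = (let e = real (card (positive_graph X h k)) in
    4 * (1 + of_int \<lceil>log 2 (real (N_max X))\<rceil>) * (1 + of_int \<lceil>log 2 (2 * e)\<rceil>)
      * (1 + of_int \<lceil>log 2 e\<rceil>))"


definition retained_parents :: "(label \<times> pt set) set \<Rightarrow> label set"
  where "retained_parents E = {B. \<exists>Q. (B, Q) \<in> E}"

definition retained_children :: "configuration \<Rightarrow> (label \<times> pt set) set \<Rightarrow> label set"
  where "retained_children X E = (\<Union>B\<in>retained_parents E. children_of X B)"

definition parent_shade :: "(label \<times> pt set) set \<Rightarrow> label \<Rightarrow> pt set"
  where "parent_shade E B = \<Union>{Q. (B, Q) \<in> E}"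

text \<open>For \<open>E = E\<^sub>2\<close> this is \<open>Y\<^sub>1\<close>; it is empty on children of non-retained parents because
  \<open>parent_shade E B\<close> is then empty.\<close>

definition shade1 :: "configuration \<Rightarrow> nat \<Rightarrow> (label \<times> pt set) set \<Rightarrow> label \<Rightarrow> pt set"
  where "shade1 X k E t = shade0 X k t \<inter> parent_shade E (parent_of X t)"

definition stage_shade ::
  "configuration \<Rightarrow> nat \<Rightarrow> (label \<times> pt set) set \<Rightarrow> (label \<times> pt set) set \<Rightarrow> label \<Rightarrow> pt set"
  where "stage_shade X k E2 E t = shade1 X k E2 t \<inter> parent_shade E (parent_of X t)"

end

theory Submission
  imports Defs "HOL-Analysis.Analysis"
begin

text \<open>The theorem has a combinatorial half, about the bipartite graph of parents and cells, and an
  incidence half, which bounds the density of the parents' shading from below.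

  The graph. Edges whose weight is less than \<open>1 / (2 e)\<close> of the largest weight carry at most half of
  the mass, so one of about \<open>log (2 e)\<close> dyadic weight classes keeps the right share of it; among the
  remaining cells one of about \<open>log e\<close> dyadic classes of degrees is chosen, and a chosen cell keeps all
  its edges (\<open>regular_subgraph\<close>). Afterwards all edges have the same weight up to a factor two, and they
  all carry a cell of the same volume. Mass, number of edges and volume of the parents' shading are
  then proportional, so that any later thinning of the edges costs the product of the \<open>c\<^sub>j\<close> and a single
  factor two (\<open>stage_mass\<close>). The inner multiplicities and the cell hulls come out right for every set
  of positive edges, because the shadings are cut along whole cells, and total multiplicities only
  decrease when edges are removed.

  The density. Fix one parent of dimensions \<open>a \<times> b \<times> r\<close> with \<open>N\<close> children of mean shading density
  \<open>\<lambda>\<close>, and project along its side of length \<open>a\<close>. At the scale \<open>a\<close> of the cells a child becomes a strip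
  around a line \<open>u = \<alpha> + \<beta> v\<close> (\<open>tube_lies_along_strip\<close>), and a neighbourhood of such a line becomes the
  intersection of the box with a slab, which is convex. Each of the three alternatives therefore says
  that up to constants at most \<open>C N (s / b)\<^bsup>1 + \<sigma>\<^esup>\<close> of the lines stay within \<open>s \<ge> a\<close> of a given one; here \<open>\<sigma> = 0\<close> in the
  ordinary and the coarse alternative, and in the latter the lines are those of the coarse tubes.

  Let \<open>f\<^sub>\<tau>\<close> be the sum over the lines of the normalised indicators of their strips of half-width \<open>\<tau>\<close>.
  The number of incidences between lines and shaded cells is governed by the integral of \<open>f\<^sub>\<kappa>\<close>, \<open>\<kappa> \<sim> a\<close>,
  over the shaded cells. Split \<open>f\<^sub>\<kappa> = f\<^sub>\<rho> + (f\<^sub>\<kappa> - f\<^sub>\<rho>)\<close>. The first part is bounded pointwise by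
  a multiple of \<open>\<rho>\<^bsup>\<sigma> - 1\<^esup>\<close>, by counting the lines near a point (\<open>lines_near_point\<close>). The second part is small in mean
  square: two transversal strips of any widths meet in a set of normalised area
  \<open>1 / \<bar>\<beta> - \<beta>'\<bar>\<close>, so that the four terms of a product of two differences cancel up to the variation of
  a cut-off (\<open>crossing_difference_energy\<close>); summation over dyadic distances gives \<open>\<rho>\<^sup>\<sigma>\<close> times the
  number of scales between \<open>a\<close> and \<open>b\<close> (\<open>strip_density_difference_energy\<close>). The choice \<open>\<rho> = \<lambda> b\<close>
  balances both parts, and gives the relative volume \<open>\<lambda>\<^bsup>2 - \<sigma>\<^esup> / (C log (2 b / a))\<close> for the shading
  of the parent (\<open>parent_cells_lower_bound\<close>). The logarithm is absorbed by \<open>(a / b)\<^sup>\<epsilon>\<close> in the biased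
  alternative. Convexity of \<open>x\<^bsup>2 - \<sigma>\<^esup>\<close> passes from the single parents to the whole family.\<close>

section \<open>Normalised strips and their crossings\<close>

text \<open>Averaging over an interval of half-width \<open>\<tau>\<close>; the total mass is one for every \<open>\<tau>\<close>.\<close>

definition strip_kernel :: "real \<Rightarrow> real \<Rightarrow> real"
  where "strip_kernel \<tau> x = indicat_real {-\<tau>..\<tau>} x / (2 * \<tau>)"

definition correlation :: "real \<Rightarrow> real \<Rightarrow> real \<Rightarrow> real"
  where "correlation \<tau> \<tau>' t = (\<integral>u. strip_kernel \<tau> u * strip_kernel \<tau>' (u + t) \<partial>lborel)"

lemma strip_kernel_measurable [measurable]: "strip_kernel \<tau> \<in> borel_measurable borel"
  unfolding strip_kernel_def[abs_def] by measurable

lemma strip_kernel_nonneg: "0 < \<tau> \<Longrightarrow> 0 \<le> strip_kernel \<tau> x"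
  by (simp add: strip_kernel_def)

lemma strip_kernel_le: "0 < \<tau> \<Longrightarrow> strip_kernel \<tau> x \<le> 1 / (2 * \<tau>)"
  by (auto simp: strip_kernel_def indicator_def)

lemma strip_kernel_has_integral:
  assumes "0 < \<tau>"
  shows strip_kernel_integrable: "integrable lborel (strip_kernel \<tau>)"
    and strip_kernel_integral: "(\<integral>x. strip_kernel \<tau> x \<partial>lborel) = 1"
  using assms by (auto simp: strip_kernel_def[abs_def])

lemma strip_kernel_mult_integrable:
  assumes "0 < \<tau>" "0 < \<tau>'"
  shows "integrable lborel (\<lambda>u. strip_kernel \<tau> u * strip_kernel \<tau>' (u + t))"
proof (rule Bochner_Integration.integrable_bound[where f = "\<lambda>u. (1 / (2 * \<tau>')) * strip_kernel \<tau> u"])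
  show "integrable lborel (\<lambda>u. (1 / (2 * \<tau>')) * strip_kernel \<tau> u)"
    using strip_kernel_integrable[OF assms(1)] by simp
  show "AE u in lborel. norm (strip_kernel \<tau> u * strip_kernel \<tau>' (u + t)) \<le> norm (1 / (2 * \<tau>') * strip_kernel \<tau> u)"
    using strip_kernel_nonneg[OF assms(1)] strip_kernel_nonneg[OF assms(2)] strip_kernel_le[OF assms(2)] assms
    by (intro AE_I2) (simp add: abs_mult mult.commute mult_left_mono del: times_divide_eq_left times_divide_eq_right)
qed measurable

lemma correlation_nonneg:
  assumes "0 < \<tau>" "0 < \<tau>'"
  shows "0 \<le> correlation \<tau> \<tau>' t"
  unfolding correlation_def using strip_kernel_nonneg[OF assms(1)] strip_kernel_nonneg[OF assms(2)]
  by (intro integral_nonneg_AE) auto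

lemma correlation_le_right:
  assumes "0 < \<tau>" "0 < \<tau>'"
  shows "correlation \<tau> \<tau>' t \<le> 1 / (2 * \<tau>')"
proof -
  have "correlation \<tau> \<tau>' t \<le> (\<integral>u. (1 / (2 * \<tau>')) * strip_kernel \<tau> u \<partial>lborel)"
    unfolding correlation_def
    using strip_kernel_integrable[OF assms(1)] strip_kernel_mult_integrable[OF assms]
      strip_kernel_nonneg[OF assms(1)] strip_kernel_le[OF assms(2)]
    by (intro integral_mono)
      (auto simp: mult.commute mult_left_mono simp del: times_divide_eq_left times_divide_eq_right)
  also have "\<dots> = 1 / (2 * \<tau>')"
    using strip_kernel_integral[OF assms(1)] by simp
  finally show ?thesis .
qed

lemma correlation_commute: "correlation \<tau> \<tau>' t = correlation \<tau>' \<tau> (- t)"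
proof -
  have "correlation \<tau> \<tau>' t = (\<integral>u. strip_kernel \<tau> (- t + 1 * u) * strip_kernel \<tau>' ((- t + 1 * u) + t) \<partial>lborel)"
    unfolding correlation_def by (subst lborel_integral_real_affine[where c = 1 and t = "- t"]) auto
  also have "\<dots> = correlation \<tau>' \<tau> (- t)"
    unfolding correlation_def by (simp add: mult.commute add.commute)
  finally show ?thesis .
qed

lemma correlation_le:
  assumes "0 < \<tau>" "0 < \<tau>'"
  shows "correlation \<tau> \<tau>' t \<le> 1 / (2 * max \<tau> \<tau>')"
proof (cases "\<tau> \<le> \<tau>'")
  case True
  then show ?thesis using correlation_le_right[OF assms, of t] by (simp add: max_def)
next
  case False
  then show ?thesis using correlation_le_right[OF assms(2,1), of "- t"]
    by (simp add: max_def correlation_commute[of \<tau> \<tau>' t])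
qed

lemma correlation_eq_0:
  assumes "\<tau> + \<tau>' < \<bar>t\<bar>"
  shows "correlation \<tau> \<tau>' t = 0"
proof -
  have "(\<lambda>u. strip_kernel \<tau> u * strip_kernel \<tau>' (u + t)) = (\<lambda>u. 0)"
    using assms by (auto simp: fun_eq_iff strip_kernel_def indicator_def)
  then show ?thesis by (simp add: correlation_def)
qed

lemma correlation_measurable [measurable]: "correlation \<tau> \<tau>' \<in> borel_measurable borel"
  unfolding correlation_def[abs_def] by measurable

text \<open>Both kernels have mass one, hence so has their correlation, whatever the two widths are. This
  independence of the widths is the source of the cancellation below.\<close>

lemma correlation_has_integral:
  assumes "0 < \<tau>" "0 < \<tau>'"
  shows correlation_integrable: "integrable lborel (correlation \<tau> \<tau>')"
    and correlation_integral: "(\<integral>t. correlation \<tau> \<tau>' t \<partial>lborel) = 1"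
proof -
  have ker1: "(\<integral>\<^sup>+x. ennreal (strip_kernel s (x + c)) \<partial>lborel) = 1" if "0 < s" for s c
  proof -
    have "integrable lborel (\<lambda>x. strip_kernel s (c + 1 * x))"
      using strip_kernel_integrable[OF that] by (rule lborel_integrable_real_affine) simp
    moreover have "(\<integral>x. strip_kernel s (c + 1 * x) \<partial>lborel) = 1"
      using lborel_integral_real_affine[of 1 "strip_kernel s" c] strip_kernel_integral[OF that] by simp
    ultimately show ?thesis
      using strip_kernel_nonneg[OF that] by (subst nn_integral_eq_integral) (auto simp: add.commute)
  qed
  have "(\<integral>\<^sup>+t. ennreal (correlation \<tau> \<tau>' t) \<partial>lborel)
      = (\<integral>\<^sup>+t. (\<integral>\<^sup>+u. ennreal (strip_kernel \<tau> u * strip_kernel \<tau>' (u + t)) \<partial>lborel) \<partial>lborel)"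
    unfolding correlation_def
    using strip_kernel_mult_integrable[OF assms] strip_kernel_nonneg[OF assms(1)] strip_kernel_nonneg[OF assms(2)]
    by (intro nn_integral_cong) (subst nn_integral_eq_integral, auto)
  also have "\<dots> = (\<integral>\<^sup>+u. (\<integral>\<^sup>+t. ennreal (strip_kernel \<tau> u * strip_kernel \<tau>' (u + t)) \<partial>lborel) \<partial>lborel)"
    by (rule lborel_pair.Fubini') measurable
  also have "\<dots> = (\<integral>\<^sup>+u. ennreal (strip_kernel \<tau> u) \<partial>lborel)"
    using strip_kernel_nonneg[OF assms(1)] strip_kernel_nonneg[OF assms(2)] ker1[OF assms(2)]
    by (intro nn_integral_cong) (simp add: ennreal_mult nn_integral_cmult add.commute)
  also have "\<dots> = 1" using ker1[OF assms(1), of 0] by simp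
  finally have *: "(\<integral>\<^sup>+t. ennreal (correlation \<tau> \<tau>' t) \<partial>lborel) = ennreal 1" by simp
  show "integrable lborel (correlation \<tau> \<tau>')"
    using * correlation_nonneg[OF assms] by (intro integrableI_nonneg) auto
  show "(\<integral>t. correlation \<tau> \<tau>' t \<partial>lborel) = 1"
    using * correlation_nonneg[OF assms] by (intro integral_eq_nn_integral[THEN trans]) auto
qed

text \<open>A cut-off which is at least one on \<open>[-R, R]\<close>. It is Lipschitz with constant \<open>1 / R\<close>, which a sharp
  cut-off is not: the cancellation between crossing strips needs this regularity.\<close>

definition tent :: "real \<Rightarrow> real \<Rightarrow> real"
  where "tent R v = max 0 (2 - \<bar>v\<bar> / R)"

lemma tent_measurable [measurable]: "tent R \<in> borel_measurable borel"
  unfolding tent_def[abs_def] by measurable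

lemma tent_nonneg: "0 \<le> tent R v" by (simp add: tent_def)
lemma tent_le: "0 < R \<Longrightarrow> tent R v \<le> 2" by (simp add: tent_def)
lemma tent_ge_1: "0 < R \<Longrightarrow> \<bar>v\<bar> \<le> R \<Longrightarrow> 1 \<le> tent R v"
  by (simp add: tent_def field_simps le_max_iff_disj)
lemma tent_eq_0: "0 < R \<Longrightarrow> 2 * R \<le> \<bar>v\<bar> \<Longrightarrow> tent R v = 0"
  by (simp add: tent_def field_simps)
lemma tent_lipschitz:
  assumes "0 < R" shows "\<bar>tent R v - tent R v'\<bar> \<le> \<bar>v - v'\<bar> / R"
proof -
  have "\<bar>tent R v - tent R v'\<bar> \<le> \<bar>\<bar>v\<bar> / R - \<bar>v'\<bar> / R\<bar>"
    unfolding tent_def by linarith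
  also have "\<dots> = \<bar>\<bar>v\<bar> - \<bar>v'\<bar>\<bar> / R" using assms by (simp add: diff_divide_distrib[symmetric])
  also have "\<dots> \<le> \<bar>v - v'\<bar> / R" using assms by (intro divide_right_mono) auto
  finally show ?thesis .
qed

text \<open>The cut-off area of the intersection of two normalised strips around lines that differ by \<open>p\<close> in the
  intercept and by \<open>q\<close> in the slope, after the integration across the strips.\<close>

definition crossing :: "real \<Rightarrow> real \<Rightarrow> real \<Rightarrow> real \<Rightarrow> real \<Rightarrow> real"
  where "crossing R \<tau> \<tau>' p q = (\<integral>v. tent R v * correlation \<tau> \<tau>' (p + q * v) \<partial>lborel)"

lemma correlation_affine:
  assumes "0 < \<tau>" "0 < \<tau>'" "q \<noteq> 0"
  shows "integrable lborel (\<lambda>v. correlation \<tau> \<tau>' (p + q * v))"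
    and "(\<integral>v. correlation \<tau> \<tau>' (p + q * v) \<partial>lborel) = 1 / \<bar>q\<bar>"
proof -
  show "integrable lborel (\<lambda>v. correlation \<tau> \<tau>' (p + q * v))"
    using correlation_integrable[OF assms(1,2)] assms(3) by (rule lborel_integrable_real_affine)
  have "1 = \<bar>q\<bar> * (\<integral>v. correlation \<tau> \<tau>' (p + q * v) \<partial>lborel)"
    using lborel_integral_real_affine[OF assms(3), of "correlation \<tau> \<tau>'" p] correlation_integral[OF assms(1,2)]
    by simp
  then show "(\<integral>v. correlation \<tau> \<tau>' (p + q * v) \<partial>lborel) = 1 / \<bar>q\<bar>"
    using assms(3) by (simp add: field_simps)
qed

lemma crossing_integrable:
  assumes "0 < R" "0 < \<tau>" "0 < \<tau>'"
  shows "integrable lborel (\<lambda>v. tent R v * correlation \<tau> \<tau>' (p + q * v))"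
proof (rule Bochner_Integration.integrable_bound[where f = "\<lambda>v. (2 / (2 * max \<tau> \<tau>')) * indicat_real {-2*R..2*R} v"])
  show "integrable lborel (\<lambda>v. (2 / (2 * max \<tau> \<tau>')) * indicat_real {-2*R..2*R} v)"
    by (intro integrable_mult_right integrable_real_indicator) (auto simp: emeasure_lborel_Icc_eq)
  show "AE v in lborel. norm (tent R v * correlation \<tau> \<tau>' (p + q * v)) \<le> norm ((2 / (2 * max \<tau> \<tau>')) * indicat_real {-2*R..2*R} v)"
  proof (intro AE_I2)
    fix v
    show "norm (tent R v * correlation \<tau> \<tau>' (p + q * v)) \<le> norm ((2 / (2 * max \<tau> \<tau>')) * indicat_real {-2*R..2*R} v)"
    proof (cases "\<bar>v\<bar> \<le> 2 * R")
      case True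
      have "tent R v * correlation \<tau> \<tau>' (p + q * v) \<le> 2 * (1 / (2 * max \<tau> \<tau>'))"
        by (intro mult_mono correlation_le tent_le correlation_nonneg tent_nonneg assms) auto
      moreover have "0 \<le> tent R v * correlation \<tau> \<tau>' (p + q * v)"
        using correlation_nonneg assms tent_nonneg by simp
      ultimately show ?thesis using True assms by (auto simp: indicator_def)
    next
      case False
      then show ?thesis using tent_eq_0[OF assms(1), of v] by simp
    qed
  qed
qed measurable

lemma crossing_nonneg:
  assumes "0 < \<tau>" "0 < \<tau>'" shows "0 \<le> crossing R \<tau> \<tau>' p q"
  unfolding crossing_def using correlation_nonneg[OF assms] tent_nonneg by (intro integral_nonneg_AE) auto

lemma crossing_le_short:
  assumes "0 < R" "0 < \<tau>" "0 < \<tau>'"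
  shows "crossing R \<tau> \<tau>' p q \<le> 4 * R / max \<tau> \<tau>'"
proof -
  have "crossing R \<tau> \<tau>' p q \<le> (\<integral>v. (1 / max \<tau> \<tau>') * indicat_real {-2*R..2*R} v \<partial>lborel)"
    unfolding crossing_def
  proof (intro integral_mono crossing_integrable assms)
    fix v
    show "tent R v * correlation \<tau> \<tau>' (p + q * v) \<le> (1 / max \<tau> \<tau>') * indicat_real {-2*R..2*R} v"
    proof (cases "\<bar>v\<bar> \<le> 2 * R")
      case True
      have "tent R v * correlation \<tau> \<tau>' (p + q * v) \<le> 2 * (1 / (2 * max \<tau> \<tau>'))"
        by (intro mult_mono correlation_le tent_le correlation_nonneg tent_nonneg assms) auto
      then show ?thesis using True assms by (auto simp: indicator_def)
    next
      case False
      then show ?thesis using tent_eq_0[OF assms(1), of v] assms by (simp add: max_def)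
    qed
  qed (intro integrable_mult_right integrable_real_indicator, auto simp: emeasure_lborel_Icc_eq)
  also have "\<dots> = 4 * R / max \<tau> \<tau>'" using assms by simp
  finally show ?thesis .
qed

lemma crossing_le_slope:
  assumes "0 < R" "0 < \<tau>" "0 < \<tau>'" "q \<noteq> 0"
  shows "crossing R \<tau> \<tau>' p q \<le> 2 / \<bar>q\<bar>"
proof -
  have "crossing R \<tau> \<tau>' p q \<le> (\<integral>v. 2 * correlation \<tau> \<tau>' (p + q * v) \<partial>lborel)"
    unfolding crossing_def using correlation_affine[OF assms(2,3,4)] correlation_nonneg[OF assms(2,3)] assms
    by (intro integral_mono crossing_integrable assms mult_right_mono tent_le) auto
  also have "\<dots> = 2 / \<bar>q\<bar>" using correlation_affine[OF assms(2,3,4)] by simp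
  finally show ?thesis .
qed

lemma crossing_eq_0:
  assumes "0 < R" "0 < \<tau>" "0 < \<tau>'" "\<tau> + \<tau>' + 2 * R * \<bar>q\<bar> < \<bar>p\<bar>"
  shows "crossing R \<tau> \<tau>' p q = 0"
proof -
  have "tent R v * correlation \<tau> \<tau>' (p + q * v) = 0" for v
  proof (cases "2 * R \<le> \<bar>v\<bar>")
    case False
    then have "\<bar>q * v\<bar> \<le> \<bar>q\<bar> * (2 * R)" unfolding abs_mult by (intro mult_left_mono) auto
    then have "\<tau> + \<tau>' < \<bar>p + q * v\<bar>" using assms(4) by (simp add: algebra_simps)
    then show ?thesis by (simp add: correlation_eq_0)
  qed (simp add: tent_eq_0 assms)
  then show ?thesis unfolding crossing_def by (simp only: integral_zero)
qed

text \<open>Without the cut-off the normalised area would be exactly \<open>1 / \<bar>q\<bar>\<close>. The correlation is supported where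
  the lines are within \<open>\<tau> + \<tau>'\<close> of each other, that is within \<open>(\<tau> + \<tau>') / \<bar>q\<bar>\<close> of the crossing point
  \<open>- p / q\<close>, and there the cut-off varies only a little.\<close>

lemma crossing_transversal:
  assumes "0 < R" "0 < \<tau>" "0 < \<tau>'" "q \<noteq> 0"
  shows "\<bar>crossing R \<tau> \<tau>' p q - tent R (- p / q) / \<bar>q\<bar>\<bar> \<le> (\<tau> + \<tau>') / (R * q\<^sup>2)"
proof -
  note ov = correlation_affine[OF assms(2,3,4), of p]
  note I1 = crossing_integrable[OF assms(1-3), of p q]
  have I2: "integrable lborel (\<lambda>v. tent R (- p / q) * correlation \<tau> \<tau>' (p + q * v))"
    using ov by simp
  have "\<bar>crossing R \<tau> \<tau>' p q - tent R (- p / q) / \<bar>q\<bar>\<bar>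
      = \<bar>(\<integral>v. tent R v * correlation \<tau> \<tau>' (p + q * v) - tent R (- p / q) * correlation \<tau> \<tau>' (p + q * v) \<partial>lborel)\<bar>"
    unfolding crossing_def by (subst Bochner_Integration.integral_diff[OF I1 I2]) (simp add: ov(2))
  also have "\<dots> \<le> (\<integral>v. \<bar>tent R v * correlation \<tau> \<tau>' (p + q * v) - tent R (- p / q) * correlation \<tau> \<tau>' (p + q * v)\<bar> \<partial>lborel)"
    by (rule integral_abs_bound)
  also have "\<dots> \<le> (\<integral>v. (\<tau> + \<tau>') / (R * \<bar>q\<bar>) * correlation \<tau> \<tau>' (p + q * v) \<partial>lborel)"
  proof (rule integral_mono)
    show "integrable lborel (\<lambda>v. \<bar>tent R v * correlation \<tau> \<tau>' (p + q * v) - tent R (- p / q) * correlation \<tau> \<tau>' (p + q * v)\<bar>)"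
      by (intro Bochner_Integration.integrable_abs Bochner_Integration.integrable_diff I1 I2)
    show "integrable lborel (\<lambda>v. (\<tau> + \<tau>') / (R * \<bar>q\<bar>) * correlation \<tau> \<tau>' (p + q * v))"
      using ov by simp
    fix v
    show "\<bar>tent R v * correlation \<tau> \<tau>' (p + q * v) - tent R (- p / q) * correlation \<tau> \<tau>' (p + q * v)\<bar>
        \<le> (\<tau> + \<tau>') / (R * \<bar>q\<bar>) * correlation \<tau> \<tau>' (p + q * v)"
    proof (cases "\<bar>p + q * v\<bar> \<le> \<tau> + \<tau>'")
      case True
      have "\<bar>tent R v - tent R (- p / q)\<bar> \<le> \<bar>v - - p / q\<bar> / R"
        by (rule tent_lipschitz[OF assms(1)])
      also have "\<dots> = \<bar>p + q * v\<bar> / (R * \<bar>q\<bar>)"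
      proof -
        have "v - - p / q = (p + q * v) / q" using assms(4) by (simp add: field_simps)
        then show ?thesis by (simp add: abs_divide mult.commute)
      qed
      also have "\<dots> \<le> (\<tau> + \<tau>') / (R * \<bar>q\<bar>)"
        using assms True by (intro divide_right_mono) auto
      finally have "\<bar>tent R v - tent R (- p / q)\<bar> * correlation \<tau> \<tau>' (p + q * v)
          \<le> (\<tau> + \<tau>') / (R * \<bar>q\<bar>) * correlation \<tau> \<tau>' (p + q * v)"
        by (rule mult_right_mono) (rule correlation_nonneg[OF assms(2,3)])
      then show ?thesis
        using correlation_nonneg[OF assms(2,3), of "p + q * v"]
        by (simp add: left_diff_distrib[symmetric] abs_mult)
    next
      case False
      then show ?thesis using correlation_eq_0[of \<tau> \<tau>' "p + q * v"] by simp
    qed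
  qed
  also have "\<dots> = (\<tau> + \<tau>') / (R * q\<^sup>2)"
    using ov(2) by (simp add: power2_eq_square abs_mult_self_eq mult.assoc)
  finally show ?thesis .
qed

text \<open>The quantity \<open>\<bar>p\<bar> + R \<bar>q\<bar>\<close> is the distance of the two lines over \<open>[-R, R]\<close>. Lines that cross under the
  cut-off and are much further apart than the strips are wide must have a slope difference of the
  order of this distance.\<close>

lemma crossing_le:
  assumes "0 < R" "0 < \<tau>" "0 < \<tau>'"
  shows "crossing R \<tau> \<tau>' p q \<le> 16 * R / max (\<bar>p\<bar> + R * \<bar>q\<bar>) (max \<tau> \<tau>')"
proof -
  define d m where "d = \<bar>p\<bar> + R * \<bar>q\<bar>" and "m = max \<tau> \<tau>'"
  have m: "0 < m" "\<tau> \<le> m" "\<tau>' \<le> m" using assms by (auto simp: m_def)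
  have d0: "0 \<le> d" using assms by (simp add: d_def)
  consider "\<tau> + \<tau>' + 2 * R * \<bar>q\<bar> < \<bar>p\<bar>" | "d \<le> 4 * m"
    | "4 * m < d" "\<bar>p\<bar> \<le> \<tau> + \<tau>' + 2 * R * \<bar>q\<bar>"
    by linarith
  then have "crossing R \<tau> \<tau>' p q \<le> 16 * R / max d m"
  proof cases
    case 1
    then show ?thesis using crossing_eq_0[OF assms] assms m by (simp add: le_max_iff_disj)
  next
    case 2
    have "crossing R \<tau> \<tau>' p q \<le> 4 * R / m" using crossing_le_short[OF assms] by (simp add: m_def)
    also have "\<dots> = 16 * R / (4 * m)" by simp
    also have "\<dots> \<le> 16 * R / max d m"
      using 2 m assms by (intro divide_left_mono) auto
    finally show ?thesis .
  next
    case 3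
    then have *: "d \<le> 6 * (R * \<bar>q\<bar>)" using m unfolding d_def by (simp add: algebra_simps)
    then have q: "0 < R * \<bar>q\<bar>" using 3 m by linarith
    then have "q \<noteq> 0" by auto
    then have "crossing R \<tau> \<tau>' p q \<le> 2 / \<bar>q\<bar>" by (rule crossing_le_slope[OF assms])
    also have "\<dots> = 12 * R / (6 * (R * \<bar>q\<bar>))" using q assms by (simp add: field_simps)
    also have "\<dots> \<le> 12 * R / d" using * q 3 m assms by (intro divide_left_mono) auto
    also have "\<dots> \<le> 16 * R / d" using assms d0 by (intro divide_right_mono) auto
    also have "d = max d m" using 3 m by simp
    finally show ?thesis by simp
  qed
  then show ?thesis by (simp add: d_def m_def)
qed

text \<open>The mutual energy of two differences of strips, of half-widths \<open>\<kappa>\<close> and \<open>\<rho>\<close>. Lines at a distance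
  \<open>d \<le> 4 \<rho>\<close> contribute at most their crossing, of size \<open>R / max \<kappa> d\<close>. For larger \<open>d\<close> the main terms
  \<open>tent R (- p / q) / \<bar>q\<bar>\<close> of the four crossings cancel, and \<open>\<rho> R / d\<^sup>2\<close> is left. The stated bound has the
  shape that a count of order \<open>d\<^bsup>1 + \<sigma>\<^esup>\<close> turns into a constant for each dyadic scale.\<close>

lemma crossing_difference_energy:
  fixes R \<kappa> \<rho> \<sigma> p q :: real
  assumes R: "0 < R" and \<kappa>: "0 < \<kappa>" "\<kappa> \<le> \<rho>" and \<sigma>: "0 \<le> \<sigma>" "\<sigma> \<le> 1"
  shows "crossing R \<kappa> \<kappa> p q - crossing R \<kappa> \<rho> p q - crossing R \<rho> \<kappa> p q + crossing R \<rho> \<rho> p q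
      \<le> 288 * R * \<rho> powr \<sigma> / max \<kappa> (\<bar>p\<bar> + R * \<bar>q\<bar>) powr (1 + \<sigma>)"
    (is "?E \<le> _")
proof -
  define d where "d = \<bar>p\<bar> + R * \<bar>q\<bar>"
  define D where "D = max \<kappa> d"
  have \<rho>: "0 < \<rho>" using \<kappa> by simp
  have D: "0 < D" "\<kappa> \<le> D" "d \<le> D" using \<kappa> by (auto simp: D_def)
  have d0: "0 \<le> d" using R by (simp add: d_def)
  have "?E \<le> 288 * R * \<rho> powr \<sigma> / D powr (1 + \<sigma>)"
  proof (cases "d \<le> 4 * \<rho>")
    case True
    have le: "crossing R \<tau> \<tau>' p q \<le> 16 * R / D" if "\<kappa> \<le> \<tau>" "\<kappa> \<le> \<tau>'" for \<tau> \<tau>'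
    proof -
      have "crossing R \<tau> \<tau>' p q \<le> 16 * R / max d (max \<tau> \<tau>')"
        unfolding d_def using that \<kappa> R by (intro crossing_le) auto
      also have "\<dots> \<le> 16 * R / D"
        using that R \<kappa> unfolding D_def by (intro divide_left_mono) (auto simp: max_def)
      finally show ?thesis .
    qed
    have "?E \<le> 32 * R / D"
      using le[of \<kappa> \<kappa>] le[of \<rho> \<rho>] crossing_nonneg[OF \<kappa>(1) \<rho>, of R p q] crossing_nonneg[OF \<rho> \<kappa>(1), of R p q] \<kappa>
      by simp
    also have "\<dots> = 32 * R * D powr \<sigma> / D powr (1 + \<sigma>)"
      using D by (simp add: powr_add)
    also have "D powr \<sigma> \<le> (4 * \<rho>) powr \<sigma>"
      using True \<kappa> D \<sigma> by (intro powr_mono2) (auto simp: D_def)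
    also have "(4 * \<rho>) powr \<sigma> = 4 powr \<sigma> * \<rho> powr \<sigma>" using \<rho> by (simp add: powr_mult)
    also have "(4::real) powr \<sigma> \<le> 4 powr 1" using \<sigma> by (intro powr_mono) auto
    finally have "?E \<le> 32 * R * (4 powr 1 * \<rho> powr \<sigma>) / D powr (1 + \<sigma>)"
      using R D by (simp add: mult_left_mono mult_right_mono divide_right_mono)
    also have "\<dots> \<le> 288 * R * \<rho> powr \<sigma> / D powr (1 + \<sigma>)"
      using R by (intro divide_right_mono) auto
    finally show ?thesis .
  next
    case False
    then have Dd: "D = d" and dpos: "0 < d" using \<kappa> by (auto simp: D_def)
    show ?thesis
    proof (cases "6 * (R * \<bar>q\<bar>) < d")
      case True
      then have "2 * \<rho> + 2 * R * \<bar>q\<bar> < \<bar>p\<bar>" using False by (simp add: d_def algebra_simps)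
      then have "?E = 0"
        using \<kappa> \<rho> R by (simp add: crossing_eq_0)
      then show ?thesis using R by simp
    next
      case F2: False
      then have q: "q \<noteq> 0" using dpos by auto
      define w where "w = tent R (- p / q) / \<bar>q\<bar>"
      have tr: "\<bar>crossing R \<tau> \<tau>' p q - w\<bar> \<le> 2 * \<rho> / (R * q\<^sup>2)"
        if "0 < \<tau>" "0 < \<tau>'" "\<tau> \<le> \<rho>" "\<tau>' \<le> \<rho>" for \<tau> \<tau>'
      proof -
        have "\<bar>crossing R \<tau> \<tau>' p q - w\<bar> \<le> (\<tau> + \<tau>') / (R * q\<^sup>2)"
          unfolding w_def using that R q by (intro crossing_transversal) auto
        also have "\<dots> \<le> 2 * \<rho> / (R * q\<^sup>2)" using that R by (intro divide_right_mono) auto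
        finally show ?thesis .
      qed
      have "?E \<le> 4 * (2 * \<rho> / (R * q\<^sup>2))"
        using tr[of \<kappa> \<kappa>] tr[of \<kappa> \<rho>] tr[of \<rho> \<kappa>] tr[of \<rho> \<rho>] \<kappa> \<rho> by (auto simp: abs_le_iff)
      also have "\<dots> = 8 * \<rho> * R / (R * \<bar>q\<bar>)\<^sup>2"
        using R by (simp add: power2_eq_square field_simps)
      also have "\<dots> \<le> 8 * \<rho> * R / (d / 6)\<^sup>2"
        using F2 dpos R \<rho> q by (intro divide_left_mono power_mono mult_pos_pos) auto
      also have "\<dots> = 288 * R * \<rho> * (1 / d\<^sup>2)" by (simp add: power2_eq_square field_simps)
      also have "1 / d\<^sup>2 = d powr (\<sigma> - 1) / d powr (1 + \<sigma>)"
        using dpos by (simp add: powr_diff[symmetric] powr_minus_divide powr_numeral[symmetric] del: powr_numeral)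
      also have "288 * R * \<rho> * (d powr (\<sigma> - 1) / d powr (1 + \<sigma>))
          \<le> 288 * R * \<rho> * (\<rho> powr (\<sigma> - 1) / d powr (1 + \<sigma>))"
        using False \<rho> R \<sigma> by (intro mult_left_mono divide_right_mono powr_mono2') auto
      also have "\<dots> = 288 * R * \<rho> powr \<sigma> / d powr (1 + \<sigma>)"
        using \<rho> by (simp add: powr_diff)
      finally show ?thesis by (simp add: Dd)
    qed
  qed
  then show ?thesis by (simp add: D_def d_def)
qed

text \<open>Each dyadic range of \<open>f\<close> contributes a multiple of \<open>\<Gamma>\<close>. Beyond \<open>b\<close> the total number of elements
  replaces the count.\<close>

lemma sum_over_scales:
  fixes f :: "'a \<Rightarrow> real" and \<kappa> \<Gamma> e b :: real
  assumes fin: "finite F" and \<kappa>: "0 < \<kappa>" and e: "0 \<le> e" "e \<le> 2"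
    and count: "\<And>s. \<kappa> \<le> s \<Longrightarrow> real (card {t \<in> F. f t \<le> s}) \<le> \<Gamma> * s powr e"
    and total: "real (card F) \<le> \<Gamma> * b powr e" and b: "0 < b" "b \<le> 2 ^ I * \<kappa>"
  shows "(\<Sum>t\<in>F. 1 / max \<kappa> (f t) powr e) \<le> \<Gamma> * (4 * real I + 2)"
proof -
  have \<Gamma>: "0 \<le> \<Gamma>"
  proof -
    have "0 \<le> \<Gamma> * \<kappa> powr e" using count[of \<kappa>] by (rule order_trans[rotated]) auto
    then show ?thesis using \<kappa> by (simp add: zero_le_mult_iff)
  qed
  have dy: "(\<Sum>t\<in>{t \<in> F. f t \<le> 2 ^ i * \<kappa>}. 1 / max \<kappa> (f t) powr e) \<le> \<Gamma> * (4 * real i + 1)" for i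
  proof (induction i)
    case 0
    have "(\<Sum>t\<in>{t \<in> F. f t \<le> 2 ^ 0 * \<kappa>}. 1 / max \<kappa> (f t) powr e)
        = (\<Sum>t\<in>{t \<in> F. f t \<le> \<kappa>}. 1 / \<kappa> powr e)"
      by (intro sum.cong) (auto simp: max_def)
    also have "\<dots> = real (card {t \<in> F. f t \<le> \<kappa>}) / \<kappa> powr e" by simp
    also have "\<dots> \<le> \<Gamma>" using count[of \<kappa>] \<kappa> by (simp add: divide_le_eq)
    finally show ?case by simp
  next
    case (Suc i)
    let ?s = "2 ^ i * \<kappa>"
    have s: "0 < ?s" "\<kappa> \<le> ?s" using \<kappa> by auto
    have split: "{t \<in> F. f t \<le> 2 ^ Suc i * \<kappa>}
        = {t \<in> F. f t \<le> ?s} \<union> {t \<in> F. ?s < f t \<and> f t \<le> 2 * ?s}"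
      using s by auto
    have "(\<Sum>t\<in>{t \<in> F. ?s < f t \<and> f t \<le> 2 * ?s}. 1 / max \<kappa> (f t) powr e)
        \<le> (\<Sum>t\<in>{t \<in> F. ?s < f t \<and> f t \<le> 2 * ?s}. 1 / ?s powr e)"
      using s e by (intro sum_mono divide_left_mono powr_mono2 mult_pos_pos) (auto simp: powr_gt_zero)
    also have "\<dots> = real (card {t \<in> F. ?s < f t \<and> f t \<le> 2 * ?s}) * (1 / ?s powr e)" by simp
    also have "\<dots> \<le> real (card {t \<in> F. f t \<le> 2 * ?s}) * (1 / ?s powr e)"
      using fin by (intro mult_right_mono of_nat_mono card_mono) auto
    also have "\<dots> \<le> (\<Gamma> * (2 * ?s) powr e) * (1 / ?s powr e)"
      using s by (intro mult_right_mono count) auto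
    also have "\<dots> = \<Gamma> * 2 powr e"
    proof -
      have "(2 * ?s) powr e = 2 powr e * ?s powr e" using s(1) by (simp only: powr_mult)
      then show ?thesis using s(1) \<kappa> by (simp del: powr_mult)
    qed
    also have "\<dots> \<le> \<Gamma> * 2 powr 2" using e \<Gamma> by (intro mult_left_mono powr_mono) auto
    finally have new: "(\<Sum>t\<in>{t \<in> F. ?s < f t \<and> f t \<le> 2 * ?s}. 1 / max \<kappa> (f t) powr e) \<le> \<Gamma> * 4"
      by simp
    have "(\<Sum>t\<in>{t \<in> F. f t \<le> 2 ^ Suc i * \<kappa>}. 1 / max \<kappa> (f t) powr e)
        = (\<Sum>t\<in>{t \<in> F. f t \<le> ?s}. 1 / max \<kappa> (f t) powr e)
          + (\<Sum>t\<in>{t \<in> F. ?s < f t \<and> f t \<le> 2 * ?s}. 1 / max \<kappa> (f t) powr e)"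
      unfolding split using fin by (intro sum.union_disjoint) auto
    also have "\<dots> \<le> \<Gamma> * (4 * real i + 1) + \<Gamma> * 4" using Suc new by linarith
    also have "\<dots> = \<Gamma> * (4 * real (Suc i) + 1)" by (simp add: algebra_simps)
    finally show ?case .
  qed
  let ?s = "2 ^ I * \<kappa>"
  have "(\<Sum>t\<in>{t \<in> F. ?s < f t}. 1 / max \<kappa> (f t) powr e) \<le> (\<Sum>t\<in>{t \<in> F. ?s < f t}. 1 / b powr e)"
    using b e by (intro sum_mono divide_left_mono powr_mono2 mult_pos_pos) (auto simp: powr_gt_zero)
  also have "\<dots> = real (card {t \<in> F. ?s < f t}) * (1 / b powr e)" by simp
  also have "\<dots> \<le> real (card F) * (1 / b powr e)"
    using fin by (intro mult_right_mono of_nat_mono card_mono) auto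
  also have "\<dots> \<le> (\<Gamma> * b powr e) * (1 / b powr e)" by (intro mult_right_mono total) auto
  also have "\<dots> = \<Gamma>" using b by simp
  finally have far: "(\<Sum>t\<in>{t \<in> F. ?s < f t}. 1 / max \<kappa> (f t) powr e) \<le> \<Gamma>" .
  have "(\<Sum>t\<in>F. 1 / max \<kappa> (f t) powr e)
      = (\<Sum>t\<in>{t \<in> F. f t \<le> ?s} \<union> {t \<in> F. ?s < f t}. 1 / max \<kappa> (f t) powr e)"
    by (intro sum.cong) auto
  also have "\<dots> = (\<Sum>t\<in>{t \<in> F. f t \<le> ?s}. 1 / max \<kappa> (f t) powr e)
      + (\<Sum>t\<in>{t \<in> F. ?s < f t}. 1 / max \<kappa> (f t) powr e)"
    using fin by (intro sum.union_disjoint) auto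
  also have "\<dots> \<le> \<Gamma> * (4 * real I + 1) + \<Gamma>" using dy[of I] far by linarith
  also have "\<dots> = \<Gamma> * (4 * real I + 2)" by (simp add: algebra_simps)
  finally show ?thesis .
qed

lemma strip_kernel_pair_integral:
  assumes "0 < \<tau>" "0 < \<tau>'"
  shows "integrable lborel (\<lambda>u. strip_kernel \<tau> (u - x) * strip_kernel \<tau>' (u - y))"
    and "(\<integral>u. strip_kernel \<tau> (u - x) * strip_kernel \<tau>' (u - y) \<partial>lborel) = correlation \<tau> \<tau>' (x - y)"
proof -
  have "integrable lborel (\<lambda>u. strip_kernel \<tau> (- x + 1 * u) * strip_kernel \<tau>' ((- x + 1 * u) + (x - y)))"
    by (rule lborel_integrable_real_affine[OF strip_kernel_mult_integrable[OF assms]]) simp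
  then show "integrable lborel (\<lambda>u. strip_kernel \<tau> (u - x) * strip_kernel \<tau>' (u - y))"
    by (simp add: algebra_simps)
  have "correlation \<tau> \<tau>' (x - y)
      = (\<integral>u. strip_kernel \<tau> (- x + 1 * u) * strip_kernel \<tau>' ((- x + 1 * u) + (x - y)) \<partial>lborel)"
    unfolding correlation_def by (subst lborel_integral_real_affine[where c = 1 and t = "- x"]) auto
  then show "(\<integral>u. strip_kernel \<tau> (u - x) * strip_kernel \<tau>' (u - y) \<partial>lborel) = correlation \<tau> \<tau>' (x - y)"
    by (simp add: algebra_simps)
qed

section \<open>Incidences between lines and squares in the plane\<close>

lemma strip_pair_integral:
  assumes "0 < R" "0 < \<tau>" "0 < \<tau>'"
  shows "integrable (lborel \<Otimes>\<^sub>M lborel)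
          (\<lambda>(v, u). tent R v * (strip_kernel \<tau> (u - a - b * v) * strip_kernel \<tau>' (u - a' - b' * v)))" (is ?A)
    and "(\<integral>(v, u). tent R v * (strip_kernel \<tau> (u - a - b * v) * strip_kernel \<tau>' (u - a' - b' * v))
          \<partial>(lborel \<Otimes>\<^sub>M lborel)) = crossing R \<tau> \<tau>' (a - a') (b - b')" (is ?B)
proof -
  let ?f = "\<lambda>(v, u). tent R v * (strip_kernel \<tau> (u - a - b * v) * strip_kernel \<tau>' (u - a' - b' * v))"
  have shift: "u - a - b * v = u - (a + b * v)" "(a + b * v) - (a' + b' * v) = (a - a') + (b - b') * v"
    for u a b v a' b' :: real by (auto simp: algebra_simps)
  have inner: "integrable lborel (\<lambda>u. ?f (v, u))"
      "(\<integral>u. ?f (v, u) \<partial>lborel) = tent R v * correlation \<tau> \<tau>' ((a - a') + (b - b') * v)"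
      "(\<integral>u. norm (?f (v, u)) \<partial>lborel) = tent R v * correlation \<tau> \<tau>' ((a - a') + (b - b') * v)" for v
  proof -
    note * = strip_kernel_pair_integral[OF assms(2,3), of "a + b * v" "a' + b' * v"]
    have nn: "norm (?f (v, u)) = ?f (v, u)" for u
      using tent_nonneg[of R v] strip_kernel_nonneg[OF assms(2)] strip_kernel_nonneg[OF assms(3)] by (simp add: abs_mult)
    show i: "integrable lborel (\<lambda>u. ?f (v, u))" using *(1) by (simp add: shift(1))
    show v: "(\<integral>u. ?f (v, u) \<partial>lborel) = tent R v * correlation \<tau> \<tau>' ((a - a') + (b - b') * v)"
      using *(2) by (simp add: shift)
    show "(\<integral>u. norm (?f (v, u)) \<partial>lborel) = tent R v * correlation \<tau> \<tau>' ((a - a') + (b - b') * v)"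
      unfolding nn v ..
  qed
  show ?A
  proof (rule lborel_pair.Fubini_integrable)
    show "?f \<in> borel_measurable (lborel \<Otimes>\<^sub>M lborel)" by measurable
    show "integrable lborel (\<lambda>v. \<integral>u. norm (?f (v, u)) \<partial>lborel)"
      unfolding inner(3) by (rule crossing_integrable[OF assms])
    show "AE v in lborel. integrable lborel (\<lambda>u. ?f (v, u))"
      using inner(1) by simp
  qed
  then have "(\<integral>v. (\<integral>u. ?f (v, u) \<partial>lborel) \<partial>lborel) = integral\<^sup>L (lborel \<Otimes>\<^sub>M lborel) ?f"
    by (rule lborel_pair.integral_fst')
  then show ?B unfolding inner(2) by (simp add: crossing_def)
qed

definition strip_density :: "'a set \<Rightarrow> ('a \<Rightarrow> real) \<Rightarrow> ('a \<Rightarrow> real) \<Rightarrow> real \<Rightarrow> real \<Rightarrow> real \<Rightarrow> real"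
  where "strip_density F \<alpha> \<beta> \<tau> v u = (\<Sum>t\<in>F. strip_kernel \<tau> (u - \<alpha> t - \<beta> t * v))"

text \<open>Expanding the square produces the four crossings of every pair of lines. For a fixed line the energies
  are summed over the dyadic distances of the other lines, where the count compensates the decay, so
  that every scale contributes the same amount.\<close>

lemma strip_density_difference_energy:
  fixes \<alpha> \<beta> :: "'a \<Rightarrow> real"
  assumes R: "0 < R" and \<kappa>: "0 < \<kappa>" "\<kappa> \<le> \<rho>" and \<sigma>: "0 \<le> \<sigma>" "\<sigma> \<le> 1"
    and fin: "finite F"
    and count: "\<And>t s. t \<in> F \<Longrightarrow> \<kappa> \<le> s \<Longrightarrow>
      real (card {t' \<in> F. \<bar>\<alpha> t - \<alpha> t'\<bar> + R * \<bar>\<beta> t - \<beta> t'\<bar> \<le> s}) \<le> \<Gamma> * s powr (1 + \<sigma>)"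
    and total: "real (card F) \<le> \<Gamma> * b powr (1 + \<sigma>)" and b: "0 < b" "b \<le> 2 ^ I * \<kappa>"
  shows "integrable (lborel \<Otimes>\<^sub>M lborel)
      (\<lambda>(v, u). tent R v * (strip_density F \<alpha> \<beta> \<kappa> v u - strip_density F \<alpha> \<beta> \<rho> v u)\<^sup>2)" (is ?A)
    and "(\<integral>(v, u). tent R v * (strip_density F \<alpha> \<beta> \<kappa> v u - strip_density F \<alpha> \<beta> \<rho> v u)\<^sup>2
        \<partial>(lborel \<Otimes>\<^sub>M lborel))
      \<le> real (card F) * (288 * R * \<rho> powr \<sigma> * (\<Gamma> * (4 * real I + 2)))" (is ?B)
proof -
  have \<rho>: "0 < \<rho>" using \<kappa> by simp
  define P where "P \<tau> \<tau>' t t' = (\<lambda>(v, u). tent R v * (strip_kernel \<tau> (u - \<alpha> t - \<beta> t * v) * strip_kernel \<tau>' (u - \<alpha> t' - \<beta> t' * v)))"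
    for \<tau> \<tau>' t t'
  have P: "integrable (lborel \<Otimes>\<^sub>M lborel) (P \<tau> \<tau>' t t')"
      "integral\<^sup>L (lborel \<Otimes>\<^sub>M lborel) (P \<tau> \<tau>' t t') = crossing R \<tau> \<tau>' (\<alpha> t - \<alpha> t') (\<beta> t - \<beta> t')"
    if "0 < \<tau>" "0 < \<tau>'" for \<tau> \<tau>' t t'
    unfolding P_def using strip_pair_integral[OF R that] by auto
  have expand: "(\<lambda>(v, u). tent R v * (strip_density F \<alpha> \<beta> \<kappa> v u - strip_density F \<alpha> \<beta> \<rho> v u)\<^sup>2)
      = (\<lambda>z. \<Sum>t\<in>F. \<Sum>t'\<in>F. P \<kappa> \<kappa> t t' z - P \<kappa> \<rho> t t' z - P \<rho> \<kappa> t t' z + P \<rho> \<rho> t t' z)"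
  proof (rule ext, clarify)
    fix v u
    show "tent R v * (strip_density F \<alpha> \<beta> \<kappa> v u - strip_density F \<alpha> \<beta> \<rho> v u)\<^sup>2
      = (\<Sum>t\<in>F. \<Sum>t'\<in>F. P \<kappa> \<kappa> t t' (v, u) - P \<kappa> \<rho> t t' (v, u) - P \<rho> \<kappa> t t' (v, u) + P \<rho> \<rho> t t' (v, u))"
    proof -
      define h where "h t = strip_kernel \<kappa> (u - \<alpha> t - \<beta> t * v) - strip_kernel \<rho> (u - \<alpha> t - \<beta> t * v)" for t
      have "tent R v * (strip_density F \<alpha> \<beta> \<kappa> v u - strip_density F \<alpha> \<beta> \<rho> v u)\<^sup>2
          = (\<Sum>t\<in>F. \<Sum>t'\<in>F. tent R v * (h t * h t'))"
      proof -
        have "strip_density F \<alpha> \<beta> \<kappa> v u - strip_density F \<alpha> \<beta> \<rho> v u = sum h F"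
          by (simp add: strip_density_def h_def sum_subtractf)
        then show ?thesis by (simp only: power2_eq_square sum_product) (simp only: sum_distrib_left)
      qed
      also have "\<dots> = (\<Sum>t\<in>F. \<Sum>t'\<in>F. P \<kappa> \<kappa> t t' (v, u) - P \<kappa> \<rho> t t' (v, u) - P \<rho> \<kappa> t t' (v, u) + P \<rho> \<rho> t t' (v, u))"
        unfolding P_def h_def by (intro sum.cong refl) (simp add: algebra_simps)
      finally show ?thesis .
    qed
  qed
  have I4: "integrable (lborel \<Otimes>\<^sub>M lborel) (\<lambda>z. P \<kappa> \<kappa> t t' z - P \<kappa> \<rho> t t' z - P \<rho> \<kappa> t t' z + P \<rho> \<rho> t t' z)"
    for t t'
    using \<kappa> \<rho> by (intro Bochner_Integration.integrable_add Bochner_Integration.integrable_diff P)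
  show ?A unfolding expand by (intro Bochner_Integration.integrable_sum I4)
  have "(\<integral>(v, u). tent R v * (strip_density F \<alpha> \<beta> \<kappa> v u - strip_density F \<alpha> \<beta> \<rho> v u)\<^sup>2 \<partial>(lborel \<Otimes>\<^sub>M lborel))
      = (\<Sum>t\<in>F. \<Sum>t'\<in>F. crossing R \<kappa> \<kappa> (\<alpha> t - \<alpha> t') (\<beta> t - \<beta> t') - crossing R \<kappa> \<rho> (\<alpha> t - \<alpha> t') (\<beta> t - \<beta> t')
          - crossing R \<rho> \<kappa> (\<alpha> t - \<alpha> t') (\<beta> t - \<beta> t') + crossing R \<rho> \<rho> (\<alpha> t - \<alpha> t') (\<beta> t - \<beta> t'))"
    unfolding expand using \<kappa>(1) \<rho> I4 P
    by (simp add: Bochner_Integration.integral_sum Bochner_Integration.integrable_sum)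
  also have "\<dots> \<le> (\<Sum>t\<in>F. \<Sum>t'\<in>F. 288 * R * \<rho> powr \<sigma> * (1 / max \<kappa> (\<bar>\<alpha> t - \<alpha> t'\<bar> + R * \<bar>\<beta> t - \<beta> t'\<bar>) powr (1 + \<sigma>)))"
    using crossing_difference_energy[OF R \<kappa> \<sigma>] by (intro sum_mono) simp
  also have "\<dots> = (\<Sum>t\<in>F. 288 * R * \<rho> powr \<sigma> *
      (\<Sum>t'\<in>F. 1 / max \<kappa> (\<bar>\<alpha> t - \<alpha> t'\<bar> + R * \<bar>\<beta> t - \<beta> t'\<bar>) powr (1 + \<sigma>)))"
    by (simp only: sum_distrib_left)
  also have "\<dots> \<le> (\<Sum>t\<in>F. 288 * R * \<rho> powr \<sigma> * (\<Gamma> * (4 * real I + 2)))"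
    using R \<sigma> by (intro sum_mono mult_left_mono sum_over_scales[OF fin \<kappa>(1) _ _ count total b]) auto
  also have "\<dots> = real (card F) * (288 * R * \<rho> powr \<sigma> * (\<Gamma> * (4 * real I + 2)))" by simp
  finally show ?B .
qed

text \<open>Sort the lines that pass near the point by their slopes, in steps of \<open>\<rho> / R\<close>. Two lines of one class
  stay within \<open>4 \<rho>\<close> of each other, so a class is controlled by the count, and there are about \<open>M / \<rho>\<close>
  classes.\<close>

lemma lines_near_point:
  fixes \<alpha> \<beta> :: "'a \<Rightarrow> real"
  assumes R: "0 < R" and \<rho>: "0 < \<rho>" "\<kappa> \<le> 4 * \<rho>" "\<rho> \<le> M" and \<sigma>: "0 \<le> \<sigma>" "\<sigma> \<le> 1"
    and fin: "finite F"
    and count: "\<And>t s. t \<in> F \<Longrightarrow> \<kappa> \<le> s \<Longrightarrow>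
      real (card {t' \<in> F. \<bar>\<alpha> t - \<alpha> t'\<bar> + R * \<bar>\<beta> t - \<beta> t'\<bar> \<le> s}) \<le> \<Gamma> * s powr (1 + \<sigma>)"
    and slope: "\<And>t. t \<in> F \<Longrightarrow> R * \<bar>\<beta> t\<bar> \<le> M" and v: "\<bar>v\<bar> \<le> R" and \<Gamma>: "0 \<le> \<Gamma>"
  shows "real (card {t \<in> F. \<bar>u - \<alpha> t - \<beta> t * v\<bar> \<le> \<rho>}) \<le> 64 * M * \<Gamma> * \<rho> powr \<sigma>"
proof -
  define m where "m = M / \<rho>"
  have m: "1 \<le> m" using \<rho> by (simp add: m_def)
  define cls where "cls t = \<lfloor>\<beta> t * R / \<rho>\<rfloor>" for t
  define S where "S = {t \<in> F. \<bar>u - \<alpha> t - \<beta> t * v\<bar> \<le> \<rho>}"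
  have finS: "finite S" using fin by (simp add: S_def)
  have cls: "cls t \<in> {\<lfloor>- m\<rfloor>..\<lfloor>m\<rfloor>}" if "t \<in> S" for t
  proof -
    have "\<bar>\<beta> t * R / \<rho>\<bar> \<le> m"
      using slope[of t] that R \<rho> by (auto simp: S_def m_def abs_mult mult.commute divide_right_mono)
    then have "- m \<le> \<beta> t * R / \<rho>" "\<beta> t * R / \<rho> \<le> m" by (simp_all only: abs_le_iff) linarith+
    then show ?thesis unfolding cls_def by (auto intro!: floor_mono)
  qed
  have each: "real (card {t \<in> S. cls t = i}) \<le> 16 * \<Gamma> * (\<rho> * \<rho> powr \<sigma>)" for i
  proof (cases "{t \<in> S. cls t = i} = {}")
    case True
    show ?thesis unfolding True using \<Gamma> \<rho> by simp
  next
    case False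
    then obtain t where t: "t \<in> S" "cls t = i" by auto
    have "{t' \<in> S. cls t' = i} \<subseteq> {t' \<in> F. \<bar>\<alpha> t - \<alpha> t'\<bar> + R * \<bar>\<beta> t - \<beta> t'\<bar> \<le> 4 * \<rho>}"
    proof safe
      fix t' assume t': "t' \<in> S" "i = cls t'"
      show "t' \<in> F" using t' by (simp add: S_def)
      have "\<bar>\<beta> t * R / \<rho> - \<beta> t' * R / \<rho>\<bar> \<le> 1"
        using t(2) t'(2) unfolding cls_def by linarith
      then have "\<bar>(\<beta> t - \<beta> t') * R / \<rho>\<bar> \<le> 1" by (simp add: left_diff_distrib diff_divide_distrib)
      then have *: "R * \<bar>\<beta> t - \<beta> t'\<bar> \<le> \<rho>"
        using R \<rho> by (simp add: abs_mult mult.commute)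
      have "\<bar>(\<beta> t - \<beta> t') * v\<bar> \<le> \<bar>\<beta> t - \<beta> t'\<bar> * R"
        unfolding abs_mult using v by (intro mult_left_mono) auto
      then have "\<bar>(\<beta> t - \<beta> t') * v\<bar> \<le> \<rho>" using * by (simp add: mult.commute)
      moreover have "\<alpha> t - \<alpha> t' = (u - \<alpha> t' - \<beta> t' * v) - (u - \<alpha> t - \<beta> t * v) - (\<beta> t - \<beta> t') * v"
        by (simp add: algebra_simps)
      ultimately have "\<bar>\<alpha> t - \<alpha> t'\<bar> \<le> 3 * \<rho>" using t(1) t'(1) by (auto simp: S_def)
      then show "\<bar>\<alpha> t - \<alpha> t'\<bar> + R * \<bar>\<beta> t - \<beta> t'\<bar> \<le> 4 * \<rho>" using * by simp
    qed
    then have "real (card {t' \<in> S. cls t' = i}) \<le> real (card {t' \<in> F. \<bar>\<alpha> t - \<alpha> t'\<bar> + R * \<bar>\<beta> t - \<beta> t'\<bar> \<le> 4 * \<rho>})"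
      using fin by (intro of_nat_mono card_mono) auto
    also have "\<dots> \<le> \<Gamma> * (4 * \<rho>) powr (1 + \<sigma>)" using t \<rho> by (intro count) (auto simp: S_def)
    also have "\<dots> = \<Gamma> * (4 powr (1 + \<sigma>) * (\<rho> * \<rho> powr \<sigma>))"
      using \<rho> by (simp add: powr_mult powr_add)
    also have "\<dots> \<le> \<Gamma> * (4 powr 2 * (\<rho> * \<rho> powr \<sigma>))"
      using \<sigma> \<Gamma> \<rho> by (intro mult_left_mono mult_right_mono powr_mono) auto
    finally show ?thesis by simp
  qed
  have "S = (\<Union>i\<in>{\<lfloor>- m\<rfloor>..\<lfloor>m\<rfloor>}. {t \<in> S. cls t = i})" using cls by auto
  then have "card S \<le> (\<Sum>i\<in>{\<lfloor>- m\<rfloor>..\<lfloor>m\<rfloor>}. card {t \<in> S. cls t = i})"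
    using card_UN_le[of "{\<lfloor>- m\<rfloor>..\<lfloor>m\<rfloor>}" "\<lambda>i. {t \<in> S. cls t = i}"] by simp
  then have "real (card S) \<le> (\<Sum>i\<in>{\<lfloor>- m\<rfloor>..\<lfloor>m\<rfloor>}. real (card {t \<in> S. cls t = i}))"
    by (metis of_nat_le_iff of_nat_sum)
  also have "\<dots> \<le> (\<Sum>i\<in>{\<lfloor>- m\<rfloor>..\<lfloor>m\<rfloor>}. 16 * \<Gamma> * (\<rho> * \<rho> powr \<sigma>))" by (intro sum_mono each)
  also have "\<dots> = real (card {\<lfloor>- m\<rfloor>..\<lfloor>m\<rfloor>}) * (16 * \<Gamma> * (\<rho> * \<rho> powr \<sigma>))" by simp
  also have "\<dots> \<le> (4 * m) * (16 * \<Gamma> * (\<rho> * \<rho> powr \<sigma>))"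
  proof (rule mult_right_mono)
    have "real (card {\<lfloor>- m\<rfloor>..\<lfloor>m\<rfloor>}) \<le> 2 * m + 2" using m by (simp, linarith)
    then show "real (card {\<lfloor>- m\<rfloor>..\<lfloor>m\<rfloor>}) \<le> 4 * m" using m by linarith
  qed (use \<Gamma> \<rho> in auto)
  also have "\<dots> = 64 * M * \<Gamma> * \<rho> powr \<sigma>" using \<rho> by (simp add: m_def)
  finally show ?thesis by (simp add: S_def)
qed

text \<open>Squares of half-side \<open>\<eta>\<close> around the points make an incidence visible in the density at the scale
  \<open>3 \<eta>\<close>. The density splits into its coarse part at the scale \<open>\<rho>\<close>, which is bounded pointwise, and a
  difference of small energy, which a weighted inequality between arithmetic and geometric mean
  separates from the number of squares at one place. The weight \<open>\<theta>\<close> is chosen so that the energy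
  accounts for half of the left-hand side. Multiplying out gives an inequality without \<open>\<theta>\<close>.\<close>

theorem strip_incidence_bound:
  fixes \<alpha> \<beta> :: "'a \<Rightarrow> real" and pu pv :: "'p \<Rightarrow> real"
  assumes \<eta>: "0 < \<eta>" "3 * \<eta> \<le> \<rho>" "\<rho> \<le> M" and \<sigma>: "0 \<le> \<sigma>" "\<sigma> \<le> 1" and R: "0 < R"
    and fin: "finite F" "finite P"
    and count: "\<And>t s. t \<in> F \<Longrightarrow> 3 * \<eta> \<le> s \<Longrightarrow>
      real (card {t' \<in> F. \<bar>\<alpha> t - \<alpha> t'\<bar> + R * \<bar>\<beta> t - \<beta> t'\<bar> \<le> s}) \<le> \<Gamma> * s powr (1 + \<sigma>)"
    and total: "real (card F) \<le> \<Gamma> * b powr (1 + \<sigma>)" and b: "0 < b" "b \<le> 2 ^ I * (3 * \<eta>)"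
    and slope: "\<And>t. t \<in> F \<Longrightarrow> R * \<bar>\<beta> t\<bar> \<le> M" "\<And>t. t \<in> F \<Longrightarrow> \<bar>\<beta> t\<bar> \<le> 1"
    and window: "\<And>x. x \<in> P \<Longrightarrow> \<bar>pv x\<bar> + \<eta> \<le> R"
    and crowd: "\<And>v u. real (card {x \<in> P. \<bar>v - pv x\<bar> \<le> \<eta> \<and> \<bar>u - pu x\<bar> \<le> \<eta>}) \<le> G"
    and \<Gamma>: "0 < \<Gamma>" and G: "0 < G"
  defines "\<Lambda> \<equiv> (\<Sum>x\<in>P. real (card {t \<in> F. \<bar>pu x - \<alpha> t - \<beta> t * pv x\<bar> \<le> \<eta>}))"
  shows "\<Lambda>\<^sup>2 \<le> real (card P) * (384 * \<eta> * M * \<Gamma> * (\<rho> powr \<sigma> / \<rho>) * \<Lambda>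
      + 2592 * G * real (card F) * R * \<rho> powr \<sigma> * \<Gamma> * (4 * real I + 2))"
proof (cases "\<Lambda> = 0")
  case True
  have "0 \<le> M" using \<eta> by simp
  then show ?thesis using True \<eta> R \<Gamma> G by simp
next
  case False
  define \<kappa> where "\<kappa> = 3 * \<eta>"
  have \<kappa>: "0 < \<kappa>" "\<kappa> \<le> \<rho>" using \<eta> by (auto simp: \<kappa>_def)
  have \<rho>: "0 < \<rho>" using \<kappa> by simp
  have M: "0 < M" using \<eta> by simp
  have \<Lambda>: "0 < \<Lambda>" using False unfolding \<Lambda>_def by (simp add: sum_nonneg less_le)
  have F: "0 < card F"
  proof (rule ccontr)
    assume "\<not> 0 < card F"
    then have "F = {}" using fin by (simp add: card_gt_0_iff)
    then show False using False by (simp add: \<Lambda>_def)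
  qed
  define E where "E = real (card F) * (288 * R * \<rho> powr \<sigma> * (\<Gamma> * (4 * real I + 2)))"
  have E: "0 < E" unfolding E_def using F R \<rho> \<Gamma> by (intro mult_pos_pos add_nonneg_pos) auto
  define S where "S = 32 * M * \<Gamma> * (\<rho> powr \<sigma> / \<rho>)"
  \<comment> \<open>With this weight the energy term equals half of the left-hand side of the integrated inequality.\<close>
  define \<theta> where "\<theta> = 3 * E / (2 * \<eta> * \<Lambda>)"
  have \<theta>: "0 < \<theta>" using E \<eta> \<Lambda> by (simp add: \<theta>_def)
  define m where "m x = real (card {t \<in> F. \<bar>pu x - \<alpha> t - \<beta> t * pv x\<bar> \<le> \<eta>})" for x
  define sq where "sq x = {pv x - \<eta>..pv x + \<eta>} \<times> {pu x - \<eta>..pu x + \<eta>}" for x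
  define D where "D v u = tent R v * (strip_density F \<alpha> \<beta> \<kappa> v u - strip_density F \<alpha> \<beta> \<rho> v u)\<^sup>2" for v u
  have D0: "0 \<le> D v u" for v u by (simp add: D_def tent_nonneg)
  have energy: "integrable (lborel \<Otimes>\<^sub>M lborel) (\<lambda>(v, u). D v u)"
      "(\<integral>(v, u). D v u \<partial>(lborel \<Otimes>\<^sub>M lborel)) \<le> E"
    using strip_density_difference_energy[OF R \<kappa> \<sigma> fin(1) count[folded \<kappa>_def] total b(1) b(2)[folded \<kappa>_def]]
    by (simp_all add: D_def E_def)
  \<comment> \<open>A line within \<open>\<eta>\<close> of the centre is within \<open>\<kappa> = 3 \<eta>\<close> of every point of the square, as slopes are at most one.\<close>
  have fine: "m x / (6 * \<eta>) \<le> strip_density F \<alpha> \<beta> \<kappa> v u" if "x \<in> P" "(v, u) \<in> sq x" for x v u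
  proof -
    have near: "\<bar>v - pv x\<bar> \<le> \<eta>" "\<bar>u - pu x\<bar> \<le> \<eta>" using that by (auto simp: sq_def)
    have "m x / (6 * \<eta>) = (\<Sum>t\<in>{t \<in> F. \<bar>pu x - \<alpha> t - \<beta> t * pv x\<bar> \<le> \<eta>}. 1 / (2 * \<kappa>))"
      by (simp add: m_def \<kappa>_def)
    also have "\<dots> \<le> (\<Sum>t\<in>{t \<in> F. \<bar>pu x - \<alpha> t - \<beta> t * pv x\<bar> \<le> \<eta>}. strip_kernel \<kappa> (u - \<alpha> t - \<beta> t * v))"
    proof (rule sum_mono)
      fix t assume t: "t \<in> {t \<in> F. \<bar>pu x - \<alpha> t - \<beta> t * pv x\<bar> \<le> \<eta>}"
      have "\<bar>\<beta> t * (v - pv x)\<bar> \<le> 1 * \<eta>"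
        unfolding abs_mult using slope(2)[of t] near t by (intro mult_mono) auto
      moreover have "u - \<alpha> t - \<beta> t * v = (pu x - \<alpha> t - \<beta> t * pv x) + (u - pu x) - \<beta> t * (v - pv x)"
        by (simp add: algebra_simps)
      moreover have "\<bar>pu x - \<alpha> t - \<beta> t * pv x\<bar> \<le> \<eta>" using t by simp
      ultimately have "\<bar>u - \<alpha> t - \<beta> t * v\<bar> \<le> \<kappa>" using near(2) unfolding \<kappa>_def by linarith
      then show "1 / (2 * \<kappa>) \<le> strip_kernel \<kappa> (u - \<alpha> t - \<beta> t * v)"
        by (auto simp: strip_kernel_def indicator_def)
    qed
    also have "\<dots> \<le> strip_density F \<alpha> \<beta> \<kappa> v u"
      unfolding strip_density_def using fin \<kappa> by (intro sum_mono2) (auto intro: strip_kernel_nonneg)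
    finally show ?thesis .
  qed
  have coarse: "strip_density F \<alpha> \<beta> \<rho> v u \<le> S" if "\<bar>v\<bar> \<le> R" for v u
  proof -
    have "strip_density F \<alpha> \<beta> \<rho> v u = (\<Sum>t\<in>F. indicat_real {t. \<bar>u - \<alpha> t - \<beta> t * v\<bar> \<le> \<rho>} t / (2 * \<rho>))"
      unfolding strip_density_def strip_kernel_def by (intro sum.cong) (auto simp: indicator_def)
    also have "\<dots> = real (card {t \<in> F. \<bar>u - \<alpha> t - \<beta> t * v\<bar> \<le> \<rho>}) / (2 * \<rho>)"
      using fin by (simp add: sum_divide_distrib[symmetric] indicator_def sum.If_cases Int_def)
    also have "\<dots> \<le> 64 * M * \<Gamma> * \<rho> powr \<sigma> / (2 * \<rho>)"
      using \<eta> \<rho> \<Gamma> that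
      by (intro divide_right_mono lines_near_point[OF R \<rho> _ _ \<sigma> fin(1) count slope(1)]) auto
    also have "\<dots> = S" by (simp add: S_def)
    finally show ?thesis .
  qed
  have pointwise: "(\<Sum>x\<in>P. m x / (6 * \<eta>) * indicat_real (sq x) (v, u))
      \<le> (S + \<theta> * G / 2) * (\<Sum>x\<in>P. indicat_real (sq x) (v, u)) + 1 / (2 * \<theta>) * D v u" for v u
  proof (cases "\<exists>x\<in>P. (v, u) \<in> sq x")
    case False
    then have "indicat_real (sq x) (v, u) = 0" if "x \<in> P" for x using that by auto
    then show ?thesis using D0[of v u] \<theta> by simp
  next
    case True
    then have vR: "\<bar>v\<bar> \<le> R" using window by (force simp: sq_def)
    define g where "g = (\<Sum>x\<in>P. indicat_real (sq x) (v, u))"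
    have g0: "0 \<le> g" unfolding g_def by (intro sum_nonneg) auto
    have "g = real (card {x \<in> P. (v, u) \<in> sq x})"
      unfolding g_def using fin by (simp add: indicator_def sum.If_cases Int_def)
    also have "{x \<in> P. (v, u) \<in> sq x} = {x \<in> P. \<bar>v - pv x\<bar> \<le> \<eta> \<and> \<bar>u - pu x\<bar> \<le> \<eta>}"
      by (auto simp: sq_def abs_le_iff)
    finally have gG: "g \<le> G" using crowd by simp
    define d where "d = \<bar>strip_density F \<alpha> \<beta> \<kappa> v u - strip_density F \<alpha> \<beta> \<rho> v u\<bar>"
    have "(\<Sum>x\<in>P. m x / (6 * \<eta>) * indicat_real (sq x) (v, u))
        \<le> (\<Sum>x\<in>P. strip_density F \<alpha> \<beta> \<kappa> v u * indicat_real (sq x) (v, u))"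
      using fine by (intro sum_mono) (auto simp: indicator_def)
    also have "\<dots> = strip_density F \<alpha> \<beta> \<kappa> v u * g" by (simp add: g_def sum_distrib_left)
    also have "\<dots> \<le> (S + d) * g"
      using coarse[OF vR, of u] g0 unfolding d_def by (intro mult_right_mono) auto
    also have "\<dots> = S * g + d * g" by (simp add: algebra_simps)
    also have "d * g \<le> \<theta> * G / 2 * g + 1 / (2 * \<theta>) * D v u"
    proof -
      have "d\<^sup>2 \<le> D v u"
        using tent_ge_1[OF R vR] mult_right_mono[of 1 "tent R v" "d\<^sup>2"] by (simp add: D_def d_def)
      moreover have "d * g \<le> \<theta> * g\<^sup>2 / 2 + 1 / (2 * \<theta>) * d\<^sup>2"
      proof -
        have "0 \<le> (\<theta> * g - d)\<^sup>2 / (2 * \<theta>)" using \<theta> by simp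
        also have "\<dots> = \<theta> * g\<^sup>2 / 2 + 1 / (2 * \<theta>) * d\<^sup>2 - d * g"
          using \<theta> by (simp add: power2_eq_square field_simps)
        finally show ?thesis by simp
      qed
      moreover have "\<theta> * g\<^sup>2 / 2 \<le> \<theta> * G / 2 * g"
        using \<theta> mult_right_mono[OF gG g0] by (simp add: power2_eq_square)
      moreover have "1 / (2 * \<theta>) * d\<^sup>2 \<le> 1 / (2 * \<theta>) * D v u"
        using \<theta> calculation(1) by (intro mult_left_mono) auto
      ultimately show ?thesis by linarith
    qed
    finally show ?thesis by (simp add: g_def algebra_simps)
  qed
  have sqint: "integrable (lborel \<Otimes>\<^sub>M lborel) (indicat_real (sq x))"
      "integral\<^sup>L (lborel \<Otimes>\<^sub>M lborel) (indicat_real (sq x)) = 4 * \<eta>\<^sup>2" for x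
  proof -
    have em: "emeasure (lborel \<Otimes>\<^sub>M lborel) (sq x) = ennreal (4 * \<eta>\<^sup>2)"
      unfolding sq_def using \<eta>
      by (subst lborel.emeasure_pair_measure_Times) (auto simp: ennreal_mult[symmetric] power2_eq_square)
    have sets: "sq x \<in> sets (lborel \<Otimes>\<^sub>M lborel)" unfolding sq_def by measurable
    show "integrable (lborel \<Otimes>\<^sub>M lborel) (indicat_real (sq x))"
      by (rule integrable_real_indicator[OF sets]) (simp add: em)
    show "integral\<^sup>L (lborel \<Otimes>\<^sub>M lborel) (indicat_real (sq x)) = 4 * \<eta>\<^sup>2"
      using em sets by (simp add: measure_def)
  qed
  have "(\<Sum>x\<in>P. m x / (6 * \<eta>) * (4 * \<eta>\<^sup>2))
      = (\<integral>z. (\<Sum>x\<in>P. m x / (6 * \<eta>) * indicat_real (sq x) z) \<partial>(lborel \<Otimes>\<^sub>M lborel))"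
    using sqint by (simp add: Bochner_Integration.integral_sum)
  also have "\<dots> \<le> (\<integral>z. (S + \<theta> * G / 2) * (\<Sum>x\<in>P. indicat_real (sq x) z) + 1 / (2 * \<theta>) * (case z of (v, u) \<Rightarrow> D v u)
      \<partial>(lborel \<Otimes>\<^sub>M lborel))"
    using sqint energy(1) pointwise
    by (intro integral_mono Bochner_Integration.integrable_add integrable_mult_right Bochner_Integration.integrable_sum) auto
  also have "\<dots> = (S + \<theta> * G / 2) * (real (card P) * (4 * \<eta>\<^sup>2))
      + 1 / (2 * \<theta>) * (\<integral>(v, u). D v u \<partial>(lborel \<Otimes>\<^sub>M lborel))"
    using sqint energy(1)
    by (subst Bochner_Integration.integral_add)
      (auto intro!: integrable_mult_right Bochner_Integration.integrable_sum simp: Bochner_Integration.integral_sum simp del: integrable_mult_left_iff)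
  also have "\<dots> \<le> (S + \<theta> * G / 2) * (real (card P) * (4 * \<eta>\<^sup>2)) + 1 / (2 * \<theta>) * E"
    using energy(2) \<theta> by (intro add_left_mono mult_left_mono) auto
  also have "(\<Sum>x\<in>P. m x / (6 * \<eta>) * (4 * \<eta>\<^sup>2)) = \<Lambda> * (2 * \<eta> / 3)"
    unfolding \<Lambda>_def m_def[symmetric] sum_distrib_right using \<eta> by (intro sum.cong) (auto simp: power2_eq_square field_simps)
  also have "1 / (2 * \<theta>) * E = \<Lambda> * (\<eta> / 3)" using E \<Lambda> \<eta> by (simp add: \<theta>_def field_simps)
  finally have "\<Lambda> * (\<eta> / 3) \<le> (S + \<theta> * G / 2) * (real (card P) * (4 * \<eta>\<^sup>2))" by (simp add: algebra_simps)
  then have "(3 * \<Lambda> / \<eta>) * (\<Lambda> * (\<eta> / 3)) \<le> (3 * \<Lambda> / \<eta>) * ((S + \<theta> * G / 2) * (real (card P) * (4 * \<eta>\<^sup>2)))"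
    using \<Lambda> \<eta> by (intro mult_left_mono) auto
  also have "(3 * \<Lambda> / \<eta>) * (\<Lambda> * (\<eta> / 3)) = \<Lambda>\<^sup>2" using \<eta> by (simp add: power2_eq_square)
  also have "(3 * \<Lambda> / \<eta>) * ((S + \<theta> * G / 2) * (real (card P) * (4 * \<eta>\<^sup>2)))
      = real (card P) * (12 * \<eta> * S * \<Lambda> + 9 * G * E)"
    using \<eta> \<Lambda> unfolding \<theta>_def by (simp add: field_simps power2_eq_square)
  also have "\<dots> = real (card P) * (384 * \<eta> * M * \<Gamma> * (\<rho> powr \<sigma> / \<rho>) * \<Lambda>
      + 2592 * G * real (card F) * R * \<rho> powr \<sigma> * \<Gamma> * (4 * real I + 2))"
    unfolding S_def E_def by (simp add: algebra_simps)
  finally show ?thesis .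
qed

section \<open>Volumes of boxes, tubes and cells\<close>

definition orthonormal :: "(3 \<Rightarrow> pt) \<Rightarrow> bool"
  where "orthonormal f \<longleftrightarrow> (\<forall>i j. f i \<bullet> f j = (if i = j then 1 else 0))"

lemma orthonormal_matrix:
  assumes "orthonormal f"
  shows "orthogonal_matrix ((\<chi> i. f i) :: real^3^3)"
proof -
  have "(\<chi> i. f i) ** transpose (\<chi> i. f i) = mat 1"
    using assms by (simp add: matrix_matrix_mult_def transpose_def mat_def vec_eq_iff inner_vec_def orthonormal_def)
  then show ?thesis
    unfolding orthogonal_matrix_def using matrix_left_right_inverse by blast
qed

lemma matrix_rows_mult: "((\<chi> i. f i) *v x) $ i = f i \<bullet> x" for f :: "3 \<Rightarrow> pt"
  by (simp add: matrix_vector_mult_def inner_vec_def)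

lemma norm_le_frame_coordinates:
  assumes "orthonormal f"
  shows "norm x \<le> \<bar>f 1 \<bullet> x\<bar> + \<bar>f 2 \<bullet> x\<bar> + \<bar>f 3 \<bullet> x\<bar>"
proof -
  have "orthogonal_transformation (\<lambda>x. (\<chi> i. f i) *v x)"
    using orthonormal_matrix[OF assms] by (simp add: orthogonal_transformation_matrix)
  then have "norm x = norm ((\<chi> i. f i) *v x)" by (simp add: orthogonal_transformation)
  also have "\<dots> \<le> (\<Sum>i\<in>UNIV. \<bar>((\<chi> i. f i) *v x) $ i\<bar>)" by (rule norm_le_l1_cart)
  finally show ?thesis by (simp add: matrix_rows_mult sum_3)
qed

lemma orthonormal_norm: "orthonormal f \<Longrightarrow> norm (f i) = 1"
  by (simp add: orthonormal_def norm_eq_1)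

lemma orthonormal_coordinate_le:
  assumes "orthonormal f" shows "\<bar>f i \<bullet> x\<bar> \<le> norm x"
  using Cauchy_Schwarz_ineq2[of "f i" x] orthonormal_norm[OF assms, of i] by simp

lemma prod_UNIV_3: "prod f (UNIV :: 3 set) = f 1 * f 2 * (f 3 :: real)"
  unfolding UNIV_3 by (simp add: mult.assoc)

text \<open>A shear of one coordinate form by another has determinant one, so the volume is that of the
  rectangular box with the same half-sides.\<close>

lemma sheared_box_measure:
  fixes f :: "3 \<Rightarrow> pt" and c s :: "3 \<Rightarrow> real" and \<beta> :: real
  assumes f: "orthonormal f" and kl: "k \<noteq> l" and s: "\<And>i. 0 \<le> s i"
  defines "g \<equiv> (\<lambda>i. if i = k then f k - \<beta> *\<^sub>R f l else f i)"
  defines "P \<equiv> {x. \<forall>i. \<bar>g i \<bullet> x - c i\<bar> \<le> s i}"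
  shows "P \<in> lmeasurable" and "vol P = 8 * s 1 * s 2 * s 3"
proof -
  let ?F = "(\<chi> i. f i) :: real^3^3" and ?A = "(\<chi> i. g i) :: real^3^3"
  have "?A = (\<chi> i. if i = k then row k ?F + (- \<beta>) *s row l ?F else row i ?F)"
    by (simp add: g_def row_def vec_eq_iff)
  then have "det ?A = det ?F" using det_row_operation[OF kl, of ?F "- \<beta>"] by simp
  then have det: "\<bar>det ?A\<bar> = 1" using det_orthogonal_matrix[OF orthonormal_matrix[OF f]] by auto
  then have "invertible ?A" by (auto simp: invertible_det_nz)
  then obtain B where B: "?A ** B = mat 1" "B ** ?A = mat 1" by (auto simp: invertible_def)
  have "det ?A * det B = 1" using B(1) det_mul[of ?A B] by simp
  then have detB: "\<bar>det B\<bar> = 1" using det by (metis abs_1 abs_mult mult_1)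
  define K where "K = cbox ((\<chi> i. c i - s i) :: pt) (\<chi> i. c i + s i)"
  have P: "P = (\<lambda>y. B *v y) ` K"
  proof (intro equalityI subsetI)
    fix x assume "x \<in> P"
    then have "?A *v x \<in> K" unfolding P_def K_def mem_box_cart matrix_rows_mult
      by (auto simp: abs_diff_le_iff)
    moreover have "x = B *v (?A *v x)" by (simp add: matrix_vector_mul_assoc B)
    ultimately show "x \<in> (\<lambda>y. B *v y) ` K" by blast
  next
    fix x assume "x \<in> (\<lambda>y. B *v y) ` K"
    then obtain y where y: "y \<in> K" "x = B *v y" by blast
    then have "?A *v x = y" by (simp add: matrix_vector_mul_assoc B)
    then have "g i \<bullet> x = y $ i" for i using matrix_rows_mult[of g x i] by simp
    then show "x \<in> P" using y(1) unfolding P_def K_def mem_box_cart by (auto simp: abs_diff_le_iff)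
  qed
  have K: "K \<in> lmeasurable" by (simp add: K_def)
  have lin: "linear (\<lambda>y. B *v y)" by (rule matrix_vector_mul_linear)
  show "P \<in> lmeasurable" unfolding P by (rule measurable_linear_image[OF lin K])
  have ne: "cbox ((\<chi> i. c i - s i) :: pt) (\<chi> i. c i + s i) \<noteq> {}"
    using s by (auto simp: interval_ne_empty_cart add_increasing2 intro: order_trans[of _ "c _"])
  have "vol P = vol K" unfolding P measure_linear_image[OF lin K] using detB by simp
  also have "\<dots> = (\<Prod>i\<in>UNIV. 2 * s i)" unfolding K_def using content_cbox_cart[OF ne] by simp
  also have "\<dots> = 8 * s 1 * s 2 * s 3" by (simp only: prod_UNIV_3)
  finally show "vol P = 8 * s 1 * s 2 * s 3" .
qed

lemma rotated_box_measure:
  fixes f :: "3 \<Rightarrow> pt" and c s :: "3 \<Rightarrow> real"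
  assumes "orthonormal f" and "\<And>i. 0 \<le> s i"
  shows "{x. \<forall>i. \<bar>f i \<bullet> x - c i\<bar> \<le> s i} \<in> lmeasurable"
    and "vol {x. \<forall>i. \<bar>f i \<bullet> x - c i\<bar> \<le> s i} = 8 * s 1 * s 2 * s 3"
proof -
  have eq: "(if i = 1 then f 1 - 0 *\<^sub>R f 2 else f i) = f i" for i :: 3 by simp
  note sheared_box_measure[of f 1 2 s 0 c, unfolded eq]
  then show "{x. \<forall>i. \<bar>f i \<bullet> x - c i\<bar> \<le> s i} \<in> lmeasurable"
    and "vol {x. \<forall>i. \<bar>f i \<bullet> x - c i\<bar> \<le> s i} = 8 * s 1 * s 2 * s 3"
    using assms by auto
qed

lemma is_box_frame: "is_box K a b r B \<Longrightarrow> orthonormal (frame B)"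
  by (simp add: is_box_def orthonormal_def)

lemma box_set_eq: "box_set B = {x. \<forall>i. \<bar>frame B i \<bullet> x - frame B i \<bullet> center B\<bar> \<le> halfside B i}"
  by (simp add: box_set_def inner_diff_right inner_commute)

lemma box_set_measure:
  assumes "orthonormal (frame B)" "\<And>i. 0 \<le> halfside B i"
  shows "box_set B \<in> lmeasurable" "vol (box_set B) = 8 * halfside B 1 * halfside B 2 * halfside B 3"
  unfolding box_set_eq using rotated_box_measure[OF assms] by auto

lemma exists_frame_along:
  assumes "norm e = 1"
  obtains f where "orthonormal f" "f 1 = e"
proof -
  obtain \<phi> where \<phi>: "orthogonal_transformation \<phi>" "\<phi> (axis 1 1 :: pt) = e"
    by (rule orthogonal_transformation_exists_1[of "axis 1 1 :: pt" e]) (simp_all add: assms)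
  show thesis
  proof
    show "orthonormal (\<lambda>i. \<phi> (axis i 1))"
      using \<phi>(1) by (auto simp: orthonormal_def orthogonal_transformation_def inner_axis_axis)
    show "\<phi> (axis 1 1) = e" by (rule \<phi>(2))
  qed
qed

definition segment_tube :: "pt \<Rightarrow> pt \<Rightarrow> real \<Rightarrow> pt set"
  where "segment_tube p q s = {x. infdist x (closed_segment p q) \<le> s}"

lemma segment_tube_iff: "x \<in> segment_tube p q s \<longleftrightarrow> (\<exists>y\<in>closed_segment p q. dist x y \<le> s)"
proof
  assume "x \<in> segment_tube p q s"
  moreover obtain y where "y \<in> closed_segment p q" "infdist x (closed_segment p q) = dist x y"
    using infdist_attains_inf[of "closed_segment p q" x] by auto
  ultimately show "\<exists>y\<in>closed_segment p q. dist x y \<le> s" by (auto simp: segment_tube_def)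
next
  assume "\<exists>y\<in>closed_segment p q. dist x y \<le> s"
  then show "x \<in> segment_tube p q s" unfolding segment_tube_def by (auto intro: infdist_le2)
qed

lemma segment_tube_closed: "closed (segment_tube p q s)"
  unfolding segment_tube_def by (intro closed_Collect_le continuous_intros)

lemma segment_tube_bounded: "bounded (segment_tube p q s)"
proof -
  obtain M where M: "\<And>y. y \<in> closed_segment p q \<Longrightarrow> norm y \<le> M"
    using bounded_closed_segment[of p q] by (auto simp: bounded_iff)
  show ?thesis
  proof (rule boundedI)
    fix x assume "x \<in> segment_tube p q s"
    then obtain y where y: "y \<in> closed_segment p q" "dist x y \<le> s" by (auto simp: segment_tube_iff)
    have "norm x \<le> norm y + dist x y" by (metis add.commute dist_norm norm_triangle_sub)
    then show "norm x \<le> M + s" using M[OF y(1)] y(2) by linarith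
  qed
qed

lemma segment_tube_lmeasurable: "segment_tube p q s \<in> lmeasurable"
  using segment_tube_closed segment_tube_bounded lmeasurable_compact compact_eq_bounded_closed by blast

lemma exists_frame_along_segment:
  obtains f where "orthonormal f" "p \<noteq> q \<Longrightarrow> q - p = dist p q *\<^sub>R f 1"
proof (cases "p = q")
  case True
  obtain f where "orthonormal f" "f 1 = (axis 1 1 :: pt)" by (rule exists_frame_along[of "axis 1 1"]) auto
  then show ?thesis using True that by auto
next
  case False
  obtain f where "orthonormal f" "f 1 = (q - p) /\<^sub>R dist p q"
    using False by (rule_tac exists_frame_along[of "(q - p) /\<^sub>R dist p q"]) (auto simp: dist_norm norm_minus_commute)
  then show ?thesis using False that[of f] by simp
qed

lemma segment_frame:
  assumes "p \<noteq> q \<Longrightarrow> q - p = dist p q *\<^sub>R f 1" "y \<in> closed_segment p q"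
  obtains t where "0 \<le> t" "t \<le> dist p q" "y = p + t *\<^sub>R f 1"
proof -
  obtain u where u: "0 \<le> u" "u \<le> 1" "y = (1 - u) *\<^sub>R p + u *\<^sub>R q"
    using assms(2) by (auto simp: in_segment)
  then have "y = p + u *\<^sub>R (q - p)" by (simp add: algebra_simps)
  also have "q - p = dist p q *\<^sub>R f 1" using assms(1) by (cases "p = q") auto
  finally have "y = p + (u * dist p q) *\<^sub>R f 1" by simp
  then show ?thesis using u by (intro that[of "u * dist p q"]) (auto simp: mult_left_le_one_le)
qed

lemma segment_tube_volume_ge:
  assumes s: "0 < s" and pq: "p \<noteq> q"
  shows "dist p q * s\<^sup>2 \<le> vol (segment_tube p q s)"
proof -
  obtain f where f: "orthonormal f" and e: "p \<noteq> q \<Longrightarrow> q - p = dist p q *\<^sub>R f 1"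
    using exists_frame_along_segment[of p q] by blast
  define L where "L = dist p q"
  have L: "0 < L" using pq by (simp add: L_def)
  have q: "q = p + L *\<^sub>R f 1" using e[OF pq] by (simp add: L_def algebra_simps)
  define c where "c i = (if i = 1 then f i \<bullet> p + L / 2 else f i \<bullet> p)" for i :: 3
  define w where "w i = (if i = 1 then L / 2 else s / 2)" for i :: 3
  define P where "P = {x. \<forall>i. \<bar>f i \<bullet> x - c i\<bar> \<le> w i}"
  have w0: "0 \<le> w i" for i using L s by (simp add: w_def)
  have "P \<subseteq> segment_tube p q s"
  proof
    fix x assume "x \<in> P"
    then have x: "\<bar>f i \<bullet> x - c i\<bar> \<le> w i" for i by (simp add: P_def)
    define t where "t = f 1 \<bullet> (x - p)"
    have t: "0 \<le> t" "t \<le> L" using x[of 1] unfolding t_def c_def w_def inner_diff_right by (simp_all only: if_True simp_thms)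
    define y where "y = p + t *\<^sub>R f 1"
    have "y = (1 - t / L) *\<^sub>R p + (t / L) *\<^sub>R q" using L by (simp add: y_def q algebra_simps)
    then have "y \<in> closed_segment p q" using t L unfolding in_segment by (intro exI[of _ "t / L"]) auto
    moreover have "dist x y \<le> s"
    proof -
      have "f 1 \<bullet> (x - y) = 0" "f 2 \<bullet> (x - y) = f 2 \<bullet> x - f 2 \<bullet> p" "f 3 \<bullet> (x - y) = f 3 \<bullet> x - f 3 \<bullet> p"
        using f by (simp_all add: y_def t_def inner_diff_right inner_add_right orthonormal_def)
      then show ?thesis
        using norm_le_frame_coordinates[OF f, of "x - y"] x[of 2] x[of 3] by (simp add: c_def w_def dist_norm)
    qed
    ultimately show "x \<in> segment_tube p q s" by (auto simp: segment_tube_iff)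
  qed
  then have "vol P \<le> vol (segment_tube p q s)"
    using rotated_box_measure(1)[OF f w0, of c] segment_tube_lmeasurable[of p q s] unfolding P_def
    by (intro measure_mono_fmeasurable) (auto simp: fmeasurable_def)
  moreover have "vol P = L * s\<^sup>2"
    unfolding P_def rotated_box_measure(2)[OF f w0] by (simp add: w_def power2_eq_square)
  ultimately show ?thesis by (simp add: L_def)
qed

text \<open>In a frame along the carrier the set lies in a box of half-sides \<open>d\<close>, \<open>s\<close>, \<open>s\<close>.\<close>

lemma segment_tube_piece_volume_le:
  assumes s: "0 \<le> s" and d: "0 \<le> d" and S: "S \<subseteq> segment_tube p q s" "S \<in> sets lebesgue"
    and diam: "\<And>x y. x \<in> S \<Longrightarrow> y \<in> S \<Longrightarrow> dist x y \<le> d"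
  shows "vol S \<le> 8 * d * s\<^sup>2"
proof (cases "S = {}")
  case True
  then show ?thesis using s d by simp
next
  case False
  then obtain z where z: "z \<in> S" by auto
  obtain f where f: "orthonormal f" and e: "p \<noteq> q \<Longrightarrow> q - p = dist p q *\<^sub>R f 1"
    using exists_frame_along_segment[of p q] by blast
  define c where "c i = (if i = 1 then f i \<bullet> z else f i \<bullet> p)" for i :: 3
  define w where "w i = (if i = 1 then d else s)" for i :: 3
  define P where "P = {x. \<forall>i. \<bar>f i \<bullet> x - c i\<bar> \<le> w i}"
  have w0: "0 \<le> w i" for i using d s by (simp add: w_def)
  have "S \<subseteq> P"
  proof
    fix x assume x: "x \<in> S"
    obtain y where y: "y \<in> closed_segment p q" "dist x y \<le> s"
      using S(1) x segment_tube_iff[of x p q s] by blast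
    obtain t where t: "y = p + t *\<^sub>R f 1" using segment_frame[of p q f y, OF e y(1)] by metis
    have "\<bar>f i \<bullet> x - c i\<bar> \<le> w i" for i
    proof (cases "i = 1")
      case True
      have "\<bar>f 1 \<bullet> (x - z)\<bar> \<le> dist x z"
        using orthonormal_coordinate_le[OF f, of 1 "x - z"] by (simp add: dist_norm)
      then show ?thesis using True diam[OF x z] by (simp add: c_def w_def inner_diff_right)
    next
      case False
      have "\<bar>f i \<bullet> (x - y)\<bar> \<le> dist x y"
        using orthonormal_coordinate_le[OF f, of i "x - y"] by (simp add: dist_norm)
      moreover have "f i \<bullet> (x - y) = f i \<bullet> x - f i \<bullet> p"
        using f False by (simp add: t inner_diff_right inner_add_right orthonormal_def)
      ultimately show ?thesis using False y by (simp add: c_def w_def)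
    qed
    then show "x \<in> P" by (simp add: P_def)
  qed
  then have "vol S \<le> vol P"
    using rotated_box_measure(1)[OF f w0, of c] S(2) unfolding P_def
    by (intro measure_mono_fmeasurable) auto
  also have "\<dots> = 8 * d * s\<^sup>2"
    unfolding P_def rotated_box_measure(2)[OF f w0] by (simp add: w_def power2_eq_square)
  finally show ?thesis .
qed

lemma cell_measurable: "cell h k \<in> lmeasurable" and cell_volume: "0 < h \<Longrightarrow> vol (cell h k) = h ^ 3"
proof -
  let ?l = "(\<chi> i. h * of_int (k $ i)) :: pt" and ?u = "(\<chi> i. h * (of_int (k $ i) + 1)) :: pt"
  have sub: "box ?l ?u \<subseteq> cell h k" "cell h k \<subseteq> cbox ?l ?u"
    by (auto simp: cell_def mem_box_cart less_imp_le)
  have "cell h k = (\<Inter>i. {x. h * of_int (k $ i) \<le> x $ i} \<inter> {x. x $ i < h * (of_int (k $ i) + 1)})"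
    by (auto simp: cell_def)
  also have "\<dots> \<in> sets borel"
    by (intro sets.countable_INT'' sets.Int) (auto intro!: borel_closed borel_open closed_Collect_le open_Collect_less continuous_intros)
  finally have "cell h k \<in> sets lebesgue" by (auto intro: sets_completionI_sets)
  then show m: "cell h k \<in> lmeasurable"
    using sub(2) bounded_cbox bounded_subset by (blast intro: bounded_set_imp_lmeasurable)
  assume h: "0 < h"
  have ne: "cbox ?l ?u \<noteq> {}" using h by (auto simp: interval_ne_empty_cart)
  have "vol (cbox ?l ?u) = h ^ 3"
    using content_cbox_cart[OF ne] by (simp add: prod_UNIV_3 power3_eq_cube algebra_simps)
  moreover have "vol (box ?l ?u) = vol (cbox ?l ?u)" by (simp add: measure_lborel_box_eq measure_lborel_cbox_eq)
  moreover have "vol (box ?l ?u) \<le> vol (cell h k)" "vol (cell h k) \<le> vol (cbox ?l ?u)"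
    by (rule measure_mono_fmeasurable[OF sub(1) _ m], simp)
      (rule measure_mono_fmeasurable[OF sub(2) fmeasurableD[OF m] lmeasurable_cbox])
  ultimately show "vol (cell h k) = h ^ 3" by simp
qed

lemma cell_diameter:
  assumes "x \<in> cell h k" "y \<in> cell h k"
  shows "dist x y \<le> sqrt 3 * h"
proof -
  have c: "\<bar>(x - y) $ i\<bar> \<le> h" for i
  proof -
    have "h * of_int (k $ i) \<le> x $ i" "x $ i < h * (of_int (k $ i) + 1)"
      "h * of_int (k $ i) \<le> y $ i" "y $ i < h * (of_int (k $ i) + 1)"
      using assms by (auto simp: cell_def)
    then show ?thesis by (simp add: algebra_simps abs_le_iff)
  qed
  then have h: "0 \<le> h" using abs_ge_zero order_trans by blast
  have "(norm (x - y))\<^sup>2 = (\<Sum>i\<in>UNIV. \<bar>(x - y) $ i\<bar>\<^sup>2)"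
    by (simp add: norm_vec_def L2_set_def sum_nonneg)
  also have "\<dots> \<le> (\<Sum>i\<in>(UNIV :: 3 set). h\<^sup>2)" using c by (intro sum_mono power_mono) auto
  also have "\<dots> = (sqrt 3 * h)\<^sup>2" by (simp add: power_mult_distrib)
  finally show ?thesis using h by (simp add: dist_norm power2_le_iff_abs_le)
qed

lemma cell_disjoint:
  assumes "0 < h" "x \<in> cell h k" "x \<in> cell h k'"
  shows "k = k'"
proof -
  have "k $ i = k' $ i" for i
  proof -
    have "\<lfloor>x $ i / h\<rfloor> = k $ i" "\<lfloor>x $ i / h\<rfloor> = k' $ i"
      using assms by (auto simp: cell_def floor_eq_iff field_simps)
    then show ?thesis by simp
  qed
  then show ?thesis by (simp add: vec_eq_iff)
qed

lemma cell_cover: "0 < h \<Longrightarrow> \<exists>k. x \<in> cell h k"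
proof -
  assume h: "0 < h"
  have "x \<in> cell h (\<chi> i. \<lfloor>x $ i / h\<rfloor>)"
    unfolding cell_def
  proof (clarsimp, intro conjI)
    fix i
    have "of_int \<lfloor>x $ i / h\<rfloor> \<le> x $ i / h" "x $ i / h < of_int \<lfloor>x $ i / h\<rfloor> + 1" by linarith+
    then show "h * of_int \<lfloor>x $ i / h\<rfloor> \<le> x $ i" "x $ i < h * (of_int \<lfloor>x $ i / h\<rfloor> + 1)"
      using h by (simp_all only: pos_le_divide_eq pos_divide_less_eq mult.commute)
  qed
  then show ?thesis by blast
qed

lemma cells_disjoint:
  assumes "0 < h" "Q \<in> cells h" "Q' \<in> cells h" "x \<in> Q" "x \<in> Q'"
  shows "Q = Q'"
  using assms cell_disjoint[OF assms(1)] by (auto simp: cells_def)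

lemma cells_union_volume:
  assumes "0 < h" "finite \<Q>" "\<Q> \<subseteq> cells h"
  shows "\<Union>\<Q> \<in> lmeasurable" "vol (\<Union>\<Q>) = real (card \<Q>) * h ^ 3"
proof -
  have m: "Q \<in> lmeasurable" "vol Q = h ^ 3" if "Q \<in> \<Q>" for Q
    using that assms by (auto simp: cells_def cell_measurable cell_volume)
  show "\<Union>\<Q> \<in> lmeasurable" using assms(2) m(1) by (intro fmeasurable.finite_Union) auto
  have "disjoint \<Q>"
    using assms(3) cells_disjoint[OF assms(1)] unfolding disjoint_def pairwise_def disjnt_iff by blast
  then have "vol (\<Union>\<Q>) = (\<Sum>Q\<in>\<Q>. vol Q)"
    using m(1) by (intro measure_Union') (auto simp: assms(2))
  also have "\<dots> = real (card \<Q>) * h ^ 3" using m(2) by simp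
  finally show "vol (\<Union>\<Q>) = real (card \<Q>) * h ^ 3" .
qed

text \<open>Disjoint cells of volume \<open>h ^ 3\<close> are packed into a cube of side \<open>2 d\<close>.\<close>

lemma cells_near_point_card:
  assumes h: "0 < h" and \<Q>: "finite \<Q>" "\<Q> \<subseteq> cells h" and near: "\<And>Q x. Q \<in> \<Q> \<Longrightarrow> x \<in> Q \<Longrightarrow> dist z x \<le> d"
    and d: "0 \<le> d"
  shows "real (card \<Q>) \<le> (2 * d / h) ^ 3"
proof -
  let ?c = "cbox ((\<chi> i. z $ i - d) :: pt) (\<chi> i. z $ i + d)"
  have sub: "\<Union>\<Q> \<subseteq> ?c"
  proof
    fix x assume "x \<in> \<Union>\<Q>"
    then have "norm (z - x) \<le> d" using near by (auto simp: dist_norm)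
    then have "\<bar>z $ i - x $ i\<bar> \<le> d" for i using component_le_norm_cart[of "z - x" i] by simp
    from this[unfolded abs_le_iff] have "z $ i - d \<le> x $ i \<and> x $ i \<le> z $ i + d" for i
      by (simp add: algebra_simps)
    then show "x \<in> ?c" by (simp add: mem_box_cart)
  qed
  have ne: "?c \<noteq> {}" using d by (auto simp: interval_ne_empty_cart)
  have "real (card \<Q>) * h ^ 3 = vol (\<Union>\<Q>)" by (simp add: cells_union_volume[OF h \<Q>])
  also have "\<dots> \<le> vol ?c"
    using sub cells_union_volume(1)[OF h \<Q>] by (intro measure_mono_fmeasurable) auto
  also have "\<dots> = (2 * d) ^ 3" using content_cbox_cart[OF ne] by (simp add: prod_UNIV_3 power3_eq_cube)
  finally show ?thesis using h by (simp only: power_divide pos_le_divide_eq zero_less_power)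
qed

section \<open>Slabs in a box\<close>

text \<open>The plane of the two long sides of a box carries the lines. A line is a graph over one of the two
  coordinates with a slope of modulus at most one; the flag tells over which.\<close>

definition across :: "bool \<Rightarrow> 3" where "across sw = (if sw then 3 else 2)"
definition along :: "bool \<Rightarrow> 3" where "along sw = (if sw then 2 else 3)"

definition coord :: "obox \<Rightarrow> 3 \<Rightarrow> pt \<Rightarrow> real"
  where "coord B i x = frame B i \<bullet> (x - center B)"

definition slab :: "obox \<Rightarrow> bool \<Rightarrow> real \<Rightarrow> real \<Rightarrow> real \<Rightarrow> pt set"
  where "slab B sw \<alpha> \<beta> s = {x. \<bar>coord B (across sw) x - \<alpha> - \<beta> * coord B (along sw) x\<bar> \<le> s}"

lemma coord_dist:
  assumes "orthonormal (frame B)" shows "\<bar>coord B i x - coord B i y\<bar> \<le> dist x y"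
  using orthonormal_coordinate_le[OF assms, of i "x - y"]
  by (simp add: coord_def dist_norm inner_diff_right)

lemma dist_le_coords:
  assumes "orthonormal (frame B)"
  shows "dist x y \<le> \<bar>coord B 1 x - coord B 1 y\<bar> + \<bar>coord B 2 x - coord B 2 y\<bar> + \<bar>coord B 3 x - coord B 3 y\<bar>"
  using norm_le_frame_coordinates[OF assms, of "x - y"]
  by (simp add: coord_def dist_norm inner_diff_right)

lemma box_set_coord: "x \<in> box_set B \<longleftrightarrow> (\<forall>i. \<bar>coord B i x\<bar> \<le> halfside B i)"
  by (simp add: box_set_def coord_def inner_commute)

lemma slab_move:
  assumes B: "orthonormal (frame B)" and x: "x \<in> slab B sw \<alpha> \<beta> s" and \<beta>: "\<bar>\<beta>\<bar> \<le> 1" and d: "dist x y \<le> d"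
  shows "y \<in> slab B sw \<alpha> \<beta> (s + 2 * d)"
proof -
  have 1: "\<bar>coord B (across sw) x - coord B (across sw) y\<bar> \<le> d" "\<bar>coord B (along sw) x - coord B (along sw) y\<bar> \<le> d"
    using coord_dist[OF B] d order_trans by blast+
  have "\<bar>\<beta> * (coord B (along sw) x - coord B (along sw) y)\<bar> \<le> 1 * d"
    unfolding abs_mult using 1 \<beta> by (intro mult_mono) auto
  moreover have "coord B (across sw) y - \<alpha> - \<beta> * coord B (along sw) y
      = (coord B (across sw) x - \<alpha> - \<beta> * coord B (along sw) x)
        - (coord B (across sw) x - coord B (across sw) y) + \<beta> * (coord B (along sw) x - coord B (along sw) y)"
    by (simp add: algebra_simps)
  ultimately show ?thesis using x 1 unfolding slab_def mem_Collect_eq by linarith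
qed

text \<open>Taking the larger of the two components of the direction as the independent variable makes the slope
  at most one. The stronger bound of order \<open>b / r\<close> is only informative if \<open>b\<close> is much smaller than \<open>r\<close>;
  then the length of the tube forces its direction to be close to the longest side of the box.\<close>

lemma tube_lies_along_strip:
  fixes C a b r s :: real
  assumes C: "10 \<le> C" and abr: "0 < a" "a \<le> b" "b \<le> r"
    and B: "orthonormal (frame B)"
    and half: "2 * halfside B 1 \<le> C * a" "2 * halfside B 2 \<le> C * b"
    and len: "r / C \<le> dist p q" and s: "0 \<le> s" and sub: "segment_tube p q s \<subseteq> box_set B"
  shows "\<exists>sw \<alpha> \<beta>. \<bar>\<beta>\<bar> \<le> 1 \<and> \<bar>\<beta>\<bar> \<le> 4 * C ^ 3 * b / r \<and> segment_tube p q s \<subseteq> slab B sw \<alpha> \<beta> (2 * s)"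
proof -
  have r: "0 < r" and b: "0 < b" using abr by auto
  define d where "d i = coord B i q - coord B i p" for i
  have ends: "p \<in> box_set B" "q \<in> box_set B"
  proof -
    have "p \<in> segment_tube p q s" "q \<in> segment_tube p q s"
      unfolding segment_tube_iff using s
      by (rule_tac bexI[of _ p], simp, simp) (rule_tac bexI[of _ q], simp_all add: s)
    then show "p \<in> box_set B" "q \<in> box_set B" using sub by auto
  qed
  have dle: "\<bar>d i\<bar> \<le> 2 * halfside B i" for i
  proof -
    have "\<bar>coord B i p\<bar> \<le> halfside B i" "\<bar>coord B i q\<bar> \<le> halfside B i" using ends by (auto simp: box_set_coord)
    then show ?thesis unfolding d_def by linarith
  qed
  define sw where "sw = (\<bar>d 3\<bar> < \<bar>d 2\<bar>)"
  define \<beta> where "\<beta> = d (across sw) / d (along sw)"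
  define \<alpha> where "\<alpha> = coord B (across sw) p - \<beta> * coord B (along sw) p"
  have order: "\<bar>d (across sw)\<bar> \<le> \<bar>d (along sw)\<bar>" by (auto simp: sw_def across_def along_def)
  have \<beta>1: "\<bar>\<beta>\<bar> \<le> 1" using order by (auto simp: \<beta>_def abs_divide divide_le_eq)
  have slope: "d (across sw) = \<beta> * d (along sw)" using order by (cases "d (along sw) = 0") (auto simp: \<beta>_def)
  have "\<bar>\<beta>\<bar> \<le> 4 * C ^ 3 * b / r"
  proof (cases "r \<le> 4 * C ^ 3 * b")
    case True
    then have "1 \<le> 4 * C ^ 3 * b / r" using r by simp
    then show ?thesis using \<beta>1 by simp
  next
    case False
    have C2: "C * (4 * C * b) \<le> C * (4 * C ^ 2 * b)"
      using C b by (intro mult_left_mono mult_right_mono) (auto simp: power2_eq_square)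
    have "C * (4 * C ^ 2 * b) < r" using False by (simp add: power3_eq_cube power2_eq_square)
    with C2 have "C * (4 * C * b) < r" by (rule le_less_trans)
    then have small: "4 * (C * b) \<le> r / C"
      using C by (simp add: pos_le_divide_eq mult_ac)
    have "\<bar>d 1\<bar> \<le> C * b"
      using dle[of 1] half(1) abr C mult_left_mono[of a b C] by linarith
    moreover have d2: "\<bar>d 2\<bar> \<le> C * b" using dle[of 2] half(2) by linarith
    moreover have "r / C \<le> \<bar>d 1\<bar> + \<bar>d 2\<bar> + \<bar>d 3\<bar>"
      using len dist_le_coords[OF B, of q p] by (simp add: d_def dist_commute)
    ultimately have d3: "r / (2 * C) \<le> \<bar>d 3\<bar>" using small by simp
    have "0 < C * b" using C b by simp
    then have "\<bar>d 2\<bar> < \<bar>d 3\<bar>" using d2 d3 small by simp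
    then have "\<beta> = d 2 / d 3" by (simp add: \<beta>_def sw_def across_def along_def)
    then have "\<bar>\<beta>\<bar> = \<bar>d 2\<bar> / \<bar>d 3\<bar>" by simp
    also have "\<dots> \<le> (C * b) / (r / (2 * C))" using d2 d3 r C b by (intro frac_le) auto
    also have "\<dots> = 2 * C ^ 2 * b / r" using C by (simp add: power2_eq_square)
    also have "\<dots> \<le> 4 * C ^ 3 * b / r"
    proof -
      have "C ^ 2 \<le> C ^ 3" using C by (intro power_increasing) auto
      moreover have "0 \<le> C ^ 2" by simp
      ultimately have "2 * C ^ 2 \<le> 4 * C ^ 3" by linarith
      then show ?thesis using r b by (intro divide_right_mono mult_right_mono) auto
    qed
    finally show ?thesis .
  qed
  moreover have "segment_tube p q s \<subseteq> slab B sw \<alpha> \<beta> (2 * s)"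
  proof
    fix x assume "x \<in> segment_tube p q s"
    then obtain y where y: "y \<in> closed_segment p q" "dist x y \<le> s" by (auto simp: segment_tube_iff)
    obtain u where "y = (1 - u) *\<^sub>R p + u *\<^sub>R q" using y(1) by (auto simp: in_segment)
    then have "y = p + u *\<^sub>R (q - p)" by (simp add: algebra_simps)
    then have cy: "coord B i y = coord B i p + u * d i" for i
      by (simp add: coord_def d_def inner_diff_right inner_add_right)
    have "y \<in> slab B sw \<alpha> \<beta> 0" unfolding slab_def using cy by (simp add: \<alpha>_def slope algebra_simps)
    from slab_move[OF B this \<beta>1, of x s] y show "x \<in> slab B sw \<alpha> \<beta> (2 * s)" by (simp add: dist_commute)
  qed
  ultimately show ?thesis using \<beta>1 by blast
qed

text \<open>The section is contained in a sheared box in which the half-side across the slab is replaced by \<open>s\<close>.\<close>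

lemma slab_section_volume:
  assumes B: "orthonormal (frame B)" and half: "\<And>i. 0 < halfside B i" and s: "0 \<le> s"
  shows "convex (box_set B \<inter> slab B sw \<alpha> \<beta> s)"
    and "vol (box_set B \<inter> slab B sw \<alpha> \<beta> s) / vol (box_set B) \<le> s / halfside B (across sw)"
proof -
  define k l where "k = across sw" and "l = along sw"
  have kl: "k \<noteq> l" by (auto simp: k_def l_def across_def along_def)
  let ?g = "\<lambda>i. if i = k then frame B k - \<beta> *\<^sub>R frame B l else frame B i"
  define w where "w i = (if i = k then s else halfside B i)" for i
  have w0: "0 \<le> w i" for i using s half[of i] by (simp add: w_def)
  define c where "c i = (if i = k then \<alpha> else 0) + ?g i \<bullet> center B" for i
  have slab_eq: "slab B sw \<alpha> \<beta> s = {x. \<bar>?g k \<bullet> x - c k\<bar> \<le> s}"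
    by (auto simp: slab_def coord_def c_def k_def[symmetric] l_def[symmetric] inner_diff_left inner_diff_right algebra_simps)
  have strip: "convex {x. \<bar>g \<bullet> x - c\<bar> \<le> s}" for g :: pt and c s
  proof -
    have "{x. \<bar>g \<bullet> x - c\<bar> \<le> s} = {x. g \<bullet> x \<le> c + s} \<inter> {x. g \<bullet> x \<ge> c - s}" by (auto simp: abs_le_iff)
    then show ?thesis by (simp add: convex_Int convex_halfspace_le convex_halfspace_ge)
  qed
  have "convex (box_set B)"
  proof -
    have "box_set B = (\<Inter>i. {x. \<bar>frame B i \<bullet> x - frame B i \<bullet> center B\<bar> \<le> halfside B i})"
      unfolding box_set_eq by auto
    then show ?thesis by (simp only: convex_INT strip)
  qed
  then show conv: "convex (box_set B \<inter> slab B sw \<alpha> \<beta> s)"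
    unfolding slab_eq by (intro convex_Int strip)
  define P where "P = {x. \<forall>i. \<bar>?g i \<bullet> x - c i\<bar> \<le> w i}"
  have P: "P \<in> lmeasurable" "vol P = 8 * w 1 * w 2 * w 3"
    unfolding P_def by (rule sheared_box_measure[OF B kl w0])+
  have box: "box_set B \<in> lmeasurable" "vol (box_set B) = 8 * halfside B 1 * halfside B 2 * halfside B 3"
    using box_set_measure[OF B] half by (simp_all add: less_imp_le)
  have "box_set B \<inter> slab B sw \<alpha> \<beta> s \<subseteq> P"
    unfolding box_set_eq slab_eq P_def w_def by (auto simp: c_def)
  moreover have "box_set B \<inter> slab B sw \<alpha> \<beta> s \<in> sets lebesgue"
  proof -
    have "bounded (box_set B \<inter> slab B sw \<alpha> \<beta> s)"
    proof (rule boundedI)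
      fix x assume "x \<in> box_set B \<inter> slab B sw \<alpha> \<beta> s"
      then have i: "\<bar>coord B i x\<bar> \<le> halfside B i" for i by (simp add: box_set_coord)
      have "norm x \<le> norm (center B) + dist x (center B)"
        by (metis add.commute dist_norm norm_triangle_sub)
      moreover have "dist x (center B) \<le> halfside B 1 + halfside B 2 + halfside B 3"
        using dist_le_coords[OF B, of x "center B"] i[of 1] i[of 2] i[of 3] by (simp add: coord_def)
      ultimately show "norm x \<le> norm (center B) + (halfside B 1 + halfside B 2 + halfside B 3)" by linarith
    qed
    then show ?thesis using measurable_convex[OF conv] by (auto simp: fmeasurable_def)
  qed
  ultimately have "vol (box_set B \<inter> slab B sw \<alpha> \<beta> s) \<le> vol P" using P(1) by (intro measure_mono_fmeasurable)
  then have "vol (box_set B \<inter> slab B sw \<alpha> \<beta> s) / vol (box_set B) \<le> vol P / vol (box_set B)"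
    by (intro divide_right_mono) auto
  also have "vol P / vol (box_set B) = s / halfside B k"
    unfolding P(2) box(2) w_def k_def across_def using half[of 1] half[of 2] half[of 3] by (simp add: field_simps)
  finally show "vol (box_set B \<inter> slab B sw \<alpha> \<beta> s) / vol (box_set B) \<le> s / halfside B (across sw)"
    by (simp add: k_def)
qed

lemma number_of_scales:
  assumes "0 < a" "a \<le> b"
  shows "\<exists>I. b \<le> 2 ^ I * a \<and> 4 * real I + 2 \<le> 9 * ln (2 * b / a)"
proof -
  define I where "I = nat \<lceil>log 2 (b / a)\<rceil>"
  have q: "1 \<le> b / a" using assms by simp
  then have l0: "0 \<le> log 2 (b / a)" by simp
  have I1: "log 2 (b / a) \<le> real I" and I2: "real I \<le> log 2 (b / a) + 1"
    using l0 by (auto simp: I_def)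
  have "b / a = 2 powr (log 2 (b / a))" using q by simp
  also have "\<dots> \<le> 2 powr (real I)" using I1 by (intro powr_mono) auto
  also have "\<dots> = 2 ^ I" by (simp add: powr_realpow)
  finally have "b \<le> 2 ^ I * a" using assms by (simp add: divide_le_eq)
  moreover have "4 * real I + 2 \<le> 9 * ln (2 * b / a)"
  proof -
    have ln2: "2 / 3 \<le> ln (2::real)" using ln2_ge_two_thirds .
    have lna: "0 \<le> ln (b / a)" using q by simp
    have "log 2 (b / a) \<le> 3 / 2 * ln (b / a)"
    proof -
      have "ln (b / a) / ln 2 \<le> ln (b / a) / (2 / 3)" using ln2 lna by (intro divide_left_mono) auto
      then show ?thesis by (simp add: log_def)
    qed
    moreover have "ln (2 * b / a) = ln 2 + ln (b / a)"
    proof -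
      have "2 * b / a = 2 * (b / a)" by simp
      then show ?thesis using q by (simp only: ln_mult_pos)
    qed
    ultimately have "4 * real I + 2 \<le> 6 + 6 * ln (b / a)" using I2 by linarith
    also have "\<dots> \<le> 9 * ln (2 * b / a)"
      using ln2 lna \<open>ln (2 * b / a) = ln 2 + ln (b / a)\<close> by linarith
    finally show ?thesis .
  qed
  ultimately show ?thesis by blast
qed

section \<open>The shaded volume of one parent\<close>

text \<open>The explicit constant collects the powers of \<open>C\<close> that the proofs below produce.\<close>

definition parent_constant :: "real \<Rightarrow> real"
  where "parent_constant C = 2 * C ^ 3 * (4 * C ^ 10 * (368640 * C ^ 7 / C ^ 5 + 2592 * (28 * C ^ 2) ^ 3 * 720 * C ^ 3)
      + 18 * C ^ 6 * 20480 * C ^ 6)"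

text \<open>The arithmetic of the choice \<open>\<rho> = lam * b\<close>. In the first case both terms of the incidence bound
  compare with \<open>lam powr (2 - \<sigma>)\<close>. If \<open>lam * b\<close> is below the resolution of the cells, the pointwise count
  of lines near a point is already enough.\<close>

lemma parent_cells_from_incidences:
  fixes C a b r N n \<Lambda> lam \<Gamma> CF \<sigma> L :: real
  assumes C: "10 \<le> C" and abr: "0 < a" "a \<le> b" "b \<le> r" and \<sigma>: "0 \<le> \<sigma>" "\<sigma> \<le> 1"
    and lam: "0 < lam" and CF: "1 \<le> CF" and N: "0 < N" and n: "0 \<le> n" and L: "1 / 2 \<le> L"
    and \<Gamma>: "\<Gamma> = 16 * C ^ 2 * CF * N / b powr (1 + \<sigma>)"
    and low: "lam * N * r / (2 * C ^ 5 * a) \<le> \<Lambda>"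
    and fine: "9 * C * a \<le> lam * b \<Longrightarrow> \<Lambda>\<^sup>2 \<le> n * (384 * (3 * C * a) * (20 * C ^ 4 * b) * \<Gamma> * ((lam * b) powr \<sigma> / (lam * b)) * \<Lambda>
        + 2592 * (28 * C ^ 2) ^ 3 * N * (5 * C * r) * (lam * b) powr \<sigma> * \<Gamma> * (9 * L))"
    and coarse: "lam * b < 9 * C * a \<Longrightarrow> \<Lambda> \<le> n * (64 * (20 * C ^ 4 * b) * \<Gamma> * (9 * C * a) powr \<sigma>)"
  shows "C ^ 3 * a ^ 3 * (r * b / a\<^sup>2) * lam powr (2 - \<sigma>) \<le> parent_constant C * CF * L * (n * a ^ 3)"
proof -
  have pos: "0 < b" "0 < r" "0 < C" using abr C by auto
  define \<Lambda>0 where "\<Lambda>0 = lam * N * r / (2 * C ^ 5 * a)"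
  have \<Lambda>0: "0 < \<Lambda>0" using lam N pos abr by (simp add: \<Lambda>0_def)
  have le: "\<Lambda>0 \<le> \<Lambda>" using low by (simp add: \<Lambda>0_def)
  have bp: "b powr (1 + \<sigma>) = b * b powr \<sigma>" using pos by (simp add: powr_add)
  define K1 where "K1 = 368640 * C ^ 7"
  define K2 where "K2 = 2592 * (28 * C ^ 2) ^ 3 * 720 * C ^ 3"
  have K: "0 \<le> K1" "0 \<le> K2" using pos by (auto simp: K1_def K2_def)
  have main: "lam powr (2 - \<sigma>) * (r * b / a\<^sup>2) \<le> n * CF * (2 * L) * (4 * C ^ 10 * (K1 / C ^ 5 + K2) + 18 * C ^ 6 * 20480 * C ^ 6)"
  proof (cases "9 * C * a \<le> lam * b")
    case True
    define A where "A = 384 * (3 * C * a) * (20 * C ^ 4 * b) * \<Gamma> * ((lam * b) powr \<sigma> / (lam * b))"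
    define B where "B = 2592 * (28 * C ^ 2) ^ 3 * N * (5 * C * r) * (lam * b) powr \<sigma> * \<Gamma> * (9 * L)"
    have \<Gamma>0: "0 \<le> \<Gamma>" using \<Gamma> CF N by simp
    have AB: "0 \<le> A" "0 \<le> B" using \<Gamma>0 pos abr lam N L by (auto simp: A_def B_def)
    have A: "A = K1 * CF * N * a * (lam powr \<sigma> / lam) / b"
      using pos lam unfolding A_def \<Gamma> K1_def bp by (simp add: powr_mult field_simps power2_eq_square power_numeral_reduce)
    have B: "B = K2 * CF * N\<^sup>2 * r * lam powr \<sigma> * L / b"
      using pos lam unfolding B_def \<Gamma> K2_def bp by (simp add: powr_mult field_simps power2_eq_square power_numeral_reduce)
    \<comment> \<open>The incidence bound is inherited by the smaller number \<open>\<Lambda>0\<close>, since \<open>A / t + B / t\<^sup>2\<close> decreases in \<open>t\<close>.\<close>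
    have "\<Lambda>0\<^sup>2 \<le> n * (A * \<Lambda>0 + B)"
    proof -
      have "\<Lambda>0\<^sup>2 * \<Lambda>\<^sup>2 \<le> \<Lambda>0\<^sup>2 * (n * (A * \<Lambda> + B))"
        using fine[OF True] by (intro mult_left_mono) (auto simp: A_def B_def)
      also have "\<dots> = n * (A * (\<Lambda>0 * \<Lambda>0 * \<Lambda>) + B * (\<Lambda>0 * \<Lambda>0))" by (simp add: power2_eq_square algebra_simps)
      also have "\<dots> \<le> n * (A * (\<Lambda>0 * \<Lambda> * \<Lambda>) + B * (\<Lambda> * \<Lambda>))"
        using n AB \<Lambda>0 le by (intro mult_left_mono add_mono mult_mono) auto
      also have "\<dots> = \<Lambda>\<^sup>2 * (n * (A * \<Lambda>0 + B))" by (simp add: power2_eq_square algebra_simps)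
      finally show ?thesis using \<Lambda>0 le by (simp add: mult.commute)
    qed
    also have "A * \<Lambda>0 + B = (N\<^sup>2 * r * lam powr \<sigma> / b) * (CF * (K1 / (2 * C ^ 5) + K2 * L))"
      unfolding A B \<Lambda>0_def using pos lam abr by (simp add: field_simps power2_eq_square)
    also have "\<Lambda>0\<^sup>2 = (N\<^sup>2 * r * lam powr \<sigma> / b) * (lam powr (2 - \<sigma>) * (r * b / a\<^sup>2) / (4 * C ^ 10))"
    proof -
      have "lam powr \<sigma> * lam powr (2 - \<sigma>) = lam\<^sup>2" using lam by (simp add: powr_add[symmetric] powr_numeral)
      moreover have "(2 * C ^ 5 * a)\<^sup>2 = 4 * C ^ 10 * a\<^sup>2"
        by (simp add: power_mult_distrib power_mult[symmetric])
      ultimately show ?thesis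
        unfolding \<Lambda>0_def power_divide power_mult_distrib[of _ r] power_mult_distrib[of lam] using pos
        by (simp add: field_simps power2_eq_square)
    qed
    also have "n * ((N\<^sup>2 * r * lam powr \<sigma> / b) * (CF * (K1 / (2 * C ^ 5) + K2 * L)))
        = (N\<^sup>2 * r * lam powr \<sigma> / b) * (n * (CF * (K1 / (2 * C ^ 5) + K2 * L)))" by simp
    finally have "lam powr (2 - \<sigma>) * (r * b / a\<^sup>2) / (4 * C ^ 10) \<le> n * (CF * (K1 / (2 * C ^ 5) + K2 * L))"
      using pos lam N by (subst (asm) mult_le_cancel_left_pos) auto
    then have "lam powr (2 - \<sigma>) * (r * b / a\<^sup>2) \<le> n * (CF * (K1 / (2 * C ^ 5) + K2 * L)) * (4 * C ^ 10)"
      using pos by (subst (asm) pos_divide_le_eq) auto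
    also have "\<dots> \<le> n * (CF * (2 * L * (K1 / C ^ 5 + K2))) * (4 * C ^ 10)"
    proof -
      have "K1 / (2 * C ^ 5) \<le> 2 * L * (K1 / C ^ 5)"
        using mult_right_mono[of "1 / 2" "2 * L" "K1 / C ^ 5"] L K pos by simp
      moreover have "K2 * L \<le> 2 * L * K2" using L K by simp
      ultimately show ?thesis using n CF pos by (intro mult_right_mono mult_left_mono) (auto simp: algebra_simps)
    qed
    also have "\<dots> = n * CF * (2 * L) * (4 * C ^ 10 * (K1 / C ^ 5 + K2))" by (simp add: algebra_simps)
    also have "\<dots> \<le> n * CF * (2 * L) * (4 * C ^ 10 * (K1 / C ^ 5 + K2) + 18 * C ^ 6 * 20480 * C ^ 6)"
      using n CF L pos by (intro mult_left_mono) auto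
    finally show ?thesis .
  next
    case False
    then have small: "lam * b < 9 * C * a" by simp
    define q where "q = 9 * C * a / b"
    have q: "0 < q" "lam < q" using small pos abr by (auto simp: q_def field_simps)
    have "\<Lambda>0 \<le> n * (64 * (20 * C ^ 4 * b) * \<Gamma> * (9 * C * a) powr \<sigma>)" using le coarse[OF small] by simp
    also have "\<dots> = n * (20480 * C ^ 6 * CF * N * q powr \<sigma>)"
    proof -
      have "(9 * C * a) powr \<sigma> = q powr \<sigma> * b powr \<sigma>"
        using pos abr by (simp add: q_def powr_mult[symmetric])
      then show ?thesis using pos unfolding \<Gamma> bp by (simp add: field_simps power2_eq_square power_numeral_reduce)
    qed
    finally have "lam * r / a \<le> n * (20480 * C ^ 6 * CF * q powr \<sigma>) * (2 * C ^ 5)"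
      using pos abr N unfolding \<Lambda>0_def by (simp add: field_simps)
    then have step: "(9 * C / q powr \<sigma>) * (lam * r / a) \<le> (9 * C / q powr \<sigma>) * (n * (20480 * C ^ 6 * CF * q powr \<sigma>) * (2 * C ^ 5))"
      using q pos by (intro mult_left_mono) auto
    have "lam powr (2 - \<sigma>) = lam * lam powr (1 - \<sigma>)"
      using lam powr_add[of lam 1 "1 - \<sigma>"] by simp
    also have "\<dots> \<le> lam * q powr (1 - \<sigma>)" using q lam \<sigma> by (intro mult_left_mono powr_mono2) auto
    also have "q powr (1 - \<sigma>) = q / q powr \<sigma>" using q by (simp add: powr_diff)
    finally have "lam powr (2 - \<sigma>) * (r * b / a\<^sup>2) \<le> lam * (q / q powr \<sigma>) * (r * b / a\<^sup>2)"
      using pos by (intro mult_right_mono) auto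
    also have "\<dots> = (9 * C / q powr \<sigma>) * (lam * r / a)"
    proof -
      have "q * (r * b / a\<^sup>2) = 9 * C * (r / a)" using pos abr by (simp add: q_def power2_eq_square)
      then have "lam * (1 / q powr \<sigma>) * (q * (r * b / a\<^sup>2)) = lam * (1 / q powr \<sigma>) * (9 * C * (r / a))" by (simp only:)
      then show ?thesis by (simp add: mult_ac)
    qed
    also note step
    also have "(9 * C / q powr \<sigma>) * (n * (20480 * C ^ 6 * CF * q powr \<sigma>) * (2 * C ^ 5))
        = n * CF * 1 * (18 * C ^ 6 * 20480 * C ^ 6)"
    proof -
      have "C * C ^ 5 = C ^ 6" "C * C ^ 11 = C ^ 12" by (simp_all add: power_Suc[symmetric])
      then show ?thesis using q by (simp add: field_simps)
    qed
    also have "\<dots> \<le> n * CF * (2 * L) * (18 * C ^ 6 * 20480 * C ^ 6)"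
      using n CF L pos by (intro mult_left_mono mult_right_mono) auto
    also have "\<dots> \<le> n * CF * (2 * L) * (4 * C ^ 10 * (K1 / C ^ 5 + K2) + 18 * C ^ 6 * 20480 * C ^ 6)"
      using n CF L pos K by (intro mult_left_mono) auto
    finally show ?thesis .
  qed
  have "C ^ 3 * a ^ 3 * (r * b / a\<^sup>2) * lam powr (2 - \<sigma>) = C ^ 3 * a ^ 3 * (lam powr (2 - \<sigma>) * (r * b / a\<^sup>2))"
    by (simp only: mult_ac)
  also have "\<dots> \<le> C ^ 3 * a ^ 3 * (n * CF * (2 * L) * (4 * C ^ 10 * (K1 / C ^ 5 + K2) + 18 * C ^ 6 * 20480 * C ^ 6))"
    using main pos abr by (intro mult_left_mono) auto
  also have "\<dots> = parent_constant C * CF * L * (n * a ^ 3)"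
    unfolding parent_constant_def K1_def K2_def by (simp only: mult_ac)
  finally show ?thesis .
qed

text \<open>The lines are those of the guides \<open>G\<close>, which may be thicker than the children but whose radii are at
  most comparable to the side of the cells; only the mass estimate looks at the shadings \<open>W\<close>
  themselves. Each cell is represented by a point of the box. As the box has thickness of order \<open>a\<close>, a bounded number of cells project to the same
  place of the plane, and a cell contains at most a multiple of \<open>a \<delta>\<^sup>2\<close> of the mass of a child. Lines
  over one coordinate only are kept, those that carry half of the mass.\<close>

theorem parent_cells_lower_bound:
  fixes C \<delta> a b r h CF \<sigma> lam :: real and B :: obox and T :: "label set" and W :: "label \<Rightarrow> pt set"
  assumes C: "10 \<le> C" and scales: "0 < \<delta>" "\<delta> \<le> a" "a \<le> b" "b \<le> r" and h: "a / C \<le> h" "h \<le> a / 1000"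
    and B: "orthonormal (frame B)"
    and half: "2 * halfside B 1 \<le> C * a" "2 * halfside B 2 \<le> C * b" "2 * halfside B 3 \<le> C * r"
    and T: "finite T" "T \<noteq> {}"
    and tubes: "\<And>t. t \<in> T \<Longrightarrow> \<exists>p q s. W t \<subseteq> segment_tube p q s \<and> 0 \<le> s \<and> s \<le> C * \<delta>"
    and guides: "\<And>t. t \<in> T \<Longrightarrow> \<exists>p q s. G t = segment_tube p q s \<and> r / C \<le> dist p q \<and> 0 \<le> s \<and> s \<le> C * a"
    and guided: "\<And>t. t \<in> T \<Longrightarrow> W t \<subseteq> G t" "\<And>t. t \<in> T \<Longrightarrow> G t \<subseteq> box_set B"
    and meas: "\<And>t. t \<in> T \<Longrightarrow> W t \<in> sets lebesgue"
    and \<sigma>: "0 \<le> \<sigma>" "\<sigma> \<le> 1" and CF: "1 \<le> CF"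
    and count: "\<And>sw \<alpha> \<beta> s. a \<le> s \<Longrightarrow> real (card {t \<in> T. G t \<subseteq> slab B sw \<alpha> \<beta> s})
      \<le> CF * real (card T) * (2 * C * s / b) powr (1 + \<sigma>)"
    and \<Q>: "finite \<Q>" "\<Q> \<subseteq> cells h" "\<And>Q. Q \<in> \<Q> \<Longrightarrow> Q \<inter> box_set B \<noteq> {}"
    and lam: "0 < lam" "lam \<le> 1"
    and mass: "lam * real (card T) * (r * \<delta>\<^sup>2 / C ^ 3) \<le> (\<Sum>t\<in>T. \<Sum>Q\<in>\<Q>. vol (W t \<inter> Q))"
  shows "a * b * r * lam powr (2 - \<sigma>)
      \<le> parent_constant C * CF * ln (2 * b / a) * (real (card \<Q>) * h ^ 3)"
proof -
  have pos: "0 < a" "0 < b" "0 < r" "0 < C" "0 < h" using scales C h by (auto intro: less_le_trans[of 0 "a / C" h])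
  have aC: "a \<le> C * a" using C pos mult_right_mono[of 1 C a] by simp
  define N where "N = real (card T)"
  have N: "0 < N" using T by (simp add: N_def card_gt_0_iff)
  have dia: "dist x y \<le> a / 500" if "Q \<in> \<Q>" "x \<in> Q" "y \<in> Q" for Q x y
  proof -
    have "dist x y \<le> sqrt 3 * h" using that \<Q>(2) by (auto simp: cells_def intro: cell_diameter)
    also have "\<dots> \<le> 2 * (a / 1000)" using h pos real_sqrt_le_mono[of 3 4] by (intro mult_mono) auto
    finally show ?thesis by simp
  qed
  have "\<exists>sw \<alpha> \<beta>. \<bar>\<beta>\<bar> \<le> 1 \<and> \<bar>\<beta>\<bar> \<le> 4 * C ^ 3 * b / r \<and> G t \<subseteq> slab B sw \<alpha> \<beta> (2 * C * a)" if "t \<in> T" for t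
  proof -
    obtain p q s where g: "G t = segment_tube p q s" "r / C \<le> dist p q" "0 \<le> s" "s \<le> C * a"
      using guides \<open>t \<in> T\<close> by blast
    obtain sw \<alpha> \<beta> where x: "\<bar>\<beta>\<bar> \<le> 1" "\<bar>\<beta>\<bar> \<le> 4 * C ^ 3 * b / r" "segment_tube p q s \<subseteq> slab B sw \<alpha> \<beta> (2 * s)"
      using tube_lies_along_strip[OF C pos(1) scales(3,4) B half(1,2) g(2,3)] guided(2)[OF \<open>t \<in> T\<close>] g(1) by metis
    have "slab B sw \<alpha> \<beta> (2 * s) \<subseteq> slab B sw \<alpha> \<beta> (2 * C * a)" using g(4) by (auto simp: slab_def)
    then show ?thesis using x g(1) by blast
  qed
  then obtain swt \<alpha> \<beta> where line: "\<And>t. t \<in> T \<Longrightarrow> \<bar>\<beta> t\<bar> \<le> 1" "\<And>t. t \<in> T \<Longrightarrow> \<bar>\<beta> t\<bar> \<le> 4 * C ^ 3 * b / r"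
      "\<And>t. t \<in> T \<Longrightarrow> G t \<subseteq> slab B (swt t) (\<alpha> t) (\<beta> t) (2 * C * a)"
    by metis
  define m where "m t = (\<Sum>Q\<in>\<Q>. vol (W t \<inter> Q))" for t
  have "\<exists>sw. sum m T \<le> 2 * sum m {t \<in> T. swt t = sw}"
  proof -
    have "sum m T = sum m ({t \<in> T. swt t = True} \<union> {t \<in> T. swt t = False})" by (intro sum.cong) auto
    also have "\<dots> = sum m {t \<in> T. swt t = True} + sum m {t \<in> T. swt t = False}"
      using T by (intro sum.union_disjoint) auto
    finally show ?thesis by (cases "sum m {t \<in> T. swt t = True} \<le> sum m {t \<in> T. swt t = False}")
      (auto intro: exI[of _ True] exI[of _ False])
  qed
  then obtain sw where sw: "sum m T \<le> 2 * sum m {t \<in> T. swt t = sw}" by blast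
  define F where "F = {t \<in> T. swt t = sw}"
  have F: "finite F" "F \<subseteq> T" using T by (auto simp: F_def)
  have FN: "real (card F) \<le> N" unfolding N_def using F T by (intro of_nat_mono card_mono) auto
  have "\<forall>Q\<in>\<Q>. \<exists>x. x \<in> Q \<inter> box_set B" using \<Q>(3) by blast
  then obtain pt where pt: "\<And>Q. Q \<in> \<Q> \<Longrightarrow> pt Q \<in> Q" "\<And>Q. Q \<in> \<Q> \<Longrightarrow> pt Q \<in> box_set B" by (metis IntE)
  define pu pv where "pu Q = coord B (across sw) (pt Q)" and "pv Q = coord B (along sw) (pt Q)" for Q
  define \<eta> R M where "\<eta> = 3 * C * a" and "R = 5 * C * r" and "M = 20 * C ^ 4 * b"
  define \<Gamma> where "\<Gamma> = 16 * C ^ 2 * CF * N / b powr (1 + \<sigma>)"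
  define Gc where "Gc = (28 * C ^ 2) ^ 3"
  have \<eta>: "0 < \<eta>" and R: "0 < R" and \<Gamma>: "0 < \<Gamma>" and Gc: "0 < Gc"
    using pos CF N by (auto simp: \<eta>_def R_def \<Gamma>_def Gc_def)
  define \<Lambda> where "\<Lambda> = (\<Sum>Q\<in>\<Q>. real (card {t \<in> F. \<bar>pu Q - \<alpha> t - \<beta> t * pv Q\<bar> \<le> \<eta>}))"
  have half3: "halfside B i \<le> C * r / 2" for i
  proof -
    have "C * a \<le> C * r" "C * b \<le> C * r" using scales pos by (auto intro!: mult_left_mono)
    then show ?thesis using half exhaust_3[of i] by auto
  qed
  have Car: "C * a \<le> C * r" using scales pos by (auto intro!: mult_left_mono)
  have along: "\<bar>coord B (along sw) x\<bar> \<le> R" if "x \<in> box_set B" for x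
  proof -
    have "\<bar>coord B (along sw) x\<bar> \<le> C * r / 2" using that half3[of "along sw"] order_trans
      unfolding box_set_coord by blast
    then show ?thesis using pos by (simp add: R_def)
  qed
  \<comment> \<open>A child has mass in a cell only if its line passes within \<open>\<eta>\<close> of the representative of the cell.\<close>
  have massF: "sum m F \<le> C\<^sup>2 * a * \<delta>\<^sup>2 * \<Lambda>"
  proof -
    have each: "vol (W t \<inter> Q) \<le> (if \<bar>pu Q - \<alpha> t - \<beta> t * pv Q\<bar> \<le> \<eta> then C\<^sup>2 * a * \<delta>\<^sup>2 else 0)"
      if t: "t \<in> F" and Q: "Q \<in> \<Q>" for t Q
    proof (cases "W t \<inter> Q = {}")
      case True
      then show ?thesis using pos by simp
    next
      case False
      then obtain z where z: "z \<in> W t" "z \<in> Q" by blast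
      have tT: "t \<in> T" and "swt t = sw" using t by (auto simp: F_def)
      have "z \<in> slab B sw (\<alpha> t) (\<beta> t) (2 * C * a)"
        using line(3)[OF tT] guided(1)[OF tT] z \<open>swt t = sw\<close> by auto
      from slab_move[OF B this line(1)[OF tT] dia[OF Q z(2) pt(1)[OF Q]]]
      have "\<bar>pu Q - \<alpha> t - \<beta> t * pv Q\<bar> \<le> 2 * C * a + 2 * (a / 500)" by (simp add: slab_def pu_def pv_def)
      also have "\<dots> \<le> \<eta>" using pos aC unfolding \<eta>_def by linarith
      finally have near: "\<bar>pu Q - \<alpha> t - \<beta> t * pv Q\<bar> \<le> \<eta>" .
      obtain p q s where tub: "W t \<subseteq> segment_tube p q s" "0 \<le> s" "s \<le> C * \<delta>" using tubes[OF tT] by blast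
      have "Q \<in> sets lebesgue" using Q \<Q>(2) cell_measurable by (auto simp: cells_def fmeasurable_def)
      then have "vol (W t \<inter> Q) \<le> 8 * (a / 500) * s\<^sup>2"
        using tub pos meas[OF tT] dia[OF Q] by (intro segment_tube_piece_volume_le[of s "a / 500" _ p q]) auto
      also have "\<dots> \<le> a * s\<^sup>2" using pos by (intro mult_right_mono) auto
      also have "\<dots> \<le> a * (C * \<delta>)\<^sup>2" using pos tub by (intro mult_left_mono power_mono) auto
      finally show ?thesis using near by (simp add: power_mult_distrib mult_ac)
    qed
    have "sum m F \<le> (\<Sum>t\<in>F. \<Sum>Q\<in>\<Q>. if \<bar>pu Q - \<alpha> t - \<beta> t * pv Q\<bar> \<le> \<eta> then C\<^sup>2 * a * \<delta>\<^sup>2 else 0)"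
      unfolding m_def by (intro sum_mono each)
    also have "\<dots> = (\<Sum>Q\<in>\<Q>. \<Sum>t\<in>F. if \<bar>pu Q - \<alpha> t - \<beta> t * pv Q\<bar> \<le> \<eta> then C\<^sup>2 * a * \<delta>\<^sup>2 else 0)"
      by (rule sum.swap)
    also have "\<dots> = C\<^sup>2 * a * \<delta>\<^sup>2 * \<Lambda>"
      unfolding \<Lambda>_def sum_distrib_left using F by (intro sum.cong) (auto simp: sum.If_cases Int_def)
    finally show ?thesis .
  qed
  have low: "lam * N * r / (2 * C ^ 5 * a) \<le> \<Lambda>"
  proof -
    have "lam * N * (r * \<delta>\<^sup>2 / C ^ 3) \<le> 2 * (C\<^sup>2 * a * \<delta>\<^sup>2 * \<Lambda>)"
      using mass sw massF by (simp add: m_def N_def F_def)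
    then have "\<delta>\<^sup>2 * (lam * N * r / C ^ 3) \<le> \<delta>\<^sup>2 * (2 * C\<^sup>2 * a * \<Lambda>)" by (simp add: mult_ac)
    then have "lam * N * r / C ^ 3 \<le> 2 * C\<^sup>2 * a * \<Lambda>"
      using scales(1) by (subst (asm) mult_le_cancel_left_pos) auto
    then have "lam * N * r \<le> 2 * C\<^sup>2 * a * \<Lambda> * C ^ 3" using pos by (simp add: pos_divide_le_eq)
    also have "\<dots> = \<Lambda> * (2 * C ^ 5 * a)" by (simp add: power_add[symmetric] mult_ac)
    finally show ?thesis using pos by (simp add: pos_divide_le_eq)
  qed
  have count': "real (card {t' \<in> F. \<bar>\<alpha> t - \<alpha> t'\<bar> + R * \<bar>\<beta> t - \<beta> t'\<bar> \<le> s}) \<le> \<Gamma> * s powr (1 + \<sigma>)"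
    if t: "t \<in> F" and s: "3 * \<eta> \<le> s" for t s
  proof -
    have sa: "2 * C * a \<le> s" "a \<le> 2 * s"
      using s pos aC unfolding \<eta>_def by linarith+
    have s0: "0 < s" using sa pos by linarith
    have "{t' \<in> F. \<bar>\<alpha> t - \<alpha> t'\<bar> + R * \<bar>\<beta> t - \<beta> t'\<bar> \<le> s} \<subseteq> {t' \<in> T. G t' \<subseteq> slab B sw (\<alpha> t) (\<beta> t) (2 * s)}"
    proof safe
      fix t' x assume t': "t' \<in> F" "\<bar>\<alpha> t - \<alpha> t'\<bar> + R * \<bar>\<beta> t - \<beta> t'\<bar> \<le> s"
      show tT: "t' \<in> T" using t' F by auto
      assume x: "x \<in> G t'"
      have sw': "swt t' = sw" using t' by (simp add: F_def)
      have 1: "\<bar>coord B (across sw) x - \<alpha> t' - \<beta> t' * coord B (along sw) x\<bar> \<le> 2 * C * a"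
        using line(3)[OF tT] x sw' by (auto simp: slab_def)
      have "\<bar>(\<beta> t - \<beta> t') * coord B (along sw) x\<bar> \<le> \<bar>\<beta> t - \<beta> t'\<bar> * R"
        unfolding abs_mult using along guided(2)[OF tT] x by (intro mult_left_mono) auto
      then have 2: "\<bar>\<alpha> t - \<alpha> t'\<bar> + \<bar>(\<beta> t - \<beta> t') * coord B (along sw) x\<bar> \<le> s" using t'(2) by (simp add: mult.commute)
      have 3: "coord B (across sw) x - \<alpha> t - \<beta> t * coord B (along sw) x
          = (coord B (across sw) x - \<alpha> t' - \<beta> t' * coord B (along sw) x) - (\<alpha> t - \<alpha> t') - (\<beta> t - \<beta> t') * coord B (along sw) x"
        by (simp add: algebra_simps)
      show "x \<in> slab B sw (\<alpha> t) (\<beta> t) (2 * s)" unfolding slab_def mem_Collect_eq 3 using 1 2 sa(1) by linarith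
    qed
    then have "real (card {t' \<in> F. \<bar>\<alpha> t - \<alpha> t'\<bar> + R * \<bar>\<beta> t - \<beta> t'\<bar> \<le> s})
        \<le> real (card {t' \<in> T. G t' \<subseteq> slab B sw (\<alpha> t) (\<beta> t) (2 * s)})"
      using T by (intro of_nat_mono card_mono) auto
    also have "\<dots> \<le> CF * N * (2 * C * (2 * s) / b) powr (1 + \<sigma>)" unfolding N_def by (rule count[OF sa(2)])
    also have "(2 * C * (2 * s) / b) powr (1 + \<sigma>) = (4 * C) powr (1 + \<sigma>) * (s powr (1 + \<sigma>) / b powr (1 + \<sigma>))"
    proof -
      have "2 * C * (2 * s) / b = (4 * C) * (s / b)" by simp
      then show ?thesis using pos s0 by (simp only: powr_mult powr_divide)
    qed
    also have "(4 * C) powr (1 + \<sigma>) \<le> (4 * C) powr 2" using \<sigma> C by (intro powr_mono) auto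
    also have "(4 * C) powr 2 = 16 * C\<^sup>2" using pos by (simp add: powr_numeral power_mult_distrib)
    finally have "real (card {t' \<in> F. \<bar>\<alpha> t - \<alpha> t'\<bar> + R * \<bar>\<beta> t - \<beta> t'\<bar> \<le> s})
        \<le> CF * N * (16 * C\<^sup>2 * (s powr (1 + \<sigma>) / b powr (1 + \<sigma>)))"
      using CF N by (simp add: mult_left_mono mult_right_mono divide_right_mono)
    then show ?thesis by (simp add: \<Gamma>_def mult_ac)
  qed
  have total: "real (card F) \<le> \<Gamma> * b powr (1 + \<sigma>)"
  proof -
    have "1 * 1 \<le> (16 * C\<^sup>2) * CF"
    proof (rule mult_mono)
      have "1 \<le> C\<^sup>2" using C by (intro one_le_power) simp
      then show "1 \<le> 16 * C\<^sup>2" by linarith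
    qed (use CF in auto)
    then have "1 * N \<le> (16 * C\<^sup>2) * CF * N" using N by (intro mult_right_mono) auto
    then show ?thesis using FN pos by (simp add: \<Gamma>_def)
  qed
  have slopeM: "R * \<bar>\<beta> t\<bar> \<le> M" if "t \<in> F" for t
  proof -
    have "R * \<bar>\<beta> t\<bar> \<le> R * (4 * C ^ 3 * b / r)" using line(2) that F R by (intro mult_left_mono) auto
    also have "\<dots> = M" using pos by (simp add: R_def M_def power_numeral_reduce mult_ac)
    finally show ?thesis .
  qed
  have slope1: "\<bar>\<beta> t\<bar> \<le> 1" if "t \<in> F" for t using line(1) that F by auto
  have pvR: "\<bar>pv Q\<bar> + \<eta> \<le> R" if "Q \<in> \<Q>" for Q
  proof -
    have "\<bar>pv Q\<bar> \<le> C * r / 2" using pt(2)[OF that] half3[of "along sw"] order_trans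
      unfolding box_set_coord pv_def by blast
    moreover have "0 < C * r" using pos by simp
    ultimately show ?thesis using Car unfolding \<eta>_def R_def by linarith
  qed
  \<comment> \<open>Two cells over the same place of the plane differ by at most \<open>C a\<close> in the first coordinate.\<close>
  have crowd: "real (card {Q \<in> \<Q>. \<bar>v - pv Q\<bar> \<le> \<eta> \<and> \<bar>u - pu Q\<bar> \<le> \<eta>}) \<le> Gc" for v u
  proof (cases "{Q \<in> \<Q>. \<bar>v - pv Q\<bar> \<le> \<eta> \<and> \<bar>u - pu Q\<bar> \<le> \<eta>} = {}")
    case True
    show ?thesis unfolding True using Gc by simp
  next
    case False
    then obtain Q0 where Q0: "Q0 \<in> \<Q>" "\<bar>v - pv Q0\<bar> \<le> \<eta>" "\<bar>u - pu Q0\<bar> \<le> \<eta>" by blast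
    have near: "dist (pt Q0) x \<le> 14 * C * a"
      if Q: "Q \<in> {Q \<in> \<Q>. \<bar>v - pv Q\<bar> \<le> \<eta> \<and> \<bar>u - pu Q\<bar> \<le> \<eta>}" and x: "x \<in> Q" for Q x
    proof -
      have Q': "Q \<in> \<Q>" "\<bar>v - pv Q\<bar> \<le> \<eta>" "\<bar>u - pu Q\<bar> \<le> \<eta>" using Q by auto
      have "\<bar>coord B 1 (pt Q0)\<bar> \<le> halfside B 1" "\<bar>coord B 1 (pt Q)\<bar> \<le> halfside B 1"
        using pt(2)[OF Q0(1)] pt(2)[OF Q'(1)] by (simp_all add: box_set_coord)
      then have 1: "\<bar>coord B 1 (pt Q0) - coord B 1 (pt Q)\<bar> \<le> C * a" using half(1) by linarith
      have 2: "\<bar>coord B (across sw) (pt Q0) - coord B (across sw) (pt Q)\<bar> \<le> 2 * \<eta>"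
        "\<bar>coord B (along sw) (pt Q0) - coord B (along sw) (pt Q)\<bar> \<le> 2 * \<eta>"
        using Q0(2,3) Q'(2,3) unfolding pu_def pv_def by linarith+
      have "\<bar>coord B 2 (pt Q0) - coord B 2 (pt Q)\<bar> + \<bar>coord B 3 (pt Q0) - coord B 3 (pt Q)\<bar> \<le> 4 * \<eta>"
        using 2 by (cases sw) (auto simp: across_def along_def)
      then have "dist (pt Q0) (pt Q) \<le> C * a + 4 * \<eta>"
        using dist_le_coords[OF B, of "pt Q0" "pt Q"] 1 by linarith
      moreover have "dist (pt Q) x \<le> a / 500" by (rule dia[OF Q'(1) pt(1)[OF Q'(1)] x])
      moreover have "a / 500 \<le> C * a" using pos aC by linarith
      ultimately show ?thesis using dist_triangle[of "pt Q0" x "pt Q"] unfolding \<eta>_def by linarith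
    qed
    have "real (card {Q \<in> \<Q>. \<bar>v - pv Q\<bar> \<le> \<eta> \<and> \<bar>u - pu Q\<bar> \<le> \<eta>}) \<le> (2 * (14 * C * a) / h) ^ 3"
      using \<Q> pos near by (intro cells_near_point_card[of h _ "pt Q0"]) auto
    also have "\<dots> \<le> Gc" unfolding Gc_def
    proof (rule power_mono)
      have "2 * (14 * C * a) / h \<le> 2 * (14 * C * a) / (a / C)" using h pos by (intro divide_left_mono) auto
      then show "2 * (14 * C * a) / h \<le> 28 * C\<^sup>2" using pos by (simp add: power2_eq_square)
    qed (use pos in auto)
    finally show ?thesis .
  qed
  obtain I where I: "b \<le> 2 ^ I * a" "4 * real I + 2 \<le> 9 * ln (2 * b / a)"
    using number_of_scales[OF pos(1) scales(3)] by blast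
  have I': "b \<le> 2 ^ I * (3 * \<eta>)"
  proof -
    have "a \<le> 3 * \<eta>" using pos aC unfolding \<eta>_def by linarith
    then have "2 ^ I * a \<le> 2 ^ I * (3 * \<eta>)" by (intro mult_left_mono) auto
    then show ?thesis using I(1) by linarith
  qed
  define L where "L = ln (2 * b / a)"
  have L: "1 / 2 \<le> L"
  proof -
    have "2 \<le> 2 * b / a" using pos scales by (simp add: pos_le_divide_eq)
    then have "ln 2 \<le> ln (2 * b / a)" by simp
    then show ?thesis using ln2_ge_two_thirds unfolding L_def by linarith
  qed
  have C4: "C \<le> C ^ 4" using C power_increasing[of 1 4 C] by simp
  have M1: "b \<le> M" and M2: "9 * C * a \<le> M"
  proof -
    have "1 \<le> C ^ 4" using C by (simp add: one_le_power)
    then have "1 * b \<le> (20 * C ^ 4) * b" using pos by (intro mult_right_mono) linarith+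
    then show "b \<le> M" by (simp add: M_def)
    have "(9 * C) * a \<le> (20 * C ^ 4) * b" using C4 C scales pos by (intro mult_mono) auto
    then show "9 * C * a \<le> M" by (simp add: M_def)
  qed
  have n0: "(0::real) \<le> real (card \<Q>)" by simp
  have "C ^ 3 * a ^ 3 * (r * b / a\<^sup>2) * lam powr (2 - \<sigma>) \<le> parent_constant C * CF * L * (real (card \<Q>) * a ^ 3)"
  proof (rule parent_cells_from_incidences[OF C pos(1) scales(3,4) \<sigma> lam(1) CF N n0 L \<Gamma>_def low])
    assume fine: "9 * C * a \<le> lam * b"
    then have r1: "3 * \<eta> \<le> lam * b" by (simp add: \<eta>_def)
    have r2: "lam * b \<le> M" using lam(2) pos M1 mult_right_mono[OF lam(2), of b] by linarith
    have "\<Lambda>\<^sup>2 \<le> real (card \<Q>) * (384 * \<eta> * M * \<Gamma> * ((lam * b) powr \<sigma> / (lam * b)) * \<Lambda>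
        + 2592 * Gc * real (card F) * R * (lam * b) powr \<sigma> * \<Gamma> * (4 * real I + 2))"
      unfolding \<Lambda>_def
      by (rule strip_incidence_bound[OF \<eta> r1 r2 \<sigma> R F(1) \<Q>(1) count' total pos(2) I' slopeM slope1 pvR crowd \<Gamma> Gc])
    also have "\<dots> \<le> real (card \<Q>) * (384 * \<eta> * M * \<Gamma> * ((lam * b) powr \<sigma> / (lam * b)) * \<Lambda>
        + 2592 * Gc * N * R * (lam * b) powr \<sigma> * \<Gamma> * (9 * L))"
      using FN I(2) Gc R \<Gamma> N unfolding L_def
      by (intro mult_left_mono add_left_mono mult_mono mult_nonneg_nonneg) auto
    finally show "\<Lambda>\<^sup>2 \<le> real (card \<Q>) * (384 * (3 * C * a) * (20 * C ^ 4 * b) * \<Gamma> * ((lam * b) powr \<sigma> / (lam * b)) * \<Lambda>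
        + 2592 * (28 * C ^ 2) ^ 3 * N * (5 * C * r) * (lam * b) powr \<sigma> * \<Gamma> * (9 * L))"
      by (simp only: \<eta>_def M_def R_def Gc_def)
  next
    have "\<Lambda> \<le> (\<Sum>Q\<in>\<Q>. 64 * M * \<Gamma> * (9 * C * a) powr \<sigma>)"
      unfolding \<Lambda>_def
    proof (rule sum_mono)
      fix Q assume Q: "Q \<in> \<Q>"
      have pv: "\<bar>pv Q\<bar> \<le> R" using pvR[OF Q] \<eta> by linarith
      have "real (card {t \<in> F. \<bar>pu Q - \<alpha> t - \<beta> t * pv Q\<bar> \<le> \<eta>})
          \<le> real (card {t \<in> F. \<bar>pu Q - \<alpha> t - \<beta> t * pv Q\<bar> \<le> 9 * C * a})"
        using F \<eta> by (intro of_nat_mono card_mono) (auto simp: \<eta>_def)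
      also have "\<dots> \<le> 64 * M * \<Gamma> * (9 * C * a) powr \<sigma>"
        using pv pos \<Gamma> M2 slopeM
        by (intro lines_near_point[OF R _ _ _ \<sigma> F(1) count']) (auto simp: \<eta>_def)
      finally show "real (card {t \<in> F. \<bar>pu Q - \<alpha> t - \<beta> t * pv Q\<bar> \<le> \<eta>}) \<le> 64 * M * \<Gamma> * (9 * C * a) powr \<sigma>" .
    qed
    then show "\<Lambda> \<le> real (card \<Q>) * (64 * (20 * C ^ 4 * b) * \<Gamma> * (9 * C * a) powr \<sigma>)"
      by (simp add: M_def)
  qed
  then have "C ^ 3 * (a * b * r * lam powr (2 - \<sigma>)) \<le> parent_constant C * CF * L * (real (card \<Q>) * a ^ 3)"
    using pos by (simp add: power2_eq_square power3_eq_cube mult_ac)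
  also have "\<dots> \<le> parent_constant C * CF * L * (real (card \<Q>) * (C ^ 3 * h ^ 3))"
  proof -
    have "a \<le> C * h" using h pos by (simp add: pos_divide_le_eq mult.commute)
    then have "a ^ 3 \<le> (C * h) ^ 3" using pos by (intro power_mono) auto
    moreover have "0 \<le> parent_constant C" using pos by (simp add: parent_constant_def)
    ultimately show ?thesis using CF L by (intro mult_left_mono) (auto simp: power_mult_distrib)
  qed
  also have "\<dots> = C ^ 3 * (parent_constant C * CF * L * (real (card \<Q>) * h ^ 3))" by (simp only: mult_ac)
  finally show ?thesis using pos unfolding L_def by (subst (asm) mult_le_cancel_left_pos) auto
qed

section \<open>Pigeonholing\<close>

lemma finite_cells_meeting_bounded:
  assumes "bounded E"
  shows "finite {Q \<in> cells h. Q \<inter> E \<noteq> {}}"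
proof (cases "0 < h")
  case True
  obtain M where M: "\<And>x. x \<in> E \<Longrightarrow> norm x \<le> M" using assms by (auto simp: bounded_iff)
  define S where "S = {\<lfloor>- M / h\<rfloor>..\<lfloor>M / h\<rfloor>}"
  have "{Q \<in> cells h. Q \<inter> E \<noteq> {}} \<subseteq> (\<lambda>f. cell h (vec_lambda f)) ` (UNIV \<rightarrow>\<^sub>E S)"
  proof
    fix Q assume "Q \<in> {Q \<in> cells h. Q \<inter> E \<noteq> {}}"
    then obtain k x where k: "Q = cell h k" "x \<in> cell h k" "x \<in> E" by (auto simp: cells_def)
    have "k $ i \<in> S" for i
    proof -
      have eq: "\<lfloor>x $ i / h\<rfloor> = k $ i" using k True by (auto simp: cell_def floor_eq_iff field_simps)
      have "\<bar>x $ i\<bar> \<le> M" using component_le_norm_cart[of x i] M[OF k(3)] by simp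
      then have "- M \<le> x $ i" "x $ i \<le> M" by linarith+
      then have "- M / h \<le> x $ i / h" "x $ i / h \<le> M / h"
        using True by (simp_all only: divide_right_mono less_imp_le)
      from this[THEN floor_mono] show ?thesis unfolding S_def eq by simp
    qed
    then have "(\<lambda>i. k $ i) \<in> UNIV \<rightarrow>\<^sub>E S" by auto
    moreover have "Q = cell h (vec_lambda (\<lambda>i. k $ i))" using k by simp
    ultimately show "Q \<in> (\<lambda>f. cell h (vec_lambda f)) ` (UNIV \<rightarrow>\<^sub>E S)" by blast
  qed
  moreover have "finite (UNIV \<rightarrow>\<^sub>E S :: (3 \<Rightarrow> int) set)" by (intro finite_PiE) (auto simp: S_def)
  ultimately show ?thesis by (rule finite_subset[OF _ finite_imageI])
next
  case False
  have "cell h k = {}" for k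
  proof -
    have "\<not> (h * of_int (k $ 1) \<le> x \<and> x < h * (of_int (k $ 1) + 1))" for x :: real
      using False by (auto simp: algebra_simps)
    then show ?thesis by (auto simp: cell_def)
  qed
  then have "{Q \<in> cells h. Q \<inter> E \<noteq> {}} = {}" by (auto simp: cells_def)
  then show ?thesis by (simp only: finite.emptyI)
qed

lemma cell_in_cells_lmeasurable: "Q \<in> cells h \<Longrightarrow> Q \<in> lmeasurable"
  using cell_measurable by (auto simp: cells_def)

lemma volume_over_cells:
  assumes h: "0 < h" and E: "E \<in> lmeasurable" and R: "finite R" "R \<subseteq> cells h"
  shows "vol (E \<inter> \<Union>R) = (\<Sum>Q\<in>R. vol (E \<inter> Q))"
proof -
  have "pairwise (\<lambda>Q Q'. disjnt (E \<inter> Q) (E \<inter> Q')) R"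
    using R(2) cells_disjoint[OF h] unfolding pairwise_def disjnt_iff by blast
  then have "vol (\<Union>Q\<in>R. E \<inter> Q) = (\<Sum>Q\<in>R. vol (E \<inter> Q))"
    using R E cell_in_cells_lmeasurable
    by (intro measure_UNION') (auto intro!: fmeasurable.Int)
  then show ?thesis by (simp only: Int_Union)
qed

text \<open>Only the finitely many cells that meet the bounded set matter, and those outside \<open>R\<close> contribute zero.\<close>

lemma volume_over_positive_cells:
  assumes h: "0 < h" and E: "E \<in> lmeasurable" "bounded E" and R: "finite R" "R \<subseteq> cells h"
    and pos: "\<And>Q. Q \<in> cells h \<Longrightarrow> 0 < vol (E \<inter> Q) \<Longrightarrow> Q \<in> R"
  shows "vol E = (\<Sum>Q\<in>R. vol (E \<inter> Q))"
proof -
  define R' where "R' = {Q \<in> cells h. Q \<inter> E \<noteq> {}} \<union> R"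
  have R': "finite R'" "R' \<subseteq> cells h"
    using finite_cells_meeting_bounded[OF E(2), of h] R by (auto simp: R'_def)
  have "E = E \<inter> \<Union>R'"
    using cell_cover[OF h] unfolding R'_def cells_def by blast
  then have "vol E = (\<Sum>Q\<in>R'. vol (E \<inter> Q))" using volume_over_cells[OF h E(1) R'] by simp
  also have "\<dots> = (\<Sum>Q\<in>R. vol (E \<inter> Q))"
  proof (rule sum.mono_neutral_right)
    show "\<forall>Q\<in>R' - R. vol (E \<inter> Q) = 0"
    proof
      fix Q assume "Q \<in> R' - R"
      then have "\<not> 0 < vol (E \<inter> Q)" using pos R'(2) by blast
      then show "vol (E \<inter> Q) = 0" by (simp add: zero_less_measure_iff)
    qed
  qed (use R' in \<open>auto simp: R'_def\<close>)
  finally show ?thesis .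
qed

lemma exists_heavy_class:
  fixes w :: "'a \<Rightarrow> real"
  assumes "finite S" and cls: "\<And>x. x \<in> S \<Longrightarrow> cls x \<le> J"
  shows "\<exists>j\<le>J. sum w S \<le> (1 + real J) * sum w {x \<in> S. cls x = j}"
proof (rule ccontr)
  assume "\<not> ?thesis"
  then have less: "(1 + real J) * sum w {x \<in> S. cls x = j} < sum w S" if "j \<le> J" for j using that by force
  have "sum w S = (\<Sum>j\<le>J. sum w {x \<in> S. cls x = j})"
    using assms by (subst sum.group) auto
  then have "(1 + real J) * sum w S = (\<Sum>j\<le>J. (1 + real J) * sum w {x \<in> S. cls x = j})"
    by (simp add: sum_distrib_left)
  also have "\<dots> < (\<Sum>j\<le>J. sum w S)" using less by (intro sum_strict_mono) auto
  also have "\<dots> = (1 + real J) * sum w S" by simp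
  finally show False by simp
qed

lemma dyadic_class_bounds:
  fixes x y :: real
  assumes "1 \<le> x" "x \<le> y"
  defines "i \<equiv> nat \<lfloor>log 2 x\<rfloor>"
  shows "2 ^ i \<le> x" "x < 2 ^ (i + 1)" "i \<le> nat \<lceil>log 2 y\<rceil>"
proof -
  have l: "0 \<le> log 2 x" "log 2 x \<le> log 2 y" using assms(1,2) by auto
  have i: "real i = of_int \<lfloor>log 2 x\<rfloor>" using l by (simp add: i_def)
  have "2 powr (real i) \<le> 2 powr (log 2 x)" by (intro powr_mono) (simp_all add: i)
  then show "2 ^ i \<le> x" using assms(1) powr_realpow[of 2 i] by simp
  have "2 powr (log 2 x) < 2 powr (real (i + 1))" using i by (intro powr_less_mono) (auto, linarith)
  then show "x < 2 ^ (i + 1)" using assms(1) powr_realpow[of 2 "i + 1"] by (simp del: power_Suc)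
  show "i \<le> nat \<lceil>log 2 y\<rceil>" unfolding i_def using l by linarith
qed

text \<open>A cell that is kept retains all its edges, so its degree in the final graph is the one by which it
  was classified.\<close>

lemma regular_subgraph:
  fixes \<omega> :: "'b \<times> 'q \<Rightarrow> real"
  assumes E: "finite E" "E \<noteq> {}" and \<omega>: "\<And>x. x \<in> E \<Longrightarrow> 0 < \<omega> x"
  obtains E2 and w d :: real where "E2 \<subseteq> E" "0 < w" "1 \<le> d"
    "\<And>x. x \<in> E2 \<Longrightarrow> w \<le> \<omega> x \<and> \<omega> x \<le> 2 * w"
    "\<And>Q. Q \<in> snd ` E2 \<Longrightarrow> d \<le> real (card {B. (B, Q) \<in> E2}) \<and> real (card {B. (B, Q) \<in> E2}) < 2 * d"
    "sum \<omega> E \<le> 4 * (1 + of_int \<lceil>log 2 (2 * real (card E))\<rceil>) * (1 + of_int \<lceil>log 2 (real (card E))\<rceil>) * sum \<omega> E2"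
proof -
  define e where "e = real (card E)"
  have e: "1 \<le> e" using E by (simp add: e_def card_gt_0_iff Suc_le_eq)
  define top where "top = Max (\<omega> ` E)"
  have top: "\<omega> x \<le> top" if "x \<in> E" for x using E that by (simp add: top_def)
  have "top \<in> \<omega> ` E" using E unfolding top_def by (intro Max_in) auto
  then obtain x0 where x0: "x0 \<in> E" "\<omega> x0 = top" by auto
  have top0: "0 < top" using \<omega>[OF x0(1)] x0(2) by simp
  define H where "H = {x \<in> E. top / (2 * e) \<le> \<omega> x}"
  have H: "finite H" "H \<subseteq> E" using E by (auto simp: H_def)
  \<comment> \<open>At most \<open>e\<close> light edges of weight below \<open>top / (2 e)\<close> sum to at most half of \<open>top\<close>.\<close>
  have heavy: "sum \<omega> E \<le> 2 * sum \<omega> H"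
  proof -
    have "sum \<omega> (E - H) \<le> (\<Sum>x\<in>E - H. top / (2 * e))" by (intro sum_mono) (auto simp: H_def)
    also have "\<dots> = real (card (E - H)) * (top / (2 * e))" by simp
    also have "\<dots> \<le> e * (top / (2 * e))"
      unfolding e_def using E top0 by (intro mult_right_mono of_nat_mono card_mono) auto
    also have "\<dots> = top / 2" using e by simp
    also have "\<dots> \<le> sum \<omega> E / 2"
      using member_le_sum[of x0 E \<omega>] x0 E(1) less_imp_le[OF \<omega>] by simp
    finally show ?thesis using sum.subset_diff[OF H(2) E(1), of \<omega>] by simp
  qed
  define cls where "cls x = nat \<lfloor>log 2 (top / \<omega> x)\<rfloor>" for x
  define J where "J = nat \<lceil>log 2 (2 * e)\<rceil>"
  have cls: "2 ^ cls x \<le> top / \<omega> x" "top / \<omega> x < 2 ^ (cls x + 1)" "cls x \<le> J" if "x \<in> H" for x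
  proof -
    have x: "x \<in> E" "top / (2 * e) \<le> \<omega> x" using that by (auto simp: H_def)
    have "1 \<le> top / \<omega> x" using top[OF x(1)] \<omega>[OF x(1)] by simp
    moreover have "top / \<omega> x \<le> 2 * e" using x(2) \<omega>[OF x(1)] e by (simp add: field_simps)
    ultimately show "2 ^ cls x \<le> top / \<omega> x" "top / \<omega> x < 2 ^ (cls x + 1)" "cls x \<le> J"
      unfolding cls_def J_def by (rule dyadic_class_bounds)+
  qed
  obtain i where i: "sum \<omega> H \<le> (1 + real J) * sum \<omega> {x \<in> H. cls x = i}"
    using exists_heavy_class[of H cls J \<omega>] H(1) cls(3) by blast
  define E1 where "E1 = {x \<in> H. cls x = i}"
  have E1: "finite E1" "E1 \<subseteq> E" using H by (auto simp: E1_def)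
  define w where "w = top / 2 ^ (i + 1)"
  have w: "0 < w" using top0 by (simp add: w_def)
  have wb: "w \<le> \<omega> x \<and> \<omega> x \<le> 2 * w" if "x \<in> E1" for x
  proof -
    have x: "x \<in> H" "cls x = i" using that by (auto simp: E1_def)
    then have "0 < \<omega> x" using H(2) \<omega> by blast
    then show ?thesis using cls(1,2)[OF x(1)] unfolding x(2) w_def by (simp add: field_simps)
  qed
  define deg where "deg Q = real (card {B. (B, Q) \<in> E1})" for Q
  have fib: "{B. (B, Q) \<in> E1} = fst ` {x \<in> E1. snd x = Q}" for Q by force
  have deg: "1 \<le> deg Q" "deg Q \<le> e" if "Q \<in> snd ` E1" for Q
  proof -
    have "finite {B. (B, Q) \<in> E1}" unfolding fib using E1 by auto
    moreover have "{B. (B, Q) \<in> E1} \<noteq> {}" using that by auto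
    ultimately show "1 \<le> deg Q" unfolding deg_def by (simp add: card_gt_0_iff Suc_le_eq)
    have "card {B. (B, Q) \<in> E1} \<le> card {x \<in> E1. snd x = Q}" unfolding fib using E1 by (intro card_image_le) auto
    also have "\<dots> \<le> card E" using E1 E by (intro card_mono) auto
    finally show "deg Q \<le> e" by (simp add: deg_def e_def)
  qed
  define J' where "J' = nat \<lceil>log 2 e\<rceil>"
  define dcls where "dcls x = nat \<lfloor>log 2 (deg (snd x))\<rfloor>" for x :: "'b \<times> 'q"
  have dcls: "2 ^ dcls x \<le> deg (snd x)" "deg (snd x) < 2 ^ (dcls x + 1)" "dcls x \<le> J'" if "x \<in> E1" for x
  proof -
    have "1 \<le> deg (snd x)" "deg (snd x) \<le> e" using deg[of "snd x"] that by auto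
    then show "2 ^ dcls x \<le> deg (snd x)" "deg (snd x) < 2 ^ (dcls x + 1)" "dcls x \<le> J'"
      unfolding dcls_def J'_def by (rule dyadic_class_bounds)+
  qed
  obtain j where j: "sum \<omega> E1 \<le> (1 + real J') * sum \<omega> {x \<in> E1. dcls x = j}"
    using exists_heavy_class[of E1 dcls J' \<omega>] E1(1) dcls(3) by blast
  define E2 where "E2 = {x \<in> E1. dcls x = j}"
  have same: "{B. (B, Q) \<in> E2} = {B. (B, Q) \<in> E1}" if "Q \<in> snd ` E2" for Q
    using that by (auto simp: E2_def dcls_def)
  have d: "(2::real) ^ j \<le> real (card {B. (B, Q) \<in> E2}) \<and> real (card {B. (B, Q) \<in> E2}) < 2 * 2 ^ j"
    if "Q \<in> snd ` E2" for Q
  proof -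
    obtain x where x: "x \<in> E1" "dcls x = j" "snd x = Q" using \<open>Q \<in> snd ` E2\<close> by (auto simp: E2_def)
    then show ?thesis using dcls(1,2)[OF x(1)] same[OF that] by (simp add: deg_def)
  qed
  have JJ: "1 + real J = 1 + of_int \<lceil>log 2 (2 * e)\<rceil>" "1 + real J' = 1 + of_int \<lceil>log 2 e\<rceil>"
    using e by (auto simp: J_def J'_def)
  have s2: "0 \<le> sum \<omega> E2" using E1(2) less_imp_le[OF \<omega>] unfolding E2_def by (intro sum_nonneg) blast
  have "sum \<omega> E \<le> 2 * sum \<omega> H" by (rule heavy)
  also have "\<dots> \<le> 2 * ((1 + real J) * sum \<omega> E1)" using i by (simp add: E1_def)
  also have "\<dots> \<le> 2 * ((1 + real J) * ((1 + real J') * sum \<omega> E2))"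
    using j by (intro mult_left_mono) (auto simp: E2_def)
  also have "\<dots> \<le> 4 * ((1 + real J) * ((1 + real J') * sum \<omega> E2))"
    using s2 by (intro mult_right_mono) auto
  also have "\<dots> = 4 * (1 + real J) * (1 + real J') * sum \<omega> E2" by (simp add: mult_ac)
  finally have "sum \<omega> E \<le> 4 * (1 + real J) * (1 + real J') * sum \<omega> E2" .
  then have "sum \<omega> E \<le> 4 * (1 + of_int \<lceil>log 2 (2 * real (card E))\<rceil>) * (1 + of_int \<lceil>log 2 (real (card E))\<rceil>) * sum \<omega> E2"
    unfolding JJ by (simp add: e_def)
  moreover have "E2 \<subseteq> E" "\<And>x. x \<in> E2 \<Longrightarrow> w \<le> \<omega> x \<and> \<omega> x \<le> 2 * w" using E1 wb unfolding E2_def by blast+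
  moreover have "(1::real) \<le> 2 ^ j" by simp
  ultimately show thesis using w d by (intro that[of E2 w "2 ^ j"])
qed

text \<open>Pointwise \<open>x powr p \<ge> u powr (p - 1) * (x - u)\<close>, used with \<open>u\<close> equal to half of the average.\<close>

lemma power_mean_lower_bound:
  fixes x :: "'a \<Rightarrow> real" and p t :: real
  assumes S: "finite S" and p: "1 \<le> p" "p \<le> 2" and x: "\<And>i. i \<in> S \<Longrightarrow> 0 \<le> x i" and t: "0 \<le> t"
    and avg: "t * real (card S) \<le> sum x S"
  shows "t powr p * real (card S) \<le> 4 * (\<Sum>i\<in>S. x i powr p)"
proof (cases "t = 0")
  case True
  then show ?thesis by (simp add: sum_nonneg)
next
  case False
  define u where "u = t / 2"
  have u: "0 < u" using False t by (simp add: u_def)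
  have pt: "u powr (p - 1) * (x i - u) \<le> x i powr p" if "i \<in> S" for i
  proof (cases "u \<le> x i")
    case True
    have "u powr (p - 1) * (x i - u) \<le> x i powr (p - 1) * x i"
      using True u p by (intro mult_mono powr_mono2) auto
    also have "\<dots> = x i powr p" using True u powr_add[of "x i" "p - 1" 1] by simp
    finally show ?thesis .
  next
    case False
    then have "u powr (p - 1) * (x i - u) \<le> 0" by (intro mult_nonneg_nonpos) auto
    then show ?thesis using powr_ge_zero[of "x i" p] by linarith
  qed
  have "t powr p * real (card S) \<le> 4 * (u powr (p - 1) * (u * real (card S)))"
  proof -
    have "t powr p = 2 powr p * u powr p" using u by (simp add: u_def powr_mult[symmetric])
    also have "\<dots> \<le> 2 powr 2 * u powr p" using p by (intro mult_right_mono powr_mono) auto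
    also have "u powr p = u powr (p - 1) * u" using u powr_add[of u "p - 1" 1] by simp
    finally have "t powr p \<le> 4 * (u powr (p - 1) * u)" by simp
    then have "t powr p * real (card S) \<le> 4 * (u powr (p - 1) * u) * real (card S)" by (intro mult_right_mono) auto
    then show ?thesis by (simp add: mult_ac)
  qed
  also have "u * real (card S) \<le> sum x S - u * real (card S)" using avg by (simp add: u_def)
  also have "\<dots> = (\<Sum>i\<in>S. x i - u)" by (simp add: sum_subtractf)
  also have "u powr (p - 1) * (\<Sum>i\<in>S. x i - u) \<le> (\<Sum>i\<in>S. x i powr p)"
    unfolding sum_distrib_left by (intro sum_mono pt)
  finally show ?thesis by (simp add: mult_left_mono)
qed

section \<open>Shadings cut along cells\<close>

text \<open>The level \<open>k\<close> is only a parameter of the notation, so that facts about one level are available at every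
  level.\<close>

locale shaded_grid =
  fixes X :: configuration and h :: real and k :: nat
  assumes h: "0 < h"
    and fin: "finite (parents X)" "finite (children X)"
    and parent_of: "\<And>t. t \<in> children X \<Longrightarrow> parent_of X t \<in> parents X"
    and shade: "\<And>t. t \<in> children X \<Longrightarrow> shade X t \<in> sets lebesgue" "\<And>t. t \<in> children X \<Longrightarrow> bounded (shade X t)"
    and active: "finite (active_cells h X)"
begin

abbreviation "EP \<equiv> positive_graph X h k"
abbreviation "\<omega> \<equiv> (\<lambda>(B, Q). edge_weight X k B Q)"

lemma children_of: "finite (children_of X B)" "children_of X B \<subseteq> children X"
  using fin by (auto simp: children_of_def)

lemma children_ofD: "t \<in> children_of X B \<Longrightarrow> t \<in> children X \<and> parent_of X t = B"
  by (simp add: children_of_def)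

lemma children_partition: "(\<Sum>t\<in>children X. f t) = (\<Sum>B\<in>parents X. \<Sum>t\<in>children_of X B. f t)"
  for f :: "label \<Rightarrow> real"
  unfolding children_of_def using fin parent_of by (intro sum.group[symmetric]) auto

lemma multiplicity_measurable: "multiplicity_at (children_of X B) (shade X) \<in> borel_measurable lebesgue"
  unfolding multiplicity_at_def using shade(1) children_of(2)
  by (intro borel_measurable_sum borel_measurable_indicator) auto

lemma shade0_lmeasurable:
  assumes "t \<in> children X" shows "shade0 X k t \<in> lmeasurable" "bounded (shade0 X k t)"
proof -
  let ?m = "multiplicity_at (children_of X (parent_of X t)) (shade X)"
  have "{x \<in> space lebesgue. 2 ^ k \<le> ?m x \<and> ?m x < 2 ^ (k + 1)} \<in> sets lebesgue"
    using multiplicity_measurable[of "parent_of X t"] by measurable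
  then have "shade0 X k t \<in> sets lebesgue"
    unfolding shade0_def using shade(1)[OF assms] by (auto intro!: sets.Int)
  moreover show b: "bounded (shade0 X k t)"
    using shade(2)[OF assms] by (rule bounded_subset) (auto simp: shade0_def)
  ultimately show "shade0 X k t \<in> lmeasurable" by (intro bounded_set_imp_lmeasurable)
qed

lemma shade_lmeasurable: "t \<in> children X \<Longrightarrow> shade X t \<in> lmeasurable"
  using shade by (intro bounded_set_imp_lmeasurable)

lemma positive_cell_active:
  assumes "t \<in> children X" "Q \<in> cells h" "0 < vol (shade X t \<inter> Q)"
  shows "Q \<in> active_cells h X"
proof -
  have "0 < (\<Sum>t\<in>children X. vol (shade X t \<inter> Q))"
    using fin assms by (intro sum_pos2[of _ t]) auto
  then show ?thesis using assms(2) by (simp add: active_cells_def children_partition)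
qed

lemma positive_shade0_cell_active:
  assumes "t \<in> children X" "Q \<in> cells h" "0 < vol (shade0 X k t \<inter> Q)"
  shows "Q \<in> active_cells h X"
proof -
  have "shade X t \<inter> Q \<in> lmeasurable" "shade0 X k t \<inter> Q \<in> lmeasurable"
    using shade_lmeasurable[OF assms(1)] shade0_lmeasurable(1)[OF assms(1)] cell_in_cells_lmeasurable[OF assms(2)]
    by (simp_all only: fmeasurable.Int)
  then have "vol (shade0 X k t \<inter> Q) \<le> vol (shade X t \<inter> Q)"
    by (intro measure_mono_fmeasurable fmeasurableD) (auto simp: shade0_def)
  then show ?thesis using assms by (intro positive_cell_active[of t]) auto
qed

lemma edge_weight_pos:
  assumes "0 < edge_weight X k B Q"
  shows "\<exists>t\<in>children_of X B. vol (shade0 X k t \<inter> Q) \<noteq> 0"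
proof (rule ccontr)
  assume "\<not> ?thesis"
  then have "edge_weight X k B Q = 0" unfolding edge_weight_def by (intro sum.neutral) blast
  then show False using assms by simp
qed

lemma EP_subset: "EP \<subseteq> parents X \<times> active_cells h X"
proof
  fix x assume "x \<in> EP"
  then obtain B Q where x: "x = (B, Q)" "B \<in> parents X" "Q \<in> cells h" "0 < edge_weight X k B Q"
    by (auto simp: positive_graph_def)
  then obtain t where t: "t \<in> children_of X B" "vol (shade0 X k t \<inter> Q) \<noteq> 0"
    using edge_weight_pos by blast
  then have "0 < vol (shade0 X k t \<inter> Q)" by (simp add: zero_less_measure_iff)
  then show "x \<in> parents X \<times> active_cells h X"
    using positive_shade0_cell_active[of t Q] children_ofD[OF t(1)] x by auto
qed

lemma EP_finite: "finite EP"
  using EP_subset fin active by (meson finite_SigmaI finite_subset)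

lemma EP_cells: "(B, Q) \<in> EP \<Longrightarrow> B \<in> parents X \<and> Q \<in> cells h \<and> 0 < edge_weight X k B Q"
  by (auto simp: positive_graph_def)

lemma fiber_finite: "E \<subseteq> EP \<Longrightarrow> finite {Q. (B, Q) \<in> E}"
  by (rule finite_subset[of _ "snd ` EP"]) (force, simp add: EP_finite)

lemma fiber_cells: "E \<subseteq> EP \<Longrightarrow> {Q. (B, Q) \<in> E} \<subseteq> cells h"
  using EP_cells by blast

lemma sum_edges:
  fixes f :: "label \<Rightarrow> pt set \<Rightarrow> real"
  assumes "E \<subseteq> EP"
  shows "(\<Sum>B\<in>parents X. \<Sum>Q\<in>{Q. (B, Q) \<in> E}. f B Q) = (\<Sum>(B, Q)\<in>E. f B Q)"
proof -
  have "E = Sigma (parents X) (\<lambda>B. {Q. (B, Q) \<in> E})" using assms EP_cells by fastforce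
  then show ?thesis using fin(1) fiber_finite[OF assms] by (subst sum.Sigma) auto
qed

lemma shade1_volume:
  assumes "E \<subseteq> EP" "t \<in> children X"
  shows "vol (shade1 X k E t) = (\<Sum>Q\<in>{Q. (parent_of X t, Q) \<in> E}. vol (shade0 X k t \<inter> Q))"
  unfolding shade1_def parent_shade_def
  by (rule volume_over_cells[OF h shade0_lmeasurable(1)[OF assms(2)] fiber_finite[OF assms(1)] fiber_cells[OF assms(1)]])

lemma mass_shade1:
  assumes "E \<subseteq> EP"
  shows "mass (children X) (shade1 X k E) = sum \<omega> E"
proof -
  have "mass (children X) (shade1 X k E)
      = (\<Sum>B\<in>parents X. \<Sum>t\<in>children_of X B. \<Sum>Q\<in>{Q. (B, Q) \<in> E}. vol (shade0 X k t \<inter> Q))"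
    unfolding mass_def children_partition
    by (intro sum.cong refl) (use children_ofD shade1_volume[OF assms] in auto)
  also have "\<dots> = (\<Sum>B\<in>parents X. \<Sum>Q\<in>{Q. (B, Q) \<in> E}. edge_weight X k B Q)"
    unfolding edge_weight_def by (intro sum.cong refl sum.swap)
  also have "\<dots> = sum \<omega> E" by (rule sum_edges[OF assms])
  finally show ?thesis .
qed

lemma mass_shade0: "mass (children X) (shade0 X k) = sum \<omega> EP"
proof -
  have "vol (shade0 X k t) = (\<Sum>Q\<in>active_cells h X. vol (shade0 X k t \<inter> Q))" if "t \<in> children X" for t
    using that active positive_shade0_cell_active[OF that]
    by (intro volume_over_positive_cells[OF h shade0_lmeasurable]) (auto simp: active_cells_def)
  then have "mass (children X) (shade0 X k)
      = (\<Sum>B\<in>parents X. \<Sum>t\<in>children_of X B. \<Sum>Q\<in>active_cells h X. vol (shade0 X k t \<inter> Q))"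
    unfolding mass_def children_partition using children_of(2) by (intro sum.cong refl) auto
  also have "\<dots> = (\<Sum>B\<in>parents X. \<Sum>Q\<in>active_cells h X. edge_weight X k B Q)"
    unfolding edge_weight_def by (intro sum.cong refl sum.swap)
  also have "\<dots> = sum \<omega> (parents X \<times> active_cells h X)" by (simp add: sum.cartesian_product)
  also have "\<dots> = sum \<omega> EP"
  proof (rule sum.mono_neutral_right)
    have "0 \<le> edge_weight X k B Q" for B Q unfolding edge_weight_def by (intro sum_nonneg) auto
    then show "\<forall>x\<in>parents X \<times> active_cells h X - EP. \<omega> x = 0"
      by (auto simp: positive_graph_def active_cells_def less_le)
  qed (use fin active EP_subset in auto)
  finally show ?thesis .
qed

lemma stage_shade_eq: "E \<subseteq> E2 \<Longrightarrow> stage_shade X k E2 E = shade1 X k E"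
  by (auto simp: stage_shade_def shade1_def parent_shade_def fun_eq_iff)

lemma multiplicity_card: "finite F \<Longrightarrow> multiplicity_at F Y x = real (card {t \<in> F. x \<in> Y t})"
  by (simp add: multiplicity_at_def indicator_def sum.If_cases Int_def)

lemma parent_shade_iff:
  assumes "E \<subseteq> EP" "x \<in> Q" "Q \<in> cells h"
  shows "x \<in> parent_shade E B \<longleftrightarrow> (B, Q) \<in> E"
proof
  assume "x \<in> parent_shade E B"
  then obtain Q' where "(B, Q') \<in> E" "x \<in> Q'" by (auto simp: parent_shade_def)
  then show "(B, Q) \<in> E" using cells_disjoint[OF h _ assms(3) _ assms(2)] EP_cells assms(1) by blast
qed (use assms in \<open>auto simp: parent_shade_def\<close>)

lemma parent_shade_mass: 
  assumes "E \<subseteq> EP"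
  shows "mass (parents X) (parent_shade E) = real (card E) * h ^ 3"
proof -
  have "vol (parent_shade E B) = real (card {Q. (B, Q) \<in> E}) * h ^ 3" for B
    unfolding parent_shade_def by (rule cells_union_volume(2)[OF h fiber_finite[OF assms] fiber_cells[OF assms]])
  then have "mass (parents X) (parent_shade E) = (\<Sum>B\<in>parents X. \<Sum>Q\<in>{Q. (B, Q) \<in> E}. h ^ 3)"
    by (simp add: mass_def)
  also have "\<dots> = real (card E) * h ^ 3" unfolding sum_edges[OF assms] by simp
  finally show ?thesis .
qed

lemma edge_meets_shade:
  assumes "(B, Q) \<in> EP" obtains t x where "t \<in> children_of X B" "x \<in> shade0 X k t" "x \<in> Q"
proof -
  obtain t where "t \<in> children_of X B" "vol (shade0 X k t \<inter> Q) \<noteq> 0"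
    using EP_cells[OF assms] edge_weight_pos by blast
  moreover from this have "shade0 X k t \<inter> Q \<noteq> {}" by auto
  ultimately show ?thesis using that by blast
qed

lemma parent_shade_hull:
  assumes "E \<subseteq> EP"
  shows "parent_shade E B = cell_hull h (shadow (children_of X B) (shade1 X k E))"
proof -
  have "{Q. (B, Q) \<in> E} = {Q \<in> cells h. Q \<inter> shadow (children_of X B) (shade1 X k E) \<noteq> {}}"
  proof (intro equalityI subsetI)
    fix Q assume "Q \<in> {Q. (B, Q) \<in> E}"
    then have Q: "(B, Q) \<in> E" "(B, Q) \<in> EP" using assms by auto
    obtain t x where t: "t \<in> children_of X B" "x \<in> shade0 X k t" "x \<in> Q"
      using edge_meets_shade[OF Q(2)] by blast
    then have "x \<in> shade1 X k E t"
      using Q(1) children_ofD[OF t(1)] by (auto simp: shade1_def parent_shade_def)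
    then show "Q \<in> {Q \<in> cells h. Q \<inter> shadow (children_of X B) (shade1 X k E) \<noteq> {}}"
      using t EP_cells[OF Q(2)] by (auto simp: shadow_def)
  next
    fix Q assume "Q \<in> {Q \<in> cells h. Q \<inter> shadow (children_of X B) (shade1 X k E) \<noteq> {}}"
    then obtain t x where t: "Q \<in> cells h" "t \<in> children_of X B" "x \<in> Q" "x \<in> shade1 X k E t"
      by (auto simp: shadow_def)
    then have "x \<in> parent_shade E B" using children_ofD[OF t(2)] by (auto simp: shade1_def)
    then show "Q \<in> {Q. (B, Q) \<in> E}" using parent_shade_iff[OF assms t(3,1)] by simp
  qed
  then show ?thesis by (simp add: parent_shade_def cell_hull_def)
qed

lemma inner_multiplicity:
  assumes "x \<in> shadow (children_of X B) (shade1 X k E)"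
  shows "2 ^ k \<le> multiplicity_at (children_of X B) (shade1 X k E) x"
    "multiplicity_at (children_of X B) (shade1 X k E) x < 2 * 2 ^ k"
proof -
  obtain t where t: "t \<in> children_of X B" "x \<in> shade1 X k E t" using assms by (auto simp: shadow_def)
  then have x: "x \<in> parent_shade E B" "2 ^ k \<le> multiplicity_at (children_of X B) (shade X) x"
      "multiplicity_at (children_of X B) (shade X) x < 2 * 2 ^ k"
    using children_ofD[OF t(1)] by (auto simp: shade1_def shade0_def)
  then have "{t' \<in> children_of X B. x \<in> shade1 X k E t'} = {t' \<in> children_of X B. x \<in> shade X t'}"
    using children_ofD by (auto simp: shade1_def shade0_def)
  then have "multiplicity_at (children_of X B) (shade1 X k E) x = multiplicity_at (children_of X B) (shade X) x"
    by (simp add: multiplicity_card children_of)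
  then show "2 ^ k \<le> multiplicity_at (children_of X B) (shade1 X k E) x"
    "multiplicity_at (children_of X B) (shade1 X k E) x < 2 * 2 ^ k" using x by auto
qed

text \<open>Only parents joined in \<open>E2\<close> to the cell of \<open>x\<close> contribute, each at most \<open>2 * 2 ^ k\<close>, and there are
  fewer than \<open>2 * d\<close> of them.\<close>

lemma total_multiplicity:
  assumes E: "E \<subseteq> E2" "E2 \<subseteq> EP" and d: "0 < d"
    and deg: "\<And>Q. Q \<in> snd ` E2 \<Longrightarrow> real (card {B. (B, Q) \<in> E2}) < 2 * d"
  shows "multiplicity_at (children X) (shade1 X k E) x < 4 * 2 ^ k * d"
proof -
  let ?f = "\<lambda>B. multiplicity_at (children_of X B) (shade1 X k E) x"
  have tot: "multiplicity_at (children X) (shade1 X k E) x = (\<Sum>B\<in>parents X. ?f B)"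
    unfolding multiplicity_at_def by (rule children_partition)
  have zero: "?f B = 0" if "x \<notin> shadow (children_of X B) (shade1 X k E)" for B
    using that by (auto simp: multiplicity_at_def shadow_def intro!: sum.neutral)
  obtain q where q: "x \<in> cell h q" using cell_cover[OF h] by blast
  define Q where "Q = cell h q"
  have Q: "Q \<in> cells h" "x \<in> Q" using q by (auto simp: Q_def cells_def)
  define S where "S = {B. (B, Q) \<in> E2}"
  have "S \<subseteq> parents X" using E EP_cells by (auto simp: S_def)
  with fin(1) have S: "S \<subseteq> parents X" "finite S" by (auto intro: finite_subset)
  have fS: "?f B = 0" if "B \<notin> S" for B
  proof (rule zero, rule)
    assume "x \<in> shadow (children_of X B) (shade1 X k E)"
    then have "x \<in> parent_shade E B" using children_ofD by (auto simp: shadow_def shade1_def)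
    then have "(B, Q) \<in> E" using parent_shade_iff[of E x Q B] E Q by auto
    then show False using that E by (auto simp: S_def)
  qed
  have f2: "?f B \<le> 2 * 2 ^ k" for B
    using zero[of B] inner_multiplicity(2)[of x B E] by (cases "x \<in> shadow (children_of X B) (shade1 X k E)") auto
  have "(\<Sum>B\<in>parents X. ?f B) = (\<Sum>B\<in>S. ?f B)"
    using fin S fS by (intro sum.mono_neutral_right) auto
  also have "\<dots> \<le> (\<Sum>B\<in>S. 2 * 2 ^ k)" by (intro sum_mono f2)
  also have "\<dots> = real (card S) * (2 * 2 ^ k)" by simp
  also have "\<dots> < 4 * 2 ^ k * d"
  proof (cases "S = {}")
    case True
    then show ?thesis using d by simp
  next
    case False
    then have "Q \<in> snd ` E2" by (force simp: S_def)
    then have "real (card S) < 2 * d" using deg by (simp add: S_def)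
    then have "real (card S) * (2 * 2 ^ k) < 2 * d * (2 * 2 ^ k)" by (intro mult_strict_right_mono) auto
    then show ?thesis by (simp add: mult_ac)
  qed
  finally show ?thesis by (simp add: tot)
qed

lemma outer_multiplicity:
  assumes E: "E \<subseteq> EP" and x: "x \<in> shadow (parents X) (parent_shade E)"
  shows "\<exists>Q\<in>snd ` E. multiplicity_at (parents X) (parent_shade E) x = real (card {B. (B, Q) \<in> E})"
proof -
  obtain B Q where Q: "(B, Q) \<in> E" "x \<in> Q" using x by (auto simp: shadow_def parent_shade_def)
  then have "Q \<in> cells h" using E EP_cells by blast
  then have "{B \<in> parents X. x \<in> parent_shade E B} = {B. (B, Q) \<in> E}"
    using parent_shade_iff[OF E Q(2)] E EP_cells by blast
  then show ?thesis using Q by (intro bexI[of _ Q]) (auto simp: multiplicity_card fin image_iff intro: bexI[of _ "(B, Q)"])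
qed

end

text \<open>All structural constants are compared with a single one, so that all later constants depend on
  \<open>C\<close> alone.\<close>

section \<open>From the convexity hypotheses to slabs\<close>

definition constants_within :: "real \<Rightarrow> structure_constants \<Rightarrow> bool"
  where "constants_within C K \<longleftrightarrow> 10 \<le> C \<and> 1 / C \<le> side_lo K \<and> side_hi K \<le> C \<and>
    1 / C \<le> rad_lo K \<and> rad_hi K \<le> C \<and> 1 / C \<le> len_lo K \<and> 1 / C \<le> grid_ratio K \<and> grid_ratio K \<le> 1 / 1000"

lemma exists_constants_within:
  assumes "admissible_constants K" shows "\<exists>C. constants_within C K"
proof -
  define C where "C = Max {10, 1 / side_lo K, side_hi K, 1 / rad_lo K, rad_hi K, 1 / len_lo K, 1 / grid_ratio K}"
  have ge: "x \<le> C" if "x \<in> {10, 1 / side_lo K, side_hi K, 1 / rad_lo K, rad_hi K, 1 / len_lo K, 1 / grid_ratio K}" for x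
    unfolding C_def using that by (intro Max_ge) auto
  have pos: "0 < side_lo K" "0 < rad_lo K" "0 < len_lo K" "0 < grid_ratio K" "grid_ratio K \<le> 1 / 1000"
    using assms by (auto simp: admissible_constants_def)
  have C: "0 < C" using ge[of 10] by simp
  have inv: "1 / C \<le> y" if "0 < y" "1 / y \<le> C" for y
    using that C by (simp add: field_simps)
  show ?thesis unfolding constants_within_def
    using ge pos by (intro exI[of _ C] conjI inv) auto
qed

text \<open>The common form of the three alternatives: guides that contain the children, and a count of the
  guides in slabs at the scales at least \<open>a\<close>. The children are their own guides except in the coarse
  alternative, where the guide of a child is its coarse tube.\<close>

definition guided_slab_frostman :: "real \<Rightarrow> real \<Rightarrow> real \<Rightarrow> real \<Rightarrow> real \<Rightarrow> real \<Rightarrow> configuration \<Rightarrow> label \<Rightarrow> (label \<Rightarrow> pt set) \<Rightarrow> bool"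
  where "guided_slab_frostman C a b r CF \<sigma> X B G \<longleftrightarrow>
    (\<forall>t\<in>children_of X B. (\<exists>p q s. G t = segment_tube p q s \<and> r / C \<le> dist p q \<and> 0 \<le> s \<and> s \<le> C * a) \<and>
      tube X t \<subseteq> G t \<and> G t \<subseteq> box_set (pbox X B)) \<and>
    (\<forall>sw \<alpha> \<beta> s. a \<le> s \<longrightarrow> real (card {t \<in> children_of X B. G t \<subseteq> slab (pbox X B) sw \<alpha> \<beta> s})
      \<le> CF * real (card (children_of X B)) * (2 * C * s / b) powr (1 + \<sigma>))"

lemma is_tube_segment:
  assumes "constants_within C K" "is_tube K w r U" "0 < w" "0 < r"
  shows "\<exists>p q s. U = segment_tube p q s \<and> r / C \<le> dist p q \<and> w / C \<le> s \<and> s \<le> C * w"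
proof -
  obtain p q s where *: "len_lo K * r \<le> dist p q" "rad_lo K * w \<le> s" "s \<le> rad_hi K * w" "U = segment_tube p q s"
    using assms(2) by (auto simp: is_tube_def segment_tube_def)
  have "1 / C * r \<le> len_lo K * r" "1 / C * w \<le> rad_lo K * w" "rad_hi K * w \<le> C * w"
    using assms by (simp_all only: constants_within_def mult_right_mono less_imp_le)
  then show ?thesis using * by (intro exI[of _ p] exI[of _ q] exI[of _ s]) auto
qed

lemma is_box_bounds:
  assumes "constants_within C K" "is_box K a b r B" "0 < a" "0 < b" "0 < r"
  shows "orthonormal (frame B)"
    and "2 * halfside B 1 \<le> C * a" "2 * halfside B 2 \<le> C * b" "2 * halfside B 3 \<le> C * r"
    and "a / C \<le> 2 * halfside B 1" "b / C \<le> 2 * halfside B 2" "r / C \<le> 2 * halfside B 3"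
    and "0 < halfside B i"
proof -
  show "orthonormal (frame B)" using assms(2) by (rule is_box_frame)
  have C: "0 < C" "1 / C \<le> side_lo K" "side_hi K \<le> C" using assms(1) by (auto simp: constants_within_def)
  have s: "x / C \<le> side_lo K * x" "side_hi K * x \<le> C * x" if "0 < x" for x
    using mult_right_mono[OF C(2), of x] mult_right_mono[OF C(3), of x] that by simp_all
  show u: "2 * halfside B 1 \<le> C * a" "2 * halfside B 2 \<le> C * b" "2 * halfside B 3 \<le> C * r"
    using assms(2) s(2) assms(3-5) unfolding is_box_def by (auto intro: order_trans)
  show l: "a / C \<le> 2 * halfside B 1" "b / C \<le> 2 * halfside B 2" "r / C \<le> 2 * halfside B 3"
    using assms(2) s(1) assms(3-5) unfolding is_box_def by (auto intro: order_trans)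
  have "0 < a / C" "0 < b / C" "0 < r / C" using C assms by auto
  then have "0 < halfside B 1" "0 < halfside B 2" "0 < halfside B 3" using l by linarith+
  then show "0 < halfside B i" using exhaust_3[of i] by auto
qed

lemma slab_ratio:
  assumes "constants_within C K" "is_box K a b r B" "0 < a" "a \<le> b" "b \<le> r" "0 \<le> s"
  shows "vol (box_set B \<inter> slab B sw \<alpha> \<beta> s) / vol (box_set B) \<le> 2 * C * s / b"
proof -
  have pos: "0 < a" "0 < b" "0 < r" "0 < C" using assms by (auto simp: constants_within_def)
  note bb = is_box_bounds[OF assms(1,2) pos(1-3)]
  have "b / C \<le> r / C" using assms pos by (intro divide_right_mono) auto
  then have "b / C \<le> 2 * halfside B (across sw)" using bb(6,7) by (auto simp: across_def)
  then have "b / (2 * C) \<le> halfside B (across sw)" using pos by (simp add: field_simps)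
  have "vol (box_set B \<inter> slab B sw \<alpha> \<beta> s) / vol (box_set B) \<le> s / halfside B (across sw)"
    by (rule slab_section_volume(2)[OF bb(1,8) assms(6)])
  also have "\<dots> \<le> s / (b / (2 * C))"
    using \<open>b / (2 * C) \<le> halfside B (across sw)\<close> pos bb(8) assms(6) by (intro divide_left_mono) auto
  also have "\<dots> = 2 * C * s / b" by simp
  finally show ?thesis .
qed

lemma box_volume_pos:
  assumes "constants_within C K" "is_box K a b r B" "0 < a" "0 < b" "0 < r"
  shows "0 < vol (box_set B)" "convex (box_set B)"
proof -
  note bb = is_box_bounds[OF assms]
  show "0 < vol (box_set B)" using box_set_measure(2)[OF bb(1)] bb(8) by (simp add: less_imp_le)
  have "slab B True 0 0 (halfside B 3) \<supseteq> box_set B" by (auto simp: slab_def box_set_coord across_def)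
  then show "convex (box_set B)"
    using slab_section_volume(1)[OF bb(1,8), of "halfside B 3" True 0 0] bb(8)[of 3] by (simp add: Int_absorb2)
qed

lemma convex_frostman_slabs:
  fixes fam :: "label set" and car :: "label \<Rightarrow> pt set"
  assumes K: "constants_within C K" and B: "is_box K a b r B" and abr: "0 < a" "a \<le> b" "b \<le> r"
    and fam: "finite fam" "fam \<noteq> {}" and sub: "\<And>t. t \<in> fam \<Longrightarrow> car t \<subseteq> box_set B" and e: "0 < e"
    and frost: "\<And>V. convex V \<Longrightarrow> V \<subseteq> box_set B \<Longrightarrow>
      real (card {t \<in> fam. car t \<subseteq> V}) / real (card fam) \<le> CF * (vol V / vol (box_set B)) powr e"
  shows "1 \<le> CF"
    and "a \<le> s \<Longrightarrow> real (card {t \<in> fam. car t \<subseteq> slab B sw \<alpha> \<beta> s}) \<le> CF * real (card fam) * (2 * C * s / b) powr e"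
proof -
  have pos: "0 < b" "0 < r" "0 < C" using abr K by (auto simp: constants_within_def)
  have N: "0 < real (card fam)" using fam by (simp add: card_gt_0_iff)
  have "{t \<in> fam. car t \<subseteq> box_set B} = fam" using sub by auto
  then show CF: "1 \<le> CF"
    using frost[of "box_set B"] box_volume_pos[OF K B abr(1) pos(1,2)] N by simp
  assume s: "a \<le> s"
  let ?V = "box_set B \<inter> slab B sw \<alpha> \<beta> s"
  note bb = is_box_bounds[OF K B abr(1) pos(1,2)]
  have conv: "convex ?V" using s abr by (intro slab_section_volume(1)[OF bb(1,8)]) auto
  have "{t \<in> fam. car t \<subseteq> slab B sw \<alpha> \<beta> s} = {t \<in> fam. car t \<subseteq> ?V}" using sub by auto
  then have "real (card {t \<in> fam. car t \<subseteq> slab B sw \<alpha> \<beta> s}) / real (card fam)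
      \<le> CF * (vol ?V / vol (box_set B)) powr e"
    using frost[OF conv] by simp
  also have "\<dots> \<le> CF * (2 * C * s / b) powr e"
    using slab_ratio[OF K B abr, of s] s abr CF e by (intro mult_left_mono powr_mono2) auto
  finally show "real (card {t \<in> fam. car t \<subseteq> slab B sw \<alpha> \<beta> s}) \<le> CF * real (card fam) * (2 * C * s / b) powr e"
    using N by (simp add: pos_divide_le_eq mult_ac)
qed

text \<open>The children guided into a slab number at most \<open>R m\<close> for each coarse tube in the slab, while the total
  number of children is at least \<open>m\<close> for each coarse tube. One factor \<open>R\<close> is lost.\<close>

lemma coarse_slabs:
  fixes S :: coarse_data
  assumes K: "constants_within C K" and B: "is_box K a b r (pbox X B)" and abr: "0 < a" "a \<le> b" "b \<le> r"
    and fin: "finite (children_of X B)"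
    and lab: "finite (coarse_labels S B)" "coarse_labels S B \<noteq> {}"
    and sub: "\<And>s. s \<in> coarse_labels S B \<Longrightarrow> coarse_tube S B s \<subseteq> box_set (pbox X B)"
    and frost: "\<And>V. convex V \<Longrightarrow> V \<subseteq> box_set (pbox X B) \<Longrightarrow>
      real (card {s \<in> coarse_labels S B. coarse_tube S B s \<subseteq> V}) / real (card (coarse_labels S B))
        \<le> CF * (vol V / vol (box_set (pbox X B)))"
    and assigned: "\<And>t. t \<in> children_of X B \<Longrightarrow> coarse_of S t \<in> coarse_labels S B"
    and m: "1 \<le> m" "\<And>s. s \<in> coarse_labels S B \<Longrightarrow> m \<le> real (coarse_load X S B s)"
      "\<And>s. s \<in> coarse_labels S B \<Longrightarrow> real (coarse_load X S B s) \<le> R * m" and R: "1 \<le> R"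
  shows "1 \<le> CF"
    and "a \<le> s \<Longrightarrow> real (card {t \<in> children_of X B. coarse_tube S B (coarse_of S t) \<subseteq> slab (pbox X B) sw \<alpha> \<beta> s})
      \<le> (CF * R) * real (card (children_of X B)) * (2 * C * s / b) powr 1"
proof -
  have frost1: "real (card {s \<in> coarse_labels S B. coarse_tube S B s \<subseteq> V}) / real (card (coarse_labels S B))
        \<le> CF * (vol V / vol (box_set (pbox X B))) powr 1"
    if "convex V" "V \<subseteq> box_set (pbox X B)" for V using frost[OF that] by simp
  have one: "(0::real) < 1" by simp
  show CF: "1 \<le> CF" by (rule convex_frostman_slabs(1)[OF K B abr lab sub one frost1])
  have slabs: "real (card {s' \<in> coarse_labels S B. coarse_tube S B s' \<subseteq> slab (pbox X B) sw \<alpha> \<beta> s})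
      \<le> CF * real (card (coarse_labels S B)) * (2 * C * s / b) powr 1" if "a \<le> s"
    by (rule convex_frostman_slabs(2)[OF K B abr lab sub one frost1 that])
  assume s: "a \<le> s"
  let ?U = "{s' \<in> coarse_labels S B. coarse_tube S B s' \<subseteq> slab (pbox X B) sw \<alpha> \<beta> s}"
  let ?x = "(2 * C * s / b) powr 1"
  have "{t \<in> children_of X B. coarse_tube S B (coarse_of S t) \<subseteq> slab (pbox X B) sw \<alpha> \<beta> s}
      \<subseteq> (\<Union>s'\<in>?U. {t \<in> children_of X B. coarse_of S t = s'})"
    using assigned by auto
  then have "card {t \<in> children_of X B. coarse_tube S B (coarse_of S t) \<subseteq> slab (pbox X B) sw \<alpha> \<beta> s}
      \<le> card (\<Union>s'\<in>?U. {t \<in> children_of X B. coarse_of S t = s'})"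
    using fin lab by (intro card_mono) auto
  also have "\<dots> \<le> (\<Sum>s'\<in>?U. card {t \<in> children_of X B. coarse_of S t = s'})" using lab by (intro card_UN_le) auto
  finally have "real (card {t \<in> children_of X B. coarse_tube S B (coarse_of S t) \<subseteq> slab (pbox X B) sw \<alpha> \<beta> s})
      \<le> (\<Sum>s'\<in>?U. real (coarse_load X S B s'))"
    unfolding coarse_load_def by (simp only: of_nat_sum[symmetric] of_nat_le_iff)
  also have "\<dots> \<le> (\<Sum>s'\<in>?U. R * m)" using m(3) by (intro sum_mono) auto
  also have "\<dots> = real (card ?U) * (R * m)" by simp
  also have "\<dots> \<le> (CF * real (card (coarse_labels S B)) * ?x) * (R * m)"
    using slabs[OF s] R m(1) by (intro mult_right_mono) auto
  also have "\<dots> = CF * R * ?x * (real (card (coarse_labels S B)) * m)" by (simp only: mult_ac)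
  also have "\<dots> \<le> CF * R * ?x * real (card (children_of X B))"
  proof (rule mult_left_mono)
    have "real (card (coarse_labels S B)) * m = (\<Sum>s'\<in>coarse_labels S B. m)" by simp
    also have "\<dots> \<le> (\<Sum>s'\<in>coarse_labels S B. real (coarse_load X S B s'))" using m(2) by (intro sum_mono)
    also have "\<dots> = real (\<Sum>s'\<in>coarse_labels S B. card {t \<in> children_of X B. coarse_of S t = s'})"
      by (simp add: coarse_load_def)
    also have "(\<Sum>s'\<in>coarse_labels S B. card {t \<in> children_of X B. coarse_of S t = s'}) = card (children_of X B)"
      using sum.group[OF fin lab(1), of "coarse_of S" "\<lambda>_. 1::nat"] assigned by auto
    finally show "real (card (coarse_labels S B)) * m \<le> real (card (children_of X B))" .
  qed (use CF R in auto)
  finally show "real (card {t \<in> children_of X B. coarse_tube S B (coarse_of S t) \<subseteq> slab (pbox X B) sw \<alpha> \<beta> s})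
      \<le> (CF * R) * real (card (children_of X B)) * ?x"
    by (simp only: mult_ac)
qed

section \<open>The density of the parents and the stages\<close>

text \<open>The bound for one parent is summed with the power mean inequality. All children families have the
  same volume up to \<open>\<kappa>\<close>, so the average over the retained parents of the densities of their children is
  at least the density of the whole family divided by \<open>\<kappa> \<Lambda>\<close>.\<close>

lemma density_lower_bound:
  fixes \<Lambda> :: real
  assumes K: "constants_within C K" and scales: "0 < \<delta>" "\<delta> \<le> a" "a \<le> b" "b \<le> r" and h_def: "h = grid_ratio K * a"
    and X: "shaded_family X" and F1: "F1 K \<delta> a b r X" and F2: "F2 D \<kappa> X" and grid: "shaded_grid X h"
    and E: "E \<subseteq> positive_graph X h k" "E \<noteq> {}"
    and \<sigma>: "0 \<le> \<sigma>" "\<sigma> \<le> 1" and CF: "1 \<le> CF"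
    and frost: "\<And>B. B \<in> parents X \<Longrightarrow> \<exists>G. guided_slab_frostman C a b r CF \<sigma> X B G"
    and \<Lambda>: "0 < \<Lambda>" and mass: "inverse \<Lambda> * total_mass X \<le> mass (children X) (shade1 X k E)"
  shows "1 / (32 * C ^ 3 * parent_constant C) * inverse CF * inverse (ln (2 * b / a))
      * (shading_density (children X) (tube X) (shade X) / (\<kappa> * \<Lambda>)) powr (2 - \<sigma>)
    \<le> shading_density (retained_parents E) (\<lambda>B. box_set (enlarge h (pbox X B))) (parent_shade E)"
proof -
  interpret shaded_grid X h k by (rule grid)
  have C: "10 \<le> C" using K by (simp add: constants_within_def)
  have pos: "0 < a" "0 < b" "0 < r" "0 < C" using scales C by auto
  have hh: "a / C \<le> h" "h \<le> a / 1000"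
  proof -
    have g: "1 / C \<le> grid_ratio K" "grid_ratio K \<le> 1 / 1000" using K by (simp_all add: constants_within_def)
    show "a / C \<le> h" "h \<le> a / 1000"
      using mult_right_mono[OF g(1), of a] mult_right_mono[OF g(2), of a] pos by (simp_all add: h_def)
  qed
  define p where "p = 2 - \<sigma>"
  have p: "1 \<le> p" "p \<le> 2" using \<sigma> by (auto simp: p_def)
  define L where "L = ln (2 * b / a)"
  have L: "0 < L" unfolding L_def using scales pos by (intro ln_gt_zero) (simp add: less_divide_eq)
  define PC where "PC = parent_constant C"
  have PC: "0 < PC" unfolding PC_def parent_constant_def using pos by (intro mult_pos_pos add_pos_pos) auto
  define S where "S = retained_parents E"
  define fib where "fib B = {Q. (B, Q) \<in> E}" for B
  have S: "S \<subseteq> parents X" "S \<noteq> {}" using E EP_cells by (auto simp: S_def retained_parents_def)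
  have finS: "finite S" using S fin by (auto intro: finite_subset)
  have nS: "0 < real (card S)" using S finS by (simp add: card_gt_0_iff)
  define V where "V B = (\<Sum>t\<in>children_of X B. vol (tube X t))" for B
  have D: "0 < D" "1 \<le> \<kappa>" "\<And>B. B \<in> parents X \<Longrightarrow> D \<le> V B" "\<And>B. B \<in> parents X \<Longrightarrow> V B \<le> \<kappa> * D"
    using F2 by (auto simp: F2_def V_def)
  have box: "is_box K a b r (pbox X B)" if "B \<in> parents X" for B using F1 that by (simp add: F1_def)
  have tube: "\<exists>p q s. tube X t = segment_tube p q s \<and> r / C \<le> dist p q \<and> \<delta> / C \<le> s \<and> s \<le> C * \<delta>"
    if "B \<in> parents X" "t \<in> children_of X B" for B t
    using is_tube_segment[OF K _ scales(1) pos(3)] F1 that by (simp add: F1_def)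
  have sub: "shade0 X k t \<subseteq> tube X t" if "t \<in> children X" for t
    using X that by (auto simp: shaded_family_def shade0_def)
  define mm where "mm B = (\<Sum>Q\<in>fib B. edge_weight X k B Q)" for B
  have mm_alt: "mm B = (\<Sum>t\<in>children_of X B. \<Sum>Q\<in>fib B. vol (shade0 X k t \<inter> Q))" for B
    unfolding mm_def edge_weight_def by (rule sum.swap)
  define x where "x B = mm B / V B" for B
  have fibfin: "finite (fib B)" "fib B \<subseteq> cells h" for B
    unfolding fib_def using fiber_finite[OF E(1)] fiber_cells[OF E(1)] by auto
  have xpos: "0 < x B" if B: "B \<in> S" for B
  proof -
    obtain Q where "Q \<in> fib B" using B by (auto simp: S_def retained_parents_def fib_def)
    moreover have "0 < edge_weight X k B Q" if "Q \<in> fib B" for Q using that E EP_cells by (auto simp: fib_def)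
    ultimately have "0 < mm B" unfolding mm_def using fibfin by (intro sum_pos) auto
    moreover have "0 < V B" using D B S by (auto intro: less_le_trans)
    ultimately show ?thesis by (simp add: x_def)
  qed
  have xle: "x B \<le> 1" if B: "B \<in> S" for B
  proof -
    have BP: "B \<in> parents X" using B S by auto
    have "mm B \<le> V B"
      unfolding mm_alt V_def
    proof (rule sum_mono)
      fix t assume t: "t \<in> children_of X B"
      have tX: "t \<in> children X" using children_ofD[OF t] by simp
      obtain p q s where tu: "tube X t = segment_tube p q s" using tube[OF BP t] by blast
      have "(\<Sum>Q\<in>fib B. vol (shade0 X k t \<inter> Q)) = vol (shade0 X k t \<inter> \<Union>(fib B))"
        by (rule volume_over_cells[OF h shade0_lmeasurable(1)[OF tX] fibfin, symmetric])
      also have "\<dots> \<le> vol (tube X t)"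
      proof (rule measure_mono_fmeasurable)
        show "shade0 X k t \<inter> \<Union>(fib B) \<subseteq> tube X t" using sub[OF tX] by auto
        show "shade0 X k t \<inter> \<Union>(fib B) \<in> sets lebesgue"
          using shade0_lmeasurable(1)[OF tX] cells_union_volume(1)[OF h fibfin]
          by (intro fmeasurableD fmeasurable.Int)
        show "tube X t \<in> lmeasurable" unfolding tu by (rule segment_tube_lmeasurable)
      qed
      finally show "(\<Sum>Q\<in>fib B. vol (shade0 X k t \<inter> Q)) \<le> vol (tube X t)" .
    qed
    moreover have "0 < V B" using D(1) D(3)[OF BP] by linarith
    ultimately show ?thesis by (simp add: x_def)
  qed
  have parent: "a * b * r * x B powr p \<le> PC * CF * L * (real (card (fib B)) * h ^ 3)" if B: "B \<in> S" for B
  proof -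
    have BP: "B \<in> parents X" using B S by auto
    have VB: "0 < V B" using D(1) D(3)[OF BP] by linarith
    note bb = is_box_bounds[OF K box[OF BP] pos(1-3)]
    obtain G where G: "guided_slab_frostman C a b r CF \<sigma> X B G" using frost[OF BP] by blast
    have ne: "children_of X B \<noteq> {}" using VB by (auto simp: V_def)
    have vt: "r * \<delta>\<^sup>2 / C ^ 3 \<le> vol (tube X t)" if t: "t \<in> children_of X B" for t
    proof -
      obtain p q s where tu: "tube X t = segment_tube p q s" "r / C \<le> dist p q" "\<delta> / C \<le> s"
        using tube[OF BP t] by blast
      have s: "0 < s" using tu(3) scales pos by (auto intro: less_le_trans[of 0 "\<delta> / C"])
      have "0 < r / C" using pos by simp
      then have "p \<noteq> q" using tu(2) by auto
      have "r * \<delta>\<^sup>2 / C ^ 3 = r / C * (\<delta> / C)\<^sup>2" by (simp add: power2_eq_square power3_eq_cube)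
      also have "\<dots> \<le> dist p q * s\<^sup>2" using tu s pos scales by (intro mult_mono power_mono) auto
      also have "\<dots> \<le> vol (tube X t)" unfolding tu(1) by (rule segment_tube_volume_ge[OF s \<open>p \<noteq> q\<close>])
      finally show ?thesis .
    qed
    have "x B * real (card (children_of X B)) * (r * \<delta>\<^sup>2 / C ^ 3) = x B * (\<Sum>t\<in>children_of X B. r * \<delta>\<^sup>2 / C ^ 3)" by simp
    also have "\<dots> \<le> x B * V B" unfolding V_def using vt xpos[OF B] by (intro mult_left_mono sum_mono) auto
    also have "\<dots> = mm B" using VB by (simp add: x_def)
    finally have lowmass: "x B * real (card (children_of X B)) * (r * \<delta>\<^sup>2 / C ^ 3)
        \<le> (\<Sum>t\<in>children_of X B. \<Sum>Q\<in>fib B. vol (shade0 X k t \<inter> Q))" by (simp add: mm_alt)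
    show ?thesis unfolding PC_def L_def p_def
    proof (rule parent_cells_lower_bound[OF C scales hh bb(1-4) children_of(1) ne _ _ _ _ _ \<sigma> CF _ fibfin _ xpos[OF B] xle[OF B] lowmass, of G])
      fix t assume t: "t \<in> children_of X B"
      have tX: "t \<in> children X" using children_ofD[OF t] by simp
      have g: "(\<exists>p q s. G t = segment_tube p q s \<and> r / C \<le> dist p q \<and> 0 \<le> s \<and> s \<le> C * a)"
        "tube X t \<subseteq> G t" "G t \<subseteq> box_set (pbox X B)"
        using G t unfolding guided_slab_frostman_def by auto
      obtain p q s where tu: "tube X t = segment_tube p q s" "\<delta> / C \<le> s" "s \<le> C * \<delta>"
        using tube[OF BP t] by blast
      have "0 \<le> \<delta> / C" using scales pos by simp
      then show "\<exists>p q s. shade0 X k t \<subseteq> segment_tube p q s \<and> 0 \<le> s \<and> s \<le> C * \<delta>"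
        using tu sub[OF tX] by (intro exI[of _ p] exI[of _ q] exI[of _ s]) auto
      show "\<exists>p q s. G t = segment_tube p q s \<and> r / C \<le> dist p q \<and> 0 \<le> s \<and> s \<le> C * a" by (rule g(1))
      show "shade0 X k t \<subseteq> G t" using sub[OF tX] g(2) by auto
      show "G t \<subseteq> box_set (pbox X B)" by (rule g(3))
      show "shade0 X k t \<in> sets lebesgue" using shade0_lmeasurable(1)[OF tX] by (rule fmeasurableD)
    next
      fix sw \<alpha> \<beta> s assume "a \<le> s"
      then show "real (card {t \<in> children_of X B. G t \<subseteq> slab (pbox X B) sw \<alpha> \<beta> s})
          \<le> CF * real (card (children_of X B)) * (2 * C * s / b) powr (1 + \<sigma>)"
        using G unfolding guided_slab_frostman_def by blast
    next
      fix Q assume "Q \<in> fib B"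
      then obtain t z where tz: "t \<in> children_of X B" "z \<in> shade0 X k t" "z \<in> Q"
        using E edge_meets_shade by (auto simp: fib_def) blast
      then have "z \<in> box_set (pbox X B)"
        using sub children_ofD[OF tz(1)] F1 BP unfolding F1_def by blast
      then show "Q \<inter> box_set (pbox X B) \<noteq> {}" using tz(3) by blast
    qed
  qed
  define lam where "lam = shading_density (children X) (tube X) (shade X)"
  define tot where "tot = (\<Sum>t\<in>children X. vol (tube X t))"
  have totV: "tot = (\<Sum>B\<in>parents X. V B)" unfolding tot_def V_def by (rule children_partition)
  have Stot: "D * real (card S) \<le> tot"
  proof -
    have "D * real (card S) = (\<Sum>B\<in>S. D)" by simp
    also have "\<dots> \<le> (\<Sum>B\<in>S. V B)" using D(3) S by (intro sum_mono) auto
    also have "\<dots> \<le> (\<Sum>B\<in>parents X. V B)"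
      using S fin by (intro sum_mono2) (auto simp: V_def sum_nonneg)
    finally show ?thesis by (simp add: totV)
  qed
  have tot: "0 < tot" using Stot D(1) nS mult_pos_pos[of D "real (card S)"] by linarith
  have M0: "0 \<le> total_mass X" by (auto simp: total_mass_def mass_def intro: sum_nonneg)
  have lam: "lam = total_mass X / tot" by (simp add: lam_def shading_density_def total_mass_def tot_def)
  define t0 where "t0 = lam / (\<kappa> * \<Lambda>)"
  have t0: "0 \<le> t0" using M0 tot D \<Lambda> by (simp add: t0_def lam)
  have massmm: "mass (children X) (shade1 X k E) = (\<Sum>B\<in>S. mm B)"
  proof -
    have "mass (children X) (shade1 X k E) = (\<Sum>B\<in>parents X. mm B)"
      unfolding mass_shade1[OF E(1)] mm_def fib_def by (rule sum_edges[OF E(1), symmetric])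
    also have "\<dots> = (\<Sum>B\<in>S. mm B)"
    proof (rule sum.mono_neutral_right)
      show "\<forall>B\<in>parents X - S. mm B = 0"
        by (auto simp: mm_def fib_def S_def retained_parents_def)
    qed (use fin S in auto)
    finally show ?thesis .
  qed
  have avg: "t0 * real (card S) \<le> (\<Sum>B\<in>S. x B)"
  proof -
    have "t0 * real (card S) = (inverse \<Lambda> * total_mass X) * (D * real (card S) / tot) / (\<kappa> * D)"
      using D(1) by (simp add: t0_def lam field_simps)
    also have "\<dots> \<le> (inverse \<Lambda> * total_mass X) * 1 / (\<kappa> * D)"
      using Stot tot D \<Lambda> M0 by (intro divide_right_mono mult_left_mono) auto
    also have "\<dots> \<le> (\<Sum>B\<in>S. mm B) / (\<kappa> * D)"
      using mass D unfolding massmm by (intro divide_right_mono) auto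
    also have "\<dots> = (\<Sum>B\<in>S. mm B / (\<kappa> * D))" by (rule sum_divide_distrib)
    also have "\<dots> \<le> (\<Sum>B\<in>S. x B)"
    proof (rule sum_mono)
      fix B assume B: "B \<in> S"
      then have BP: "B \<in> parents X" using S by auto
      have "0 < V B" using D(1) D(3)[OF BP] by linarith
      moreover then have "0 < mm B" using xpos[OF B] by (simp add: x_def zero_less_divide_iff)
      ultimately show "mm B / (\<kappa> * D) \<le> x B"
        unfolding x_def using D(4)[OF BP] D(1,2) by (intro divide_left_mono) auto
    qed
    finally show ?thesis .
  qed
  have pm: "t0 powr p * real (card S) \<le> 4 * (\<Sum>B\<in>S. x B powr p)"
    using xpos by (intro power_mean_lower_bound[OF finS p _ t0 avg]) (auto intro: less_imp_le)
  have massS: "mass S (parent_shade E) = (\<Sum>B\<in>S. real (card (fib B)) * h ^ 3)"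
    unfolding mass_def parent_shade_def fib_def[symmetric] using cells_union_volume(2)[OF h fibfin] by simp
  have vbox: "0 < vol (box_set (enlarge h (pbox X B)))" "vol (box_set (enlarge h (pbox X B))) \<le> 8 * C ^ 3 * (a * b * r)"
    if B: "B \<in> S" for B
  proof -
    have BP: "B \<in> parents X" using B S by auto
    note bb = is_box_bounds[OF K box[OF BP] pos(1-3)]
    let ?H = "\<lambda>i. halfside (pbox X B) i + sqrt 3 * h"
    have "sqrt 3 * h \<le> 2 * (a / 1000)" using hh h pos real_sqrt_le_mono[of 3 4] by (intro mult_mono) auto
    moreover have "10 * a \<le> C * a" "10 * b \<le> C * b" "10 * r \<le> C * r" using C pos by (auto intro!: mult_right_mono)
    ultimately have H: "?H 1 \<le> C * a" "?H 2 \<le> C * b" "?H 3 \<le> C * r" using bb(2-4) scales by linarith+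
    have H0: "0 < ?H i" for i using bb(8)[of i] h by (simp add: add_pos_pos)
    have v: "vol (box_set (enlarge h (pbox X B))) = 8 * ?H 1 * ?H 2 * ?H 3"
      using box_set_measure(2)[of "enlarge h (pbox X B)"] bb(1) less_imp_le[OF H0] by (simp add: enlarge_def)
    show "0 < vol (box_set (enlarge h (pbox X B)))" unfolding v using H0 by (intro mult_pos_pos) auto
    have "8 * ?H 1 * ?H 2 * ?H 3 \<le> 8 * (C * a) * (C * b) * (C * r)"
      using H less_imp_le[OF H0] pos by (intro mult_mono mult_nonneg_nonneg) auto
    then show "vol (box_set (enlarge h (pbox X B))) \<le> 8 * C ^ 3 * (a * b * r)"
      unfolding v by (simp add: power3_eq_cube mult_ac)
  qed
  define W where "W = (\<Sum>B\<in>S. vol (box_set (enlarge h (pbox X B))))"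
  have W0: "0 < W" unfolding W_def using finS S vbox(1) by (intro sum_pos) auto
  have Wle: "W \<le> 8 * C ^ 3 * (a * b * r) * real (card S)"
    unfolding W_def using sum_mono[OF vbox(2), of S "\<lambda>x. x"] by (simp add: mult.commute)
  have main: "(a * b * r) * (t0 powr p * real (card S)) \<le> 4 * (PC * CF * L * mass S (parent_shade E))"
  proof -
    have "(a * b * r) * (t0 powr p * real (card S)) \<le> (a * b * r) * (4 * (\<Sum>B\<in>S. x B powr p))"
      using pm pos by (intro mult_left_mono) auto
    also have "\<dots> = 4 * (\<Sum>B\<in>S. a * b * r * x B powr p)" by (simp add: sum_distrib_left mult_ac)
    also have "\<dots> \<le> 4 * (\<Sum>B\<in>S. PC * CF * L * (real (card (fib B)) * h ^ 3))"
      using parent by (intro mult_left_mono sum_mono) auto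
    also have "\<dots> = 4 * (PC * CF * L * mass S (parent_shade E))" by (simp add: massS sum_distrib_left)
    finally show ?thesis .
  qed
  have "1 / (32 * C ^ 3 * PC) * inverse CF * inverse L * t0 powr p * W \<le> mass S (parent_shade E)"
  proof -
    have "1 / (32 * C ^ 3 * PC) * inverse CF * inverse L * t0 powr p * W
        \<le> 1 / (32 * C ^ 3 * PC) * inverse CF * inverse L * t0 powr p * (8 * C ^ 3 * (a * b * r) * real (card S))"
      using Wle PC CF L pos by (intro mult_left_mono) auto
    also have "\<dots> = (1 / (4 * PC) * inverse CF * inverse L) * ((a * b * r) * (t0 powr p * real (card S)))"
      using pos PC by (simp add: field_simps)
    also have "\<dots> \<le> (1 / (4 * PC) * inverse CF * inverse L) * (4 * (PC * CF * L * mass S (parent_shade E)))"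
      using main PC CF L by (intro mult_left_mono) auto
    also have "\<dots> = mass S (parent_shade E)" using PC CF L by (simp add: field_simps)
    finally show ?thesis .
  qed
  then have "1 / (32 * C ^ 3 * PC) * inverse CF * inverse L * t0 powr p \<le> mass S (parent_shade E) / W"
    using W0 by (simp add: pos_le_divide_eq)
  then show ?thesis
    by (simp add: shading_density_def[of "retained_parents E"] S_def W_def PC_def L_def p_def t0_def lam_def)
qed

text \<open>On the shading of a child the multiplicity is a number between \<open>1\<close> and \<open>N_max X\<close>, so the levels cover
  the shading and one of them has at least the average mass.\<close>

lemma (in shaded_grid) common_inner_level_exists:
  assumes tot: "0 < total_mass X"
  shows "\<exists>k. common_inner_level X k" and "1 \<le> N_max X"
proof -
  have pne: "parents X \<noteq> {}"
  proof
    assume "parents X = {}"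
    then have "children X = {}" using parent_of by auto
    then show False using tot by (simp add: total_mass_def mass_def)
  qed
  have Nmax: "card (children_of X B) \<le> N_max X" if "B \<in> parents X" for B
    unfolding N_max_def using fin that by (intro Max_ge) auto
  have "children X \<noteq> {}" using tot by (auto simp: total_mass_def mass_def)
  then obtain t0 where "t0 \<in> children X" by blast
  then have "parent_of X t0 \<in> parents X" "t0 \<in> children_of X (parent_of X t0)" using parent_of by (auto simp: children_of_def)
  then have "0 < card (children_of X (parent_of X t0))" using children_of(1) by (auto simp: card_gt_0_iff)
  then show N1: "1 \<le> N_max X" using Nmax[OF \<open>parent_of X t0 \<in> parents X\<close>] by simp
  define J where "J = nat \<lceil>log 2 (real (N_max X))\<rceil>"
  have cover: "vol (shade X t) \<le> (\<Sum>j\<le>J. vol (shade0 X j t))" if t: "t \<in> children X" for t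
  proof -
    have sm: "shade0 X j t \<in> lmeasurable" for j
      by (rule shaded_grid.shade0_lmeasurable(1)[OF shaded_grid_axioms t])
    have "shade X t \<subseteq> (\<Union>j\<le>J. shade0 X j t)"
    proof
      fix x assume x: "x \<in> shade X t"
      define B where "B = parent_of X t"
      define f where "f = multiplicity_at (children_of X B) (shade X) x"
      have f: "f = real (card {t' \<in> children_of X B. x \<in> shade X t'})"
        by (simp add: f_def multiplicity_card children_of)
      have "t \<in> {t' \<in> children_of X B. x \<in> shade X t'}" using t x by (simp add: children_of_def B_def)
      then have "{t' \<in> children_of X B. x \<in> shade X t'} \<noteq> {}" by blast
      then have f1: "1 \<le> f" unfolding f using children_of(1)[of B] by (simp add: card_gt_0_iff Suc_le_eq)
      have "card {t' \<in> children_of X B. x \<in> shade X t'} \<le> card (children_of X B)"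
        using children_of(1) by (intro card_mono) auto
      then have f2: "f \<le> real (N_max X)" unfolding f using Nmax[of B] parent_of[OF t] by (simp add: B_def)
      have "x \<in> shade0 X (nat \<lfloor>log 2 f\<rfloor>) t"
        using dyadic_class_bounds(1,2)[OF f1 f2] x by (simp add: shade0_def f_def B_def)
      moreover have "nat \<lfloor>log 2 f\<rfloor> \<le> J" unfolding J_def by (rule dyadic_class_bounds(3)[OF f1 f2])
      ultimately show "x \<in> (\<Union>j\<le>J. shade0 X j t)" by blast
    qed
    then have "vol (shade X t) \<le> vol (\<Union>j\<le>J. shade0 X j t)"
      using shade(1)[OF t] sm
      by (intro measure_mono_fmeasurable fmeasurable.finite_UN) auto
    also have "\<dots> \<le> (\<Sum>j\<le>J. vol (shade0 X j t))"
      using sm by (intro measure_UNION_le) (auto intro: fmeasurableD)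
    finally show ?thesis .
  qed
  have sum: "total_mass X \<le> (\<Sum>j\<le>J. mass (children X) (shade0 X j))"
    unfolding total_mass_def mass_def by (subst sum.swap) (intro sum_mono cover)
  have "0 \<le> log 2 (real (N_max X))" using N1 by simp
  then have "0 \<le> \<lceil>log 2 (real (N_max X))\<rceil>" by linarith
  then have JJ: "real J = of_int \<lceil>log 2 (real (N_max X))\<rceil>" "int J = \<lceil>log 2 (real (N_max X))\<rceil>" by (simp_all add: J_def)
  show "\<exists>k. common_inner_level X k"
  proof (rule ccontr)
    assume no: "\<not> ?thesis"
    have "mass (children X) (shade0 X j) < inverse (1 + real J) * total_mass X" if "j \<le> J" for j
    proof -
      have "int j \<le> \<lceil>log 2 (real (N_max X))\<rceil>" using that JJ(2) by linarith
      then show ?thesis using no unfolding common_inner_level_def JJ(1) not_le[symmetric] by blast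
    qed
    then have "(\<Sum>j\<le>J. mass (children X) (shade0 X j)) < (\<Sum>j\<le>J. inverse (1 + real J) * total_mass X)"
      by (intro sum_strict_mono) auto
    also have "\<dots> = total_mass X" by simp
    finally show False using sum by simp
  qed
qed

text \<open>This absorbs the logarithm of the number of scales into \<open>(a / b)\<^sup>\<epsilon>\<close>.\<close>

lemma inverse_log_ge_power:
  assumes "0 < a" "a \<le> b" "0 < (\<epsilon>::real)"
  shows "\<epsilon> / 2 powr \<epsilon> * (a / b) powr \<epsilon> \<le> inverse (ln (2 * b / a))"
proof -
  have b: "0 < b" using assms by simp
  have "0 < ln (2 * b / a)" using assms by (intro ln_gt_zero) (simp add: less_divide_eq)
  moreover have "ln (2 * b / a) \<le> (2 * b / a) powr \<epsilon> / \<epsilon>"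
    using assms b by (intro ln_powr_bound) (simp_all add: le_divide_eq)
  ultimately have "inverse ((2 * b / a) powr \<epsilon> / \<epsilon>) \<le> inverse (ln (2 * b / a))"
    by (intro le_imp_inverse_le) auto
  moreover have "(2 * b / a) powr \<epsilon> = 2 powr \<epsilon> * b powr \<epsilon> / a powr \<epsilon>"
    using assms b by (simp add: powr_mult powr_divide)
  ultimately show ?thesis using assms b by (simp add: powr_divide field_simps)
qed

lemma stage_mass_bookkeeping:
  fixes c :: "nat \<Rightarrow> real"
  assumes Lam: "0 < \<Lambda>" and c: "\<And>j. j \<in> {1..m} \<Longrightarrow> 0 < c j \<and> c j \<le> 1"
  shows "inverse \<Lambda> * inverse (2 ^ m) * (\<Prod>j=1..m. c j) = inverse (\<Lambda> * (\<Prod>j=1..m. 2 / c j))"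
    and "0 < c_min \<Longrightarrow> c_min \<le> 1 \<Longrightarrow> (\<And>j. j \<in> {1..m} \<Longrightarrow> c_min \<le> c j) \<Longrightarrow> m \<le> m0 \<Longrightarrow>
      \<Lambda> * (\<Prod>j=1..m. 2 / c j) \<le> \<Lambda> * (2 / c_min) ^ m0"
proof -
  have "(\<Prod>j=1..m. 2 / c j) = 2 ^ m / (\<Prod>j=1..m. c j)" by (simp add: prod_dividef)
  then show "inverse \<Lambda> * inverse (2 ^ m) * (\<Prod>j=1..m. c j) = inverse (\<Lambda> * (\<Prod>j=1..m. 2 / c j))"
    by (simp add: field_simps)
  assume cm: "0 < c_min" "c_min \<le> 1" "\<And>j. j \<in> {1..m} \<Longrightarrow> c_min \<le> c j" and m: "m \<le> m0"
  have "(\<Prod>j=1..m. 2 / c j) \<le> (\<Prod>j=1..m. 2 / c_min)"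
    using cm c by (intro prod_mono) (auto intro!: divide_left_mono simp: less_imp_le)
  also have "\<dots> = (2 / c_min) ^ m" by simp
  also have "\<dots> \<le> (2 / c_min) ^ m0" using cm m by (intro power_increasing) (auto simp: le_divide_eq)
  finally show "\<Lambda> * (\<Prod>j=1..m. 2 / c j) \<le> \<Lambda> * (2 / c_min) ^ m0" using Lam by (intro mult_left_mono) auto
qed

text \<open>The volume of the parents' shading is the number of edges times \<open>h ^ 3\<close>, so the \<open>c\<^sub>j\<close> bound the
  numbers of edges. Edge weights differ by at most a factor two, once for all stages together.\<close>

lemma (in shaded_grid) stage_mass:
  fixes c :: "nat \<Rightarrow> real" and E :: "nat \<Rightarrow> (label \<times> pt set) set"
  assumes E0: "E 0 \<subseteq> EP" and w: "0 < w" "\<And>x. x \<in> E 0 \<Longrightarrow> w \<le> \<omega> x \<and> \<omega> x \<le> 2 * w"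
    and nest: "\<And>j. j < m \<Longrightarrow> E (Suc j) \<subseteq> E j"
    and c: "\<And>j. j \<in> {1..m} \<Longrightarrow> 0 < c j \<and> c j \<le> 1 \<and>
      c j * mass (parents X) (parent_shade (E (j - 1))) \<le> mass (parents X) (parent_shade (E j))"
  shows "inverse (2 ^ m) * (\<Prod>j=1..m. c j) * mass (children X) (shade1 X k (E 0))
    \<le> mass (children X) (shade1 X k (E m))"
proof (cases "m = 0")
  case True
  then show ?thesis by simp
next
  case False
  have sub: "E j \<subseteq> E 0" if "j \<le> m" for j
    using that
  proof (induction j)
    case (Suc j)
    then show ?case using nest[of j] by auto
  qed simp
  have EP: "E j \<subseteq> EP" if "j \<le> m" for j using sub[OF that] E0 by blast
  have h3: "0 < h ^ 3" using h by simp
  have card: "(\<Prod>i=1..j. c i) * real (card (E 0)) \<le> real (card (E j))" if "j \<le> m" for j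
    using that
  proof (induction j)
    case (Suc j)
    then have "c (Suc j) * (real (card (E j)) * h ^ 3) \<le> real (card (E (Suc j))) * h ^ 3" "0 < c (Suc j)"
      using c[of "Suc j"] parent_shade_mass[OF EP] by auto
    then have step: "c (Suc j) * real (card (E j)) \<le> real (card (E (Suc j)))"
      using h3 by (simp add: mult.assoc[symmetric])
    have "(\<Prod>i=1..Suc j. c i) * real (card (E 0)) = c (Suc j) * ((\<Prod>i=1..j. c i) * real (card (E 0)))" by simp
    also have "\<dots> \<le> c (Suc j) * real (card (E j))" using Suc \<open>0 < c (Suc j)\<close> by (intro mult_left_mono) auto
    finally show ?case using step by linarith
  qed simp
  have prod0: "0 \<le> (\<Prod>j=1..m. c j)" using c by (intro prod_nonneg) (auto intro: less_imp_le)
  have "sum \<omega> (E 0) \<le> (\<Sum>x\<in>E 0. 2 * w)" using w(2) by (intro sum_mono) blast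
  then have up: "sum \<omega> (E 0) \<le> 2 * w * real (card (E 0))" by (simp add: mult_ac)
  have "(\<Sum>x\<in>E m. w) \<le> sum \<omega> (E m)" using w(2) sub[of m] by (intro sum_mono) blast
  then have low: "w * real (card (E m)) \<le> sum \<omega> (E m)" by (simp add: mult_ac)
  have two: "inverse (2 ^ m) \<le> (1 / 2 :: real)"
  proof -
    have "(2::real) ^ 1 \<le> 2 ^ m" using False by (intro power_increasing) auto
    then show ?thesis by (simp add: field_simps)
  qed
  have nn: "0 \<le> sum \<omega> (E 0)" using w by (intro sum_nonneg) (meson less_le_trans less_imp_le)
  have "inverse (2 ^ m) * (\<Prod>j=1..m. c j) * sum \<omega> (E 0) \<le> (1 / 2) * (\<Prod>j=1..m. c j) * sum \<omega> (E 0)"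
    using two prod0 nn by (intro mult_right_mono) auto
  also have "\<dots> \<le> (1 / 2) * (\<Prod>j=1..m. c j) * (2 * w * real (card (E 0)))"
    using up prod0 by (intro mult_left_mono) auto
  also have "\<dots> = w * ((\<Prod>j=1..m. c j) * real (card (E 0)))" by simp
  also have "\<dots> \<le> w * real (card (E m))" using card[of m] w(1) by (intro mult_left_mono) auto
  also note low
  finally show ?thesis by (simp add: mass_shade1[OF E0] mass_shade1[OF EP])
qed

lemma parent_shade_in_enlarged_box:
  assumes grid: "shaded_grid X h" and E: "E \<subseteq> positive_graph X h k"
    and B: "orthonormal (frame (pbox X B))"
    and sub: "\<And>t. t \<in> children_of X B \<Longrightarrow> shade X t \<subseteq> box_set (pbox X B)"
  shows "parent_shade E B \<subseteq> box_set (enlarge h (pbox X B))"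
proof
  interpret shaded_grid X h k by (rule grid)
  fix x assume "x \<in> parent_shade E B"
  then obtain Q where Q: "(B, Q) \<in> positive_graph X h k" "x \<in> Q" using E by (auto simp: parent_shade_def)
  obtain t z where t: "t \<in> children_of X B" "z \<in> shade0 X k t" "z \<in> Q" using edge_meets_shade[OF Q(1)] by blast
  have "z \<in> box_set (pbox X B)" using sub[OF t(1)] t(2) by (auto simp: shade0_def)
  then have z: "\<bar>coord (pbox X B) i z\<bar> \<le> halfside (pbox X B) i" for i by (simp add: box_set_coord)
  have "dist x z \<le> sqrt 3 * h" using cell_diameter[of x h _ z] EP_cells[OF Q(1)] Q(2) t(3) by (auto simp: cells_def)
  then have "\<bar>coord (pbox X B) i x\<bar> \<le> halfside (pbox X B) i + sqrt 3 * h" for i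
    using coord_dist[OF B, of i x z] z[of i] by linarith
  then show "x \<in> box_set (enlarge h (pbox X B))" unfolding box_set_coord by (simp add: enlarge_def coord_def)
qed

lemma shaded_gridI:
  assumes K: "constants_within C K" and "0 < \<delta>" "0 < r" "0 < h"
    and X: "shaded_family X" and F1: "F1 K \<delta> a b r X" and F3: "F3 Ccomp h \<delta> X"
  shows "shaded_grid X h"
proof
  show "0 < h" "finite (parents X)" "finite (children X)" "finite (active_cells h X)"
    using assms by (auto simp: shaded_family_def F3_def)
  fix t assume t: "t \<in> children X"
  show P: "parent_of X t \<in> parents X" "shade X t \<in> sets lebesgue" using X t by (auto simp: shaded_family_def)
  have "is_tube K \<delta> r (tube X t)" using F1 P t by (auto simp: F1_def children_of_def)
  then obtain p q s where "tube X t = segment_tube p q s" using is_tube_segment[OF K] assms by blast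
  then have "bounded (tube X t)" by (simp add: segment_tube_bounded)
  then show "bounded (shade X t)" by (rule bounded_subset) (use X t in \<open>auto simp: shaded_family_def\<close>)
qed

lemma F4_guided_slab_frostman:
  assumes K: "constants_within C K" and scales: "0 < \<delta>" "\<delta> \<le> a" "a \<le> b" "b \<le> r"
    and X: "shaded_family X" and F1: "F1 K \<delta> a b r X"
    and B: "B \<in> parents X" and ne: "children_of X B \<noteq> {}"
  shows "F4 K \<delta> a r X (Ordinary CF) \<Longrightarrow> 1 \<le> CF \<and> (\<exists>G. guided_slab_frostman C a b r CF 0 X B G)"
    and "F4 K \<delta> a r X (Biased \<sigma> C0) \<Longrightarrow> 1 \<le> C0 \<and> (\<exists>G. guided_slab_frostman C a b r C0 \<sigma> X B G)"
    and "F4 K \<delta> a r X (Coarse \<rho> CF R S) \<Longrightarrow> 1 \<le> CF \<and> (\<exists>G. guided_slab_frostman C a b r (CF * R) 0 X B G)"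
proof -
  have pos: "0 < a" "0 < b" "0 < r" "0 < C" using scales K by (auto simp: constants_within_def)
  have box: "is_box K a b r (pbox X B)" using F1 B by (simp add: F1_def)
  have fin: "finite (children_of X B)" using X by (simp add: shaded_family_def children_of_def)
  have inside: "tube X t \<subseteq> box_set (pbox X B)" if "t \<in> children_of X B" for t using F1 B that by (auto simp: F1_def)
  have guide: "\<exists>p q s. U = segment_tube p q s \<and> r / C \<le> dist p q \<and> 0 \<le> s \<and> s \<le> C * a"
    if U: "is_tube K w r U" and w: "0 < w" "w \<le> a" for U w
  proof -
    obtain p q s where U: "U = segment_tube p q s" "r / C \<le> dist p q" "w / C \<le> s" "s \<le> C * w"
      using is_tube_segment[OF K U w(1) pos(3)] by blast
    have "0 \<le> w / C" "C * w \<le> C * a" using w pos by (auto intro: mult_left_mono)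
    then have "0 \<le> s" "s \<le> C * a" using U(3,4) by linarith+
    then show ?thesis using U(1,2) by blast
  qed
  have tubes: "\<forall>t\<in>children_of X B. (\<exists>p q s. tube X t = segment_tube p q s \<and> r / C \<le> dist p q \<and> 0 \<le> s \<and> s \<le> C * a) \<and>
      tube X t \<subseteq> tube X t \<and> tube X t \<subseteq> box_set (pbox X B)"
    using guide[OF _ scales(1,2)] inside F1 B by (simp add: F1_def)
  show "1 \<le> CF \<and> (\<exists>G. guided_slab_frostman C a b r CF 0 X B G)" if F4: "F4 K \<delta> a r X (Ordinary CF)"
  proof -
    have one: "(0::real) < 1 + 0" by simp
    have frost: "real (card {t \<in> children_of X B. tube X t \<subseteq> V}) / real (card (children_of X B))
        \<le> CF * (vol V / vol (box_set (pbox X B))) powr (1 + 0)"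
      if "convex V" "V \<subseteq> box_set (pbox X B)" for V
      using F4 B that by simp
    show ?thesis
    proof (intro conjI exI[of _ "tube X"])
      show "1 \<le> CF" by (rule convex_frostman_slabs(1)[OF K box pos(1) scales(3,4) fin ne inside one frost])
      show "guided_slab_frostman C a b r CF 0 X B (tube X)" unfolding guided_slab_frostman_def
        using tubes convex_frostman_slabs(2)[OF K box pos(1) scales(3,4) fin ne inside one frost] by blast
    qed
  qed
  show "1 \<le> C0 \<and> (\<exists>G. guided_slab_frostman C a b r C0 \<sigma> X B G)" if F4: "F4 K \<delta> a r X (Biased \<sigma> C0)"
  proof -
    have one: "0 < 1 + \<sigma>" using F4 by simp
    have frost: "real (card {t \<in> children_of X B. tube X t \<subseteq> V}) / real (card (children_of X B))
        \<le> C0 * (vol V / vol (box_set (pbox X B))) powr (1 + \<sigma>)"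
      if "convex V" "V \<subseteq> box_set (pbox X B)" for V
      using F4 B that by simp
    show ?thesis
    proof (intro conjI exI[of _ "tube X"])
      show "1 \<le> C0" by (rule convex_frostman_slabs(1)[OF K box pos(1) scales(3,4) fin ne inside one frost])
      show "guided_slab_frostman C a b r C0 \<sigma> X B (tube X)" unfolding guided_slab_frostman_def
        using tubes convex_frostman_slabs(2)[OF K box pos(1) scales(3,4) fin ne inside one frost] by blast
    qed
  qed
  show "1 \<le> CF \<and> (\<exists>G. guided_slab_frostman C a b r (CF * R) 0 X B G)" if F4: "F4 K \<delta> a r X (Coarse \<rho> CF R S)"
  proof -
    have \<rho>: "\<delta> \<le> \<rho>" "\<rho> \<le> a" "1 \<le> R" using F4 by auto
    have lab: "finite (coarse_labels S B)" "coarse_labels S B \<noteq> {}" using F4 B by auto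
    have ct: "is_tube K \<rho> r (coarse_tube S B s)" "coarse_tube S B s \<subseteq> box_set (pbox X B)"
      if "s \<in> coarse_labels S B" for s using F4 B that by auto
    have frost: "real (card {s \<in> coarse_labels S B. coarse_tube S B s \<subseteq> V}) / real (card (coarse_labels S B))
        \<le> CF * (vol V / vol (box_set (pbox X B)))"
      if "convex V" "V \<subseteq> box_set (pbox X B)" for V using F4 B that by simp
    have assigned: "coarse_of S t \<in> coarse_labels S B" "tube X t \<subseteq> coarse_tube S B (coarse_of S t)"
      if "t \<in> children_of X B" for t using F4 B that by auto
    obtain m :: real where m: "1 \<le> m" "\<And>s. s \<in> coarse_labels S B \<Longrightarrow> m \<le> real (coarse_load X S B s)"
        "\<And>s. s \<in> coarse_labels S B \<Longrightarrow> real (coarse_load X S B s) \<le> R * m"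
      using F4 B unfolding F4.simps by blast
    show ?thesis
    proof (intro conjI exI[of _ "\<lambda>t. coarse_tube S B (coarse_of S t)"])
      show "1 \<le> CF" by (rule coarse_slabs(1)[OF K box pos(1) scales(3,4) fin lab ct(2) frost assigned(1) m \<rho>(3)])
      have "0 < \<rho>" using \<rho> scales by linarith
      then have "\<forall>t\<in>children_of X B. (\<exists>p q s. coarse_tube S B (coarse_of S t) = segment_tube p q s
            \<and> r / C \<le> dist p q \<and> 0 \<le> s \<and> s \<le> C * a) \<and>
          tube X t \<subseteq> coarse_tube S B (coarse_of S t) \<and> coarse_tube S B (coarse_of S t) \<subseteq> box_set (pbox X B)"
        using guide[OF ct(1) _ \<rho>(2)] assigned ct(2) by blast
      then show "guided_slab_frostman C a b r (CF * R) 0 X B (\<lambda>t. coarse_tube S B (coarse_of S t))"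
        unfolding guided_slab_frostman_def add_0_right
        using coarse_slabs(2)[OF K box pos(1) scales(3,4) fin lab ct(2) frost assigned(1) m \<rho>(3)] by blast
    qed
  qed
qed

theorem theorem8p2:
  fixes K :: structure_constants and Ccomp \<epsilon> :: real
  assumes "admissible_constants K" and "1 \<le> Ccomp" and "0 < \<epsilon>"
  shows "\<exists>(c_bias :: real \<Rightarrow> real) (c_ord :: real) (c_coarse :: real).
    (\<forall>\<sigma>. 0 < \<sigma> \<and> \<sigma> \<le> 1 \<longrightarrow> 0 < c_bias \<sigma>) \<and> 0 < c_ord \<and> 0 < c_coarse \<and>
    (\<forall>(m\<^sub>0::nat) (\<delta>::real) (a::real) (b::real) (r::real) (h::real) (D::real) (\<kappa>::real)
       (X::configuration) (alt::alternative).
      0 < \<delta> \<and> \<delta> \<le> a \<and> a \<le> b \<and> b \<le> r \<and> r \<le> 1 \<and> h = grid_ratio K * a \<and>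
      shaded_family X \<and> 0 < total_mass X \<and>
      F1 K \<delta> a b r X \<and> F2 D \<kappa> X \<and> F3 Ccomp h \<delta> X \<and> F4 K \<delta> a r X alt
      \<longrightarrow>
      (\<exists>k. common_inner_level X k) \<and>
      (\<forall>k. common_inner_level X k \<longrightarrow>
        (\<exists>(E\<^sub>2 :: (label \<times> pt set) set) (\<mu>::real) (d\<^sub>0::real).
          E\<^sub>2 \<subseteq> positive_graph X h k \<and> \<mu> = 2 ^ k \<and> 1 \<le> \<mu> \<and> 1 \<le> d\<^sub>0 \<and>
          (\<forall>B\<in>parents X. parent_shade E\<^sub>2 B \<subseteq> box_set (enlarge h (pbox X B))) \<and>
          mass (children X) (shade1 X k E\<^sub>2) \<ge> inverse (L0 X h k) * total_mass X \<and>
          (\<forall>t\<in>children X. shade1 X k E\<^sub>2 t \<subseteq> parent_shade E\<^sub>2 (parent_of X t)) \<and>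
          (\<forall>t\<in>children X - retained_children X E\<^sub>2. shade1 X k E\<^sub>2 t = {}) \<and>
          (\<forall>B\<in>parents X. \<forall>x\<in>shadow (children_of X B) (shade1 X k E\<^sub>2).
            \<mu> \<le> multiplicity_at (children_of X B) (shade1 X k E\<^sub>2) x \<and>
            multiplicity_at (children_of X B) (shade1 X k E\<^sub>2) x < 2 * \<mu>) \<and>
          (\<forall>x\<in>shadow (parents X) (parent_shade E\<^sub>2).
            d\<^sub>0 \<le> multiplicity_at (parents X) (parent_shade E\<^sub>2) x \<and>
            multiplicity_at (parents X) (parent_shade E\<^sub>2) x < 2 * d\<^sub>0) \<and>
          (\<forall>x. multiplicity_at (children X) (shade1 X k E\<^sub>2) x < 4 * \<mu> * d\<^sub>0) \<and>
          shading_density (retained_parents E\<^sub>2) (\<lambda>B. box_set (enlarge h (pbox X B))) (parent_shade E\<^sub>2)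
            \<ge> (case alt of
                 Biased \<sigma> C\<^sub>0 \<Rightarrow>
                   c_bias \<sigma> * C\<^sub>0 powr (- (2 - \<sigma>)) * (a / b) powr \<epsilon> * \<kappa> powr (- (2 - \<sigma>))
                     * L0 X h k powr (- (2 - \<sigma>))
                     * shading_density (children X) (tube X) (shade X) powr (2 - \<sigma>)
               | Ordinary C\<^sub>F \<Rightarrow>
                   c_ord * inverse C\<^sub>F * inverse (ln (2 * b / a)) * inverse (\<kappa> ^ 2)
                     * inverse (L0 X h k ^ 2)
                     * shading_density (children X) (tube X) (shade X) ^ 2
               | Coarse \<rho> C\<^sub>F R S \<Rightarrow>
                   c_coarse * inverse C\<^sub>F * inverse (R ^ 3) * inverse (ln (2 * b / a))
                     * inverse (\<kappa> ^ 2) * inverse (L0 X h k ^ 2)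
                     * shading_density (children X) (tube X) (shade X) ^ 2) \<and>
          (\<forall>(m::nat) (E :: nat \<Rightarrow> (label \<times> pt set) set) (c :: nat \<Rightarrow> real).
            m \<le> m\<^sub>0 \<and> E 0 = E\<^sub>2 \<and> (\<forall>j<m. E (Suc j) \<subseteq> E j) \<and>
            (\<forall>j\<in>{1..m}. 0 < c j \<and> c j \<le> 1 \<and>
              mass (parents X) (parent_shade (E j)) \<ge> c j * mass (parents X) (parent_shade (E (j - 1))))
            \<longrightarrow>
            mass (children X) (stage_shade X k E\<^sub>2 (E m))
              \<ge> inverse (L0 X h k) * inverse (2 ^ m) * (\<Prod>j=1..m. c j) * total_mass X \<and>
            inverse (L0 X h k) * inverse (2 ^ m) * (\<Prod>j=1..m. c j) * total_mass X
              = inverse (L0 X h k * (\<Prod>j=1..m. 2 / c j)) * total_mass X \<and>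
            (\<forall>c_min. 0 < c_min \<and> c_min \<le> 1 \<and> (\<forall>j\<in>{1..m}. c_min \<le> c j) \<longrightarrow>
              L0 X h k * (\<Prod>j=1..m. 2 / c j) \<le> L0 X h k * (2 / c_min) ^ m\<^sub>0) \<and>
            (\<forall>j\<le>m.
              (\<forall>B\<in>parents X.
                parent_shade (E j) B
                  = cell_hull h (shadow (children_of X B) (stage_shade X k E\<^sub>2 (E j))) \<and>
                (\<forall>x\<in>shadow (children_of X B) (stage_shade X k E\<^sub>2 (E j)).
                  \<mu> \<le> multiplicity_at (children_of X B) (stage_shade X k E\<^sub>2 (E j)) x \<and>
                  multiplicity_at (children_of X B) (stage_shade X k E\<^sub>2 (E j)) x < 2 * \<mu>)) \<and>
              (\<forall>x. multiplicity_at (children X) (stage_shade X k E\<^sub>2 (E j)) x < 4 * \<mu> * d\<^sub>0))))))"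
proof -
  obtain C where K: "constants_within C K" using exists_constants_within[OF assms(1)] by blast
  have C: "0 < C" using K by (simp add: constants_within_def)
  define c0 where "c0 = 1 / (32 * C ^ 3 * parent_constant C)"
  have PC: "0 < parent_constant C" unfolding parent_constant_def using C by (intro mult_pos_pos add_pos_pos) auto
  have c0: "0 < c0" using C PC by (simp add: c0_def)
  show ?thesis
    (is "\<exists>cb co cc. _ \<and> _ \<and> _ \<and> (\<forall>m \<delta> a b r h D \<kappa> X alt. _ \<longrightarrow> _ \<and>
      (\<forall>k. _ \<longrightarrow> ?regularised cb co cc m \<delta> a b r h D \<kappa> X alt k))")
  proof (intro exI[of _ "\<lambda>_. c0 * (\<epsilon> / 2 powr \<epsilon>)"] exI[of _ c0] conjI allI impI)
    show "0 < c0 * (\<epsilon> / 2 powr \<epsilon>)" using c0 assms(3) by simp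
    show "0 < c0" "0 < c0" by (rule c0)+
    fix m\<^sub>0 :: nat and \<delta> a b r h D \<kappa> :: real and X :: configuration and alt :: alternative
    assume "0 < \<delta> \<and> \<delta> \<le> a \<and> a \<le> b \<and> b \<le> r \<and> r \<le> 1 \<and> h = grid_ratio K * a \<and>
      shaded_family X \<and> 0 < total_mass X \<and>
      F1 K \<delta> a b r X \<and> F2 D \<kappa> X \<and> F3 Ccomp h \<delta> X \<and> F4 K \<delta> a r X alt"
    then have scales: "0 < \<delta>" "\<delta> \<le> a" "a \<le> b" "b \<le> r" and h_eq: "h = grid_ratio K * a"
      and X: "shaded_family X" and tot: "0 < total_mass X"
      and F1: "F1 K \<delta> a b r X" and F2: "F2 D \<kappa> X" and F3: "F3 Ccomp h \<delta> X" and F4: "F4 K \<delta> a r X alt" by auto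
    have pos: "0 < a" "0 < b" "0 < r" using scales by auto
    have "0 < 1 / C" using C by simp
    then have "0 < grid_ratio K" using K unfolding constants_within_def by linarith
    then have h0: "0 < h" using pos by (simp add: h_eq)
    have grid: "shaded_grid X h" by (rule shaded_gridI[OF K scales(1) pos(3) h0 X F1 F3])
    show "\<exists>k. common_inner_level X k" by (rule shaded_grid.common_inner_level_exists(1)[OF grid tot])
    fix k assume k: "common_inner_level X k"
    interpret shaded_grid X h k by (rule grid)
    let ?L = "L0 X h k"
    define e where "e = real (card (positive_graph X h k))"
    define LN where "LN = real_of_int \<lceil>log 2 (real (N_max X))\<rceil>"
    have "0 \<le> log 2 (real (N_max X))" using common_inner_level_exists(2)[OF tot] by simp
    then have LN: "0 \<le> LN" unfolding LN_def by linarith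
    have mass0: "total_mass X \<le> (1 + LN) * sum \<omega> EP"
    proof -
      have "inverse (1 + LN) * total_mass X \<le> sum \<omega> EP"
        using k mass_shade0 by (simp add: common_inner_level_def LN_def)
      then have "(1 + LN) * (inverse (1 + LN) * total_mass X) \<le> (1 + LN) * sum \<omega> EP"
        using LN by (intro mult_left_mono) auto
      then show ?thesis using LN by (simp add: mult.assoc[symmetric])
    qed
    have EPne: "EP \<noteq> {}" using mass0 tot by auto
    have e1: "1 \<le> e" using EPne EP_finite by (simp add: e_def card_gt_0_iff Suc_le_eq)
    have \<omega>pos: "0 < \<omega> x" if "x \<in> EP" for x using that EP_cells by (cases x) auto
    obtain E\<^sub>2 w d\<^sub>0 where E2: "E\<^sub>2 \<subseteq> EP" and w0: "0 < w" and d: "1 \<le> d\<^sub>0"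
      and wb: "\<And>x. x \<in> E\<^sub>2 \<Longrightarrow> w \<le> \<omega> x \<and> \<omega> x \<le> 2 * w"
      and deg: "\<And>Q. Q \<in> snd ` E\<^sub>2 \<Longrightarrow> d\<^sub>0 \<le> real (card {B. (B, Q) \<in> E\<^sub>2}) \<and> real (card {B. (B, Q) \<in> E\<^sub>2}) < 2 * d\<^sub>0"
      and keep: "sum \<omega> EP \<le> 4 * (1 + of_int \<lceil>log 2 (2 * real (card EP))\<rceil>) * (1 + of_int \<lceil>log 2 (real (card EP))\<rceil>) * sum \<omega> E\<^sub>2"
      by (rule regular_subgraph[OF EP_finite EPne \<omega>pos]) (assumption | rule that)+
    note w = w0 wb
    have L: "?L = (1 + LN) * (4 * (1 + of_int \<lceil>log 2 (2 * e)\<rceil>) * (1 + of_int \<lceil>log 2 e\<rceil>))"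
      by (simp only: L0_def Let_def e_def LN_def mult_ac)
    have Lpos: "0 < ?L"
    proof -
      have "0 \<le> log 2 (2 * e)" "0 \<le> log 2 e" using e1 by auto
      then have "0 \<le> \<lceil>log 2 (2 * e)\<rceil>" "0 \<le> \<lceil>log 2 e\<rceil>" by linarith+
      then show ?thesis unfolding L using LN by (intro mult_pos_pos add_pos_nonneg) auto
    qed
    have "total_mass X \<le> ?L * sum \<omega> E\<^sub>2"
    proof -
      have "(1 + LN) * sum \<omega> EP \<le> (1 + LN) * (4 * (1 + of_int \<lceil>log 2 (2 * e)\<rceil>) * (1 + of_int \<lceil>log 2 e\<rceil>) * sum \<omega> E\<^sub>2)"
        using keep LN unfolding e_def by (intro mult_left_mono) auto
      then show ?thesis using mass0 unfolding L by (simp only: mult.assoc)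
    qed
    then have mass1: "inverse ?L * total_mass X \<le> mass (children X) (shade1 X k E\<^sub>2)"
      using Lpos by (simp add: mass_shade1[OF E2] field_simps)
    have E2ne: "E\<^sub>2 \<noteq> {}"
    proof
      assume "E\<^sub>2 = {}"
      then have "sum \<omega> E\<^sub>2 = 0" by simp
      then have "inverse ?L * total_mass X \<le> 0" using mass1 mass_shade1[OF E2] by linarith
      then show False using Lpos tot by (simp add: mult_le_0_iff)
    qed
    have ne: "children_of X B \<noteq> {}" if "B \<in> parents X" for B
    proof
      assume "children_of X B = {}"
      then show False using F2 that by (force simp: F2_def)
    qed
    have D: "1 \<le> \<kappa>" using F2 by (simp add: F2_def)
    define lam where "lam = shading_density (children X) (tube X) (shade X)"
    have lam0: "0 \<le> lam" unfolding lam_def shading_density_def mass_def by (intro divide_nonneg_nonneg sum_nonneg) auto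
    obtain B0 where B0: "B0 \<in> parents X" using E2ne E2 EP_cells by fastforce
    have dens: "c0 * inverse CF * inverse (ln (2 * b / a)) * (lam / (\<kappa> * ?L)) powr (2 - \<sigma>)
        \<le> shading_density (retained_parents E\<^sub>2) (\<lambda>B. box_set (enlarge h (pbox X B))) (parent_shade E\<^sub>2)"
      if "0 \<le> \<sigma>" "\<sigma> \<le> 1" "1 \<le> CF" "\<And>B. B \<in> parents X \<Longrightarrow> \<exists>G. guided_slab_frostman C a b r CF \<sigma> X B G" for CF \<sigma>
      unfolding c0_def lam_def
      by (rule density_lower_bound[OF K scales h_eq X F1 F2 grid E2 E2ne that Lpos mass1])
    have Lab: "0 < ln (2 * b / a)" using scales pos by (intro ln_gt_zero) (simp add: less_divide_eq)
    have guided: "F4 K \<delta> a r X (Ordinary CF) \<Longrightarrow> 1 \<le> CF \<and> (\<exists>G. guided_slab_frostman C a b r CF 0 X B G)"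
      "F4 K \<delta> a r X (Biased \<sigma> CF) \<Longrightarrow> 1 \<le> CF \<and> (\<exists>G. guided_slab_frostman C a b r CF \<sigma> X B G)"
      "F4 K \<delta> a r X (Coarse \<rho> CF R S) \<Longrightarrow> 1 \<le> CF \<and> (\<exists>G. guided_slab_frostman C a b r (CF * R) 0 X B G)"
      if "B \<in> parents X" for B CF \<sigma> \<rho> R S
      by (rule F4_guided_slab_frostman[OF K scales X F1 that ne[OF that]]; assumption)+
    have density: "(case alt of
           Biased \<sigma> C\<^sub>0 \<Rightarrow> c0 * (\<epsilon> / 2 powr \<epsilon>) * C\<^sub>0 powr (- (2 - \<sigma>)) * (a / b) powr \<epsilon> * \<kappa> powr (- (2 - \<sigma>))
             * ?L powr (- (2 - \<sigma>)) * lam powr (2 - \<sigma>)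
         | Ordinary C\<^sub>F \<Rightarrow> c0 * inverse C\<^sub>F * inverse (ln (2 * b / a)) * inverse (\<kappa> ^ 2) * inverse (?L ^ 2) * lam ^ 2
         | Coarse \<rho> C\<^sub>F R S \<Rightarrow> c0 * inverse C\<^sub>F * inverse (R ^ 3) * inverse (ln (2 * b / a))
             * inverse (\<kappa> ^ 2) * inverse (?L ^ 2) * lam ^ 2)
        \<le> shading_density (retained_parents E\<^sub>2) (\<lambda>B. box_set (enlarge h (pbox X B))) (parent_shade E\<^sub>2)"
      (is "_ \<le> ?dens")
    proof -
      have sq: "(lam / (\<kappa> * ?L)) powr (2 - 0) = inverse (\<kappa> ^ 2) * inverse (?L ^ 2) * lam ^ 2"
        using lam0 D Lpos by (simp add: powr_numeral power_divide power_mult_distrib divide_inverse power_inverse mult_ac)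
      show ?thesis
      proof (cases alt)
        case (Ordinary CF)
        have "1 \<le> CF" using guided(1)[OF B0] F4 Ordinary by auto
        then have "c0 * inverse CF * inverse (ln (2 * b / a)) * (lam / (\<kappa> * ?L)) powr (2 - 0) \<le> ?dens"
          using guided(1) F4 Ordinary by (intro dens) auto
        then show ?thesis unfolding sq by (simp add: Ordinary mult_ac)
      next
        case (Biased \<sigma> C0)
        have \<sigma>: "0 < \<sigma>" "\<sigma> \<le> 1" using F4 Biased by auto
        have C0: "1 \<le> C0" using guided(2)[OF B0] F4 Biased by auto
        then have *: "c0 * inverse C0 * inverse (ln (2 * b / a)) * (lam / (\<kappa> * ?L)) powr (2 - \<sigma>) \<le> ?dens"
          using guided(2) F4 Biased \<sigma> by (intro dens) auto
        have split: "(lam / (\<kappa> * ?L)) powr (2 - \<sigma>) = \<kappa> powr (- (2 - \<sigma>)) * ?L powr (- (2 - \<sigma>)) * lam powr (2 - \<sigma>)"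
        proof -
          have "(lam / (\<kappa> * ?L)) powr q = lam powr q / (\<kappa> powr q * ?L powr q)" for q
            using lam0 D Lpos by (simp add: powr_divide powr_mult)
          then show ?thesis by (simp only: powr_minus_divide) simp
        qed
        have "C0 powr (- (2 - \<sigma>)) \<le> C0 powr (- 1)" using C0 \<sigma> by (intro powr_mono) auto
        \<comment> \<open>The proof loses only the first power of the constant, which is at least one.\<close>
        then have Cle: "C0 powr (- (2 - \<sigma>)) \<le> inverse C0" using C0 by (simp add: powr_minus)
        have "c0 * (\<epsilon> / 2 powr \<epsilon>) * C0 powr (- (2 - \<sigma>)) * (a / b) powr \<epsilon> * \<kappa> powr (- (2 - \<sigma>))
             * ?L powr (- (2 - \<sigma>)) * lam powr (2 - \<sigma>)
            = c0 * (C0 powr (- (2 - \<sigma>)) * (\<epsilon> / 2 powr \<epsilon> * (a / b) powr \<epsilon>)) * (lam / (\<kappa> * ?L)) powr (2 - \<sigma>)"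
          unfolding split by (simp only: mult_ac)
        also have "\<dots> \<le> c0 * (inverse C0 * inverse (ln (2 * b / a))) * (lam / (\<kappa> * ?L)) powr (2 - \<sigma>)"
          using c0 C0 Cle inverse_log_ge_power[OF pos(1) scales(3) assms(3)] assms(3)
          by (intro mult_right_mono mult_left_mono mult_mono) auto
        also have "\<dots> \<le> ?dens" using * by (simp only: mult.assoc)
        finally show ?thesis by (simp add: Biased)
      next
        case (Coarse \<rho> CF R S)
        have F4': "F4 K \<delta> a r X (Coarse \<rho> CF R S)" using F4 by (simp only: Coarse)
        have R: "1 \<le> R" using F4' by (simp only: F4.simps)
        have CF: "1 \<le> CF" using guided(3)[OF B0 F4'] by (rule conjunct1)
        then have "1 * 1 \<le> CF * R" using R by (intro mult_mono) auto
        then have *: "c0 * inverse (CF * R) * inverse (ln (2 * b / a)) * (lam / (\<kappa> * ?L)) powr (2 - 0) \<le> ?dens"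
          using guided(3)[OF _ F4'] by (intro dens) auto
        have "R \<le> R ^ 3" using R power_increasing[of 1 3 R] by simp
        then have R3: "inverse (R ^ 3) \<le> inverse R" using R by (intro le_imp_inverse_le) auto
        have "c0 * inverse CF * inverse (R ^ 3) * inverse (ln (2 * b / a)) * inverse (\<kappa> ^ 2) * inverse (?L ^ 2) * lam ^ 2
            = inverse (R ^ 3) * (c0 * inverse CF * inverse (ln (2 * b / a)) * (inverse (\<kappa> ^ 2) * inverse (?L ^ 2) * lam ^ 2))"
          by (simp only: mult_ac)
        also have "\<dots> \<le> inverse R * (c0 * inverse CF * inverse (ln (2 * b / a)) * (inverse (\<kappa> ^ 2) * inverse (?L ^ 2) * lam ^ 2))"
          using R3 c0 CF Lab by (intro mult_right_mono) auto
        also have "\<dots> \<le> ?dens" using * unfolding sq by (simp add: mult_ac)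
        finally show ?thesis by (simp add: Coarse)
      qed
    qed
    have box: "orthonormal (frame (pbox X B))" "t \<in> children_of X B \<Longrightarrow> shade X t \<subseteq> box_set (pbox X B)"
      if "B \<in> parents X" for B t
    proof -
      show "orthonormal (frame (pbox X B))" using F1 that by (auto simp: F1_def intro: is_box_frame)
      assume t: "t \<in> children_of X B"
      then have "tube X t \<subseteq> box_set (pbox X B)" using F1 that by (auto simp: F1_def)
      moreover have "shade X t \<subseteq> tube X t" using X children_ofD[OF t] by (auto simp: shaded_family_def)
      ultimately show "shade X t \<subseteq> box_set (pbox X B)" by blast
    qed
    have d0: "0 < d\<^sub>0" using d by simp
    have deg2: "\<And>Q. Q \<in> snd ` E\<^sub>2 \<Longrightarrow> real (card {B. (B, Q) \<in> E\<^sub>2}) < 2 * d\<^sub>0" using deg by blast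
    have stage_mass: "mass (children X) (stage_shade X k E\<^sub>2 (E m)) \<ge> inverse ?L * inverse (2 ^ m) * (\<Prod>j=1..m. c j) * total_mass X"
        (is ?mass)
      and stage_shapes: "\<forall>j\<le>m. (\<forall>B\<in>parents X.
          parent_shade (E j) B = cell_hull h (shadow (children_of X B) (stage_shade X k E\<^sub>2 (E j))) \<and>
          (\<forall>x\<in>shadow (children_of X B) (stage_shade X k E\<^sub>2 (E j)).
            2 ^ k \<le> multiplicity_at (children_of X B) (stage_shade X k E\<^sub>2 (E j)) x \<and>
            multiplicity_at (children_of X B) (stage_shade X k E\<^sub>2 (E j)) x < 2 * 2 ^ k)) \<and>
        (\<forall>x. multiplicity_at (children X) (stage_shade X k E\<^sub>2 (E j)) x < 4 * 2 ^ k * d\<^sub>0)" (is ?multiplicities)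
      if E0: "E 0 = E\<^sub>2" and nest: "\<And>j. j < m \<Longrightarrow> E (Suc j) \<subseteq> E j"
        and c: "\<And>j. j \<in> {1..m} \<Longrightarrow> 0 < c j \<and> c j \<le> 1 \<and>
          c j * mass (parents X) (parent_shade (E (j - 1))) \<le> mass (parents X) (parent_shade (E j))"
      for m :: nat and E :: "nat \<Rightarrow> (label \<times> pt set) set" and c :: "nat \<Rightarrow> real"
    proof -
      have sub: "E j \<subseteq> E\<^sub>2" if "j \<le> m" for j
        using that
      proof (induction j)
        case (Suc j)
        then show ?case using nest[of j] by auto
      qed (simp add: E0)
      have stage: "stage_shade X k E\<^sub>2 (E j) = shade1 X k (E j)" if "j \<le> m" for j
        by (rule stage_shade_eq[OF sub[OF that]])
      have "inverse ?L * inverse (2 ^ m) * (\<Prod>j=1..m. c j) * total_mass X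
          = inverse (2 ^ m) * (\<Prod>j=1..m. c j) * (inverse ?L * total_mass X)" by (simp only: mult_ac)
      also have "\<dots> \<le> inverse (2 ^ m) * (\<Prod>j=1..m. c j) * mass (children X) (shade1 X k (E 0))"
        using mass1 c unfolding E0 by (intro mult_left_mono mult_nonneg_nonneg prod_nonneg) (auto intro: less_imp_le)
      also have "\<dots> \<le> mass (children X) (shade1 X k (E m))"
        using E2 w nest c by (intro shaded_grid.stage_mass[OF grid, of E k w]) (simp_all add: E0)
      finally show ?mass by (simp only: stage[OF order_refl])
      show ?multiplicities
        using parent_shade_hull[OF order_trans[OF sub E2]] inner_multiplicity
          total_multiplicity[OF sub E2 d0 deg2] by (simp add: stage)
    qed
    show "?regularised (\<lambda>_. c0 * (\<epsilon> / 2 powr \<epsilon>)) c0 c0 m\<^sub>0 \<delta> a b r h D \<kappa> X alt k"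
    proof (rule exI[of _ E\<^sub>2], rule exI[of _ "2 ^ k :: real"], rule exI[of _ d\<^sub>0], intro conjI, goal_cases)
      case 5
      show ?case using parent_shade_in_enlarged_box[OF grid E2] box by blast
    next
      case 8
      show ?case
        by (auto simp: shade1_def parent_shade_def retained_children_def retained_parents_def children_of_def)
    next
      case 9
      show ?case using inner_multiplicity by blast
    next
      case 10
      show ?case
      proof (rule ballI)
        fix x assume x: "x \<in> shadow (parents X) (parent_shade E\<^sub>2)"
        obtain Q where Q: "Q \<in> snd ` E\<^sub>2"
          and mult: "multiplicity_at (parents X) (parent_shade E\<^sub>2) x = real (card {B. (B, Q) \<in> E\<^sub>2})"
          using outer_multiplicity[OF E2 x] by (elim bexE)
        show "d\<^sub>0 \<le> multiplicity_at (parents X) (parent_shade E\<^sub>2) x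
            \<and> multiplicity_at (parents X) (parent_shade E\<^sub>2) x < 2 * d\<^sub>0"
          unfolding mult by (rule deg[OF Q])
      qed
    next
      case 11
      show ?case using total_multiplicity[OF order_refl E2 d0 deg2] by blast
    next
      case 12
      show ?case using density unfolding lam_def .
    next
      case 13
      show ?case
      proof (intro allI impI, goal_cases)
        case H: (1 m E c)
        then have c1: "0 < c j \<and> c j \<le> 1" if "j \<in> {1..m}" for j using that by blast
        have m: "m \<le> m\<^sub>0" using H by blast
        show ?case
        proof (intro conjI, goal_cases)
          case 1
          show ?case by (rule stage_mass) (use H in blast)+
        next
          case 2
          show ?case by (simp only: stage_mass_bookkeeping(1)[OF Lpos c1])
        next
          case 3
          show ?case
          proof (intro allI impI)
            fix c_min :: real
            assume cm: "0 < c_min \<and> c_min \<le> 1 \<and> (\<forall>j\<in>{1..m}. c_min \<le> c j)"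
            show "?L * (\<Prod>j=1..m. 2 / c j) \<le> ?L * (2 / c_min) ^ m\<^sub>0"
              by (rule stage_mass_bookkeeping(2)[where m = m and c = c, OF Lpos c1]) (use cm m in auto)
          qed
        next
          case 4
          show ?case by (rule stage_shapes) (use H in blast)+
        qed
      qed
    qed (use E2 d mass1 in \<open>auto simp: shade1_def\<close>)
  qed
qed

end
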